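(* Let $Y_{ij}$, $1\le i\le j<\infty$, be a triangular array of real random variables, let $Y_{ji}=Y_{ij}$ for $i<j$, and let $\mathbf{Y}_n=\{Y_{ij}\}_{i,j=1}^n$. Assume that for each $n$ the entries $Y_{ij}$, $1\le i\le j\le n$, are independent and have Gaussian distribution with $\mathbb{E}Y_{ij}=0$, $\mathbb{E}Y_{ij}^2=\sigma_{ij}^2$ (with $\sigma_{ji}=\sigma_{ij}$). Assume that the following conditions hold: (a) for every fixed $\tau>0$, $\displaystyle L_n(\tau):=\frac{1}{n^2}\sum_{i,j=1}^n \mathbb{E}|Y_{ij}|^2\,\mathbf{1}(|Y_{ij}|\ge \tau\sqrt{n})\to 0$ as $n\to\infty$; (b) $\displaystyle \frac1n\sum_{i=1}^n |B_i^2-1|\to 0$ as $n\to\infty$, where $B_i^2:=\frac1n\sum_{j=1}^n\sigma_{ij}^2$; (c) there is an absolute constant $C$ (independent of $n$) such that $\max_{1\le i\le n}B_i\le C$ for all $n$. Then $$\sup_{x\in\mathbb{R}}|F^{\mathbf{Y}_n}(x)-G(x)|\to 0\quad\text{as } n\to\infty.$$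
   Context: All random variables are defined on a common probability space. $\mathbf{1}(B)$ denotes the indicator of an event $B$. The quantity $B_i\ge 0$ depends on $n$. For a real symmetric random $n\times n$ matrix $\mathbf{Y}_n$, let $\lambda_1\le\dots\le\lambda_n$ be the eigenvalues of $n^{-1/2}\mathbf{Y}_n$, let $\mathcal{F}^{\mathbf{Y}_n}(x)=\frac1n\sum_{i=1}^n\mathbf{1}(\lambda_i\le x)$, and let $F^{\mathbf{Y}_n}(x):=\mathbb{E}\,\mathcal{F}^{\mathbf{Y}_n}(x)$. $G$ is the distribution function of the standard semicircle law: $G(x)=\int_{-\infty}^x g(u)\,du$ with $g(x)=\frac{1}{2\pi}\sqrt{4-x^2}\,\mathbf{1}(|x|\le 2)$. *)

theory Defs
  imports "HOL-Probability.Probability" "Jordan_Normal_Form.Char_Poly"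
begin

(* As usual, point masses (variance 0) count as Gaussian; normal_density needs a positive
   standard deviation, so they are treated separately. *)
definition gaussian_rv :: "'a measure \<Rightarrow> ('a \<Rightarrow> real) \<Rightarrow> bool" where
  "gaussian_rv M X \<longleftrightarrow> X \<in> borel_measurable M \<and>
     (\<exists>\<mu> s. (s > 0 \<and> distr M borel X = density lborel (\<lambda>x. ennreal (normal_density \<mu> s x)))
          \<or> (s = 0 \<and> distr M borel X = return borel \<mu>))"

(* The entries are indexed from 1, whereas matrices of the library are indexed from 0. *)
definition random_matrix :: "(nat \<Rightarrow> nat \<Rightarrow> 'a \<Rightarrow> real) \<Rightarrow> nat \<Rightarrow> 'a \<Rightarrow> real mat" where
  "random_matrix Y n \<omega> = Matrix.mat n n (\<lambda>(i, j). Y (Suc i) (Suc j) \<omega>)"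

(* Real eigenvalues in increasing order, with algebraic multiplicity. For a symmetric
   matrix of dimension n this list has length n, with lambda_i at position i - 1. *)
definition ordered_eigenvalues :: "real mat \<Rightarrow> real list" where
  "ordered_eigenvalues A = sorted_list_of_multiset (proots (char_poly A))"

definition empirical_cdf :: "(nat \<Rightarrow> nat \<Rightarrow> 'a \<Rightarrow> real) \<Rightarrow> nat \<Rightarrow> real \<Rightarrow> 'a \<Rightarrow> real" where
  "empirical_cdf Y n x \<omega> =
     1 / real n * (\<Sum>i=1..n.
       indicat_real {..x}
         (ordered_eigenvalues ((1 / sqrt (real n)) \<cdot>\<^sub>m random_matrix Y n \<omega>) ! (i - 1)))"

definition expected_cdf ::
  "'a measure \<Rightarrow> (nat \<Rightarrow> nat \<Rightarrow> 'a \<Rightarrow> real) \<Rightarrow> nat \<Rightarrow> real \<Rightarrow> real" where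
  "expected_cdf M Y n x = (\<integral>\<omega>. empirical_cdf Y n x \<omega> \<partial>M)"

definition semicircle_density :: "real \<Rightarrow> real" where
  "semicircle_density x = 1 / (2 * pi) * sqrt (4 - x\<^sup>2) * indicat_real {x. \<bar>x\<bar> \<le> 2} x"

definition semicircle_cdf :: "real \<Rightarrow> real" where
  "semicircle_cdf x = (LINT u:{..x}|lborel. semicircle_density u)"

definition lindeberg_fraction ::
  "'a measure \<Rightarrow> (nat \<Rightarrow> nat \<Rightarrow> 'a \<Rightarrow> real) \<Rightarrow> nat \<Rightarrow> real \<Rightarrow> real" where
  "lindeberg_fraction M Y n \<tau> =
     1 / (real n)\<^sup>2 * (\<Sum>i=1..n. \<Sum>j=1..n.
       (\<integral>\<omega>. \<bar>Y i j \<omega>\<bar>\<^sup>2 * indicat_real {\<omega>. \<bar>Y i j \<omega>\<bar> \<ge> \<tau> * sqrt (real n)} \<omega> \<partial>M))"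

definition row_norm :: "(nat \<Rightarrow> nat \<Rightarrow> real) \<Rightarrow> nat \<Rightarrow> nat \<Rightarrow> real" where
  "row_norm \<sigma> n i = sqrt (1 / real n * (\<Sum>j=1..n. (\<sigma> i j)\<^sup>2))"

end

(* The method of moments, with Gaussian integration by parts in place of a count of pairings.
   Let W be the matrix n^(-1/2) Y_n, S_jl the variance of W_jl, and let c_0 = 1, c_1 = 0 and
   c_(k+2) = sum_a c_a c_(k-a) be the moments of the semicircle law. By induction on k the
   diagonal entries of W^k converge to c_k in mean square, on average over j: for
   g_j = (W^(k+1))_jj - c_(k+1), expanding one factor W and integrating by parts gives
   E[(W^(k+1))_jj g_j] = sum_l S_jl sum_(a+b=k-1) E[(W^a)_ll (W^b)_jj g_j] + error.
   In the main term the diagonal entries may be replaced by c_a and c_b, and sum_l S_jl by 1.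
   Each term of the error contains some (W^a)_lj, and
   (1/n) sum_(j,l) S_jl E[((W^a)_lj)^2] -> 0: the Lindeberg condition removes the pairs with
   S_jl > eps, and for the others sum_l ((W^a)_lj)^2 = (W^(2a))_jj supplies the factor eps.
   All moments needed are bounded because the row sums of S are bounded. No truncation is
   required, and all functionals of W that occur are polynomials. *)
theory Submission
  imports Defs "Jordan_Normal_Form.Schur_Decomposition"
begin

section \<open>Moments and weak convergence\<close>

text \<open>The variances are not constant, so the moments of the trace alone satisfy no closed
  recursion: integration by parts couples (W^a)_ll to (W^b)_jj through the individual weight S_jl.
  The expectations of the diagonal entries do not close either, because the expectation of such a
  product need not split. Mean square convergence meets both obstacles: it follows the single rows,
  and it allows each diagonal entry to be replaced by a constant inside a product whose other
  factors have bounded moments. Since the test variable is the deviation g_j itself, convergence of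
  the mean and concentration come out of one identity. The Lindeberg condition acts through the
  variances: an entry of Y_n with variance above eps n has at least three quarters of its second
  moment beyond sqrt(eps n) / 2. The way back to distribution functions rests on two properties of
  the limit: bounded support, by which moments suffice, and continuity, by which convergence is
  uniform.\<close>

lemma polynomial_tail_bound:
  fixes a :: "nat \<Rightarrow> real"
  assumes R: "R > 0" and x: "\<bar>x\<bar> \<ge> R" and N: "d \<le> 2 * N"
  shows "\<bar>\<Sum>i\<le>d. a i * x ^ i\<bar> \<le> (\<Sum>i\<le>d. \<bar>a i\<bar> * R ^ i) * (x ^ (2 * N) / R ^ (2 * N))"
proof -
  have one: "1 \<le> \<bar>x\<bar> / R" using R x by simp
  have "\<bar>a i * x ^ i\<bar> \<le> \<bar>a i\<bar> * R ^ i * (x ^ (2 * N) / R ^ (2 * N))" if "i \<le> d" for i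
  proof -
    have "(\<bar>x\<bar> / R) ^ i \<le> (\<bar>x\<bar> / R) ^ (2 * N)"
      using one that N by (intro power_increasing) auto
    also have "\<dots> = x ^ (2 * N) / R ^ (2 * N)"
      by (simp add: power_divide power_even_abs)
    finally have *: "(\<bar>x\<bar> / R) ^ i \<le> x ^ (2 * N) / R ^ (2 * N)" .
    have "\<bar>a i * x ^ i\<bar> = \<bar>a i\<bar> * R ^ i * (\<bar>x\<bar> / R) ^ i"
      using R by (simp add: abs_mult power_abs power_divide)
    also have "\<dots> \<le> \<bar>a i\<bar> * R ^ i * (x ^ (2 * N) / R ^ (2 * N))"
      using * R by (intro mult_left_mono) auto
    finally show ?thesis .
  qed
  then have "(\<Sum>i\<le>d. \<bar>a i * x ^ i\<bar>) \<le> (\<Sum>i\<le>d. \<bar>a i\<bar> * R ^ i * (x ^ (2 * N) / R ^ (2 * N)))"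
    by (intro sum_mono) auto
  then show ?thesis
    by (subst sum_distrib_right) (rule order_trans[OF sum_abs])
qed

text \<open>The coefficients and \<open>A\<close> are fixed before \<open>N\<close>, so
  \<open>N\<close> may be taken large afterwards. Weierstrass governs [-R, R]; outside, the bounded
  function and the polynomial are both dominated by a multiple of (x / R)^(2 N), an even power whose
  integral is a moment.\<close>

lemma bounded_continuous_approx_by_polynomial:
  fixes f :: "real \<Rightarrow> real"
  assumes cont: "continuous_on UNIV f" and bdd: "\<And>x. \<bar>f x\<bar> \<le> 1" and R: "R > 0" and e: "e > 0"
  shows "\<exists>a d A. A \<ge> 0 \<and> (\<forall>N x. d \<le> 2 * N \<longrightarrow>
           \<bar>f x - (\<Sum>i\<le>d. a i * x ^ i)\<bar> \<le> e + A * (x ^ (2 * N) / R ^ (2 * N)))"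
proof -
  obtain g where g: "real_polynomial_function g" "\<And>x. x \<in> {-R..R} \<Longrightarrow> \<bar>f x - g x\<bar> < e"
    using Stone_Weierstrass_real_polynomial_function[of "{-R..R}" f e] cont e
    by (metis compact_Icc continuous_on_subset top_greatest)
  obtain a d where gd: "g = (\<lambda>x. \<Sum>i\<le>d. a i * x ^ i)"
    using g(1) unfolding real_polynomial_function_iff_sum by blast
  \<comment> \<open>The summand 1 pays for \<open>f\<close> beyond \<open>R\<close>, where
    \<open>x ^ (2 * N) / R ^ (2 * N)\<close> is at least 1.\<close>
  define A where "A = 1 + (\<Sum>i\<le>d. \<bar>a i\<bar> * R ^ i)"
  have A0: "A \<ge> 0" using R unfolding A_def by (intro add_nonneg_nonneg sum_nonneg) auto
  have "\<bar>f x - (\<Sum>i\<le>d. a i * x ^ i)\<bar> \<le> e + A * (x ^ (2 * N) / R ^ (2 * N))"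
    if N: "d \<le> 2 * N" for N x
  proof (cases "\<bar>x\<bar> \<le> R")
    case True
    then have "\<bar>f x - g x\<bar> < e" by (intro g(2)) auto
    moreover have "0 \<le> A * (x ^ (2 * N) / R ^ (2 * N))" using A0 by simp
    ultimately show ?thesis unfolding gd by linarith
  next
    case False
    have 1: "1 \<le> x ^ (2 * N) / R ^ (2 * N)"
    proof -
      have "1 \<le> (\<bar>x\<bar> / R) ^ (2 * N)" using False R by (intro one_le_power) auto
      then show ?thesis by (simp add: power_divide power_even_abs)
    qed
    have "\<bar>f x - (\<Sum>i\<le>d. a i * x ^ i)\<bar> \<le> \<bar>f x\<bar> + \<bar>\<Sum>i\<le>d. a i * x ^ i\<bar>" by simp
    also have "\<dots> \<le> 1 + (\<Sum>i\<le>d. \<bar>a i\<bar> * R ^ i) * (x ^ (2 * N) / R ^ (2 * N))"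
      using bdd[of x] polynomial_tail_bound[OF R _ N, of x a] False by simp
    also have "\<dots> \<le> x ^ (2 * N) / R ^ (2 * N) + (\<Sum>i\<le>d. \<bar>a i\<bar> * R ^ i) * (x ^ (2 * N) / R ^ (2 * N))"
      using 1 by simp
    also have "\<dots> = A * (x ^ (2 * N) / R ^ (2 * N))" unfolding A_def by (simp add: algebra_simps add_divide_distrib)
    finally show ?thesis using e by linarith
  qed
  then show ?thesis using A0 by blast
qed

lemma integral_approx_by_polynomial:
  fixes f :: "real \<Rightarrow> real"
  assumes M: "real_distribution M" and int: "\<And>k. integrable M (\<lambda>x. x ^ k)"
    and f: "integrable M f"
    and bnd: "\<And>x. \<bar>f x - (\<Sum>i\<le>d. a i * x ^ i)\<bar> \<le> e + A * (x ^ m / c)"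
  shows "\<bar>(\<integral>x. f x \<partial>M) - (\<Sum>i\<le>d. a i * (\<integral>x. x ^ i \<partial>M))\<bar> \<le> e + A * ((\<integral>x. x ^ m \<partial>M) / c)"
proof -
  interpret real_distribution M by fact
  have "\<bar>(\<integral>x. f x \<partial>M) - (\<Sum>i\<le>d. a i * (\<integral>x. x ^ i \<partial>M))\<bar> = \<bar>\<integral>x. (f x - (\<Sum>i\<le>d. a i * x ^ i)) \<partial>M\<bar>"
    using f int by (simp add: Bochner_Integration.integral_diff Bochner_Integration.integral_sum)
  also have "\<dots> \<le> (\<integral>x. \<bar>f x - (\<Sum>i\<le>d. a i * x ^ i)\<bar> \<partial>M)"
    by (rule integral_abs_bound)
  also have "\<dots> \<le> (\<integral>x. e + A * (x ^ m / c) \<partial>M)"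
    using f int by (intro integral_mono bnd) auto
  also have "\<dots> = e + A * ((\<integral>x. x ^ m \<partial>M) / c)"
    using int prob_space by (simp add: Bochner_Integration.integral_add)
  finally show ?thesis .
qed

text \<open>Approximation on [-R, R] with R > r reduces a test integral to finitely many moments and
  a tail governed by the moment of order 2 N. For the limit that moment is at most r^(2 N), so the
  tail is of order (r / R)^(2 N); for \<open>\<mu> n\<close> the tail becomes small because its
  moment converges. \<open>N\<close> is fixed before n grows.\<close>

theorem weak_conv_of_moments:
  assumes \<mu>: "\<And>n. real_distribution (\<mu> n)" and \<nu>: "real_distribution \<nu>"
    and int: "\<And>n k. integrable (\<mu> n) (\<lambda>x. x ^ k)"
    and conv: "\<And>k. (\<lambda>n. \<integral>x. x ^ k \<partial>\<mu> n) \<longlonglongrightarrow> (\<integral>x. x ^ k \<partial>\<nu>)"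
    and supp: "AE x in \<nu>. \<bar>x\<bar> \<le> r" and r: "r > 0"
  shows "weak_conv_m \<mu> \<nu>"
proof -
  interpret \<nu>: real_distribution \<nu> by fact
  interpret \<mu>: real_distribution "\<mu> n" for n by fact
  have int\<nu>: "integrable \<nu> (\<lambda>x. x ^ k)" for k
    using supp by (intro \<nu>.integrable_const_bound[of _ "r ^ k"])
                  (auto elim!: eventually_mono simp: power_abs intro: power_mono)
  show ?thesis
  proof (rule integral_bdd_continuous_conv_imp_weak_conv[OF \<mu> \<nu>])
    fix f :: "real \<Rightarrow> real" assume fc: "\<And>x. isCont f x" and fb: "\<And>x. \<bar>f x\<bar> \<le> 1"
    have cf: "continuous_on UNIV f" using fc by (simp add: continuous_at_imp_continuous_on)
    have mf[measurable]: "f \<in> borel_measurable borel" using cf by (rule borel_measurable_continuous_onI)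
    have if\<mu>: "integrable (\<mu> n) f" for n
      by (rule \<mu>.integrable_const_bound[where B = 1]) (use fb in auto)
    have if\<nu>: "integrable \<nu> f"
      by (rule \<nu>.integrable_const_bound[of _ 1]) (use fb in auto)
    show "(\<lambda>n. integral\<^sup>L (\<mu> n) f) \<longlonglongrightarrow> integral\<^sup>L \<nu> f"
    proof (rule tendstoI)
      fix \<epsilon> :: real assume "\<epsilon> > 0"
      \<comment> \<open>Five errors occur, each at most \<open>e\<close>: approximation and tail for
        \<open>\<mu> n\<close>, the same two for \<open>\<nu>\<close>, and the difference of the
        polynomial integrals.\<close>
      define e where "e = \<epsilon> / 6"
      have e: "e > 0" using \<open>\<epsilon> > 0\<close> by (simp add: e_def)
      define R where "R = r + 1"
      have R: "R > 0" using r by (simp add: R_def)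
      obtain a d A where A0: "A \<ge> 0" and
        ap: "\<And>N x. d \<le> 2 * N \<Longrightarrow> \<bar>f x - (\<Sum>i\<le>d. a i * x ^ i)\<bar> \<le> e + A * (x ^ (2 * N) / R ^ (2 * N))"
        using bounded_continuous_approx_by_polynomial[OF cf fb R e] by blast
      have "(\<lambda>N. A * ((r / R)\<^sup>2) ^ N) \<longlonglongrightarrow> A * 0"
        using r by (intro tendsto_intros LIMSEQ_power_zero) (auto simp: R_def power_less_one_iff abs_square_less_1)
      then have "\<forall>\<^sub>F N in sequentially. A * ((r / R)\<^sup>2) ^ N < e"
        using e by (intro order_tendstoD) auto
      then obtain N where N: "A * ((r / R)\<^sup>2) ^ N < e" "d \<le> 2 * N"
        using eventually_happens'[OF _ eventually_conj[OF _ eventually_ge_at_top[of d]]]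
        by (metis (no_types, lifting) sequentially_bot mult_2 trans_le_add1)
      have m\<nu>: "(\<integral>x. x ^ (2 * N) \<partial>\<nu>) \<le> r ^ (2 * N)"
      proof -
        have "(\<integral>x. x ^ (2 * N) \<partial>\<nu>) \<le> (\<integral>x. r ^ (2 * N) \<partial>\<nu>)"
        proof (rule integral_mono_AE[OF int\<nu>])
          show "AE x in \<nu>. x ^ (2 * N) \<le> r ^ (2 * N)"
            using supp
          proof eventually_elim
            case (elim x)
            then have "\<bar>x\<bar> ^ (2 * N) \<le> r ^ (2 * N)" by (intro power_mono) auto
            then show ?case by (simp add: power_even_abs)
          qed
        qed auto
        then show ?thesis using \<nu>.prob_space by simp
      qed
      have t\<nu>: "A * ((\<integral>x. x ^ (2 * N) \<partial>\<nu>) / R ^ (2 * N)) < e"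
      proof -
        have "A * ((\<integral>x. x ^ (2 * N) \<partial>\<nu>) / R ^ (2 * N)) \<le> A * (r ^ (2 * N) / R ^ (2 * N))"
          using m\<nu> A0 R by (intro mult_left_mono divide_right_mono) auto
        also have "\<dots> = A * ((r / R)\<^sup>2) ^ N" by (simp add: power_mult power_divide)
        finally show ?thesis using N(1) by simp
      qed
      have l1: "(\<lambda>n. \<Sum>i\<le>d. a i * (\<integral>x. x ^ i \<partial>\<mu> n)) \<longlonglongrightarrow> (\<Sum>i\<le>d. a i * (\<integral>x. x ^ i \<partial>\<nu>))"
        by (intro tendsto_intros conv)
      have l2: "(\<lambda>n. A * ((\<integral>x. x ^ (2 * N) \<partial>\<mu> n) / R ^ (2 * N))) \<longlonglongrightarrow> A * ((\<integral>x. x ^ (2 * N) \<partial>\<nu>) / R ^ (2 * N))"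
        using R by (intro tendsto_intros conv) auto
      have "\<forall>\<^sub>F n in sequentially. A * ((\<integral>x. x ^ (2 * N) \<partial>\<mu> n) / R ^ (2 * N)) < e"
        using order_tendstoD(2)[OF l2 t\<nu>] .
      moreover have "\<forall>\<^sub>F n in sequentially. \<bar>(\<Sum>i\<le>d. a i * (\<integral>x. x ^ i \<partial>\<mu> n)) - (\<Sum>i\<le>d. a i * (\<integral>x. x ^ i \<partial>\<nu>))\<bar> < e"
        using tendstoD[OF l1 e] by (simp add: dist_real_def)
      ultimately show "\<forall>\<^sub>F n in sequentially. dist (integral\<^sup>L (\<mu> n) f) (integral\<^sup>L \<nu> f) < \<epsilon>"
      proof eventually_elim
        case (elim n)
        have "\<bar>(\<integral>x. f x \<partial>\<mu> n) - (\<Sum>i\<le>d. a i * (\<integral>x. x ^ i \<partial>\<mu> n))\<bar> \<le> e + A * ((\<integral>x. x ^ (2 * N) \<partial>\<mu> n) / R ^ (2 * N))"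
          by (rule integral_approx_by_polynomial[OF \<mu> int if\<mu> ap[OF N(2)]])
        moreover have "\<bar>(\<integral>x. f x \<partial>\<nu>) - (\<Sum>i\<le>d. a i * (\<integral>x. x ^ i \<partial>\<nu>))\<bar> \<le> e + A * ((\<integral>x. x ^ (2 * N) \<partial>\<nu>) / R ^ (2 * N))"
          by (rule integral_approx_by_polynomial[OF \<nu> int\<nu> if\<nu> ap[OF N(2)]])
        ultimately show ?case using elim t\<nu> e unfolding dist_real_def e_def by linarith
      qed
    qed
  qed
qed

section \<open>Uniform convergence of distribution functions\<close>

lemma cdf_uniform_approx_of_grid:
  fixes F G :: "real \<Rightarrow> real" and m :: nat
  assumes monoF: "mono F" and F01: "\<And>x. 0 \<le> F x \<and> F x \<le> 1"
    and monoG: "mono G" and G01: "\<And>x. 0 \<le> G x \<and> G x \<le> 1"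
    and m: "m > 0" and pt: "\<And>k. 0 < k \<Longrightarrow> k < m \<Longrightarrow> G (p k) = real k / m"
    and close: "\<And>k. 0 < k \<Longrightarrow> k < m \<Longrightarrow> \<bar>F (p k) - G (p k)\<bar> \<le> 1 / m"
  shows "\<bar>F x - G x\<bar> \<le> 2 / m"
proof -
  have lower: "G x - F x \<le> 2 / m"
  proof -
    \<comment> \<open>The last index with k / m strictly below \<open>G x\<close>; strictness forces
      \<open>p k \<le> x\<close>. The value 0 means \<open>G x \<le> 1 / m\<close>, where no
      quantile is called for.\<close>
    define k where "k = nat (\<lceil>m * G x\<rceil> - 1)"
    show ?thesis
    proof (cases "k > 0")
      case True
      then have kk: "real k = \<lceil>m * G x\<rceil> - 1" unfolding k_def by simp
      then have k1: "real k < m * G x" and k2: "m * G x \<le> real k + 1" by linarith+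
      have "m * G x \<le> m" using G01[of x] m by simp
      then have "k < m" using k1 by linarith
      have "p k \<le> x"
      proof (rule ccontr)
        assume "\<not> p k \<le> x"
        then have "G x \<le> real k / m" using pt[OF True \<open>k < m\<close>] monoD[OF monoG, of x "p k"] by simp
        then show False using k1 m by (simp add: field_simps)
      qed
      then have "F (p k) \<le> F x" using monoD[OF monoF] by blast
      moreover have "F (p k) \<ge> real k / m - 1 / m"
        using close[OF True \<open>k < m\<close>] pt[OF True \<open>k < m\<close>] by linarith
      moreover have "G x \<le> real k / m + 1 / m" using k2 m by (simp add: field_simps)
      ultimately show ?thesis by linarith
    next
      case False
      then have "\<lceil>m * G x\<rceil> \<le> 1" unfolding k_def by simp
      then have "m * G x \<le> 1" by linarith
      then have "G x \<le> 1 / m" using m by (simp add: field_simps)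
      moreover have "1 / real m \<le> 2 / m" using m by (simp add: field_simps)
      ultimately show ?thesis using F01[of x] by linarith
    qed
  qed
  have upper: "F x - G x \<le> 2 / m"
  proof -
    \<comment> \<open>The first index with k / m strictly above \<open>G x\<close>; once it reaches
      \<open>m\<close>, \<open>G x\<close> is already within 1 / m of 1.\<close>
    define k where "k = nat (\<lfloor>m * G x\<rfloor> + 1)"
    have "m * G x \<ge> 0" using G01[of x] by simp
    then have kk: "real k = \<lfloor>m * G x\<rfloor> + 1" and k0: "k > 0" unfolding k_def by simp_all
    then have k1: "real k > m * G x" and k2: "m * G x \<ge> real k - 1" by linarith+
    show ?thesis
    proof (cases "k < m")
      case True
      have "x \<le> p k"
      proof (rule ccontr)
        assume "\<not> x \<le> p k"
        then have "G x \<ge> real k / m" using pt[OF k0 True] monoD[OF monoG, of "p k" x] by simp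
        then show False using k1 m by (simp add: field_simps)
      qed
      then have "F x \<le> F (p k)" using monoD[OF monoF] by blast
      moreover have "F (p k) \<le> real k / m + 1 / m"
        using close[OF k0 True] pt[OF k0 True] by linarith
      moreover have "G x \<ge> real k / m - 1 / m" using k2 m by (simp add: field_simps)
      ultimately show ?thesis by linarith
    next
      case False
      then have "m * G x \<ge> real m - 1" using k2 by linarith
      then have "G x \<ge> 1 - 1 / m" using m by (simp add: field_simps)
      moreover have "1 / real m \<le> 2 / m" using m by (simp add: field_simps)
      ultimately show ?thesis using F01[of x] by linarith
    qed
  qed
  show ?thesis using lower upper by linarith
qed

text \<open>Polya's theorem. A continuous limit has quantiles at all levels k / m by the
  intermediate value theorem; convergence at these finitely many points is uniform, and monotonicity
  carries it to the gaps between them.\<close>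

theorem weak_conv_imp_uniform_cdf_conv:
  assumes \<mu>: "\<And>n. real_distribution (\<mu> n)" and \<nu>: "real_distribution \<nu>"
    and wc: "weak_conv_m \<mu> \<nu>" and cont: "\<And>x. isCont (cdf \<nu>) x"
  shows "(\<lambda>n. SUP x. \<bar>cdf (\<mu> n) x - cdf \<nu> x\<bar>) \<longlonglongrightarrow> 0"
proof (rule tendstoI)
  interpret \<nu>: real_distribution \<nu> by fact
  interpret \<mu>: real_distribution "\<mu> n" for n by fact
  fix \<epsilon> :: real assume e: "\<epsilon> > 0"
  obtain m :: nat where m: "real m > 2 / \<epsilon>" using reals_Archimedean2 by blast
  then have m0: "m > 0" using e by (metis divide_pos_pos gr0I less_asym of_nat_0 zero_less_numeral)
  have "\<exists>p. cdf \<nu> p = real k / m" if "0 < k" "k < m" for k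
  proof -
    have k: "0 < real k / m" "real k / m < 1" using that by auto
    obtain u where u: "cdf \<nu> u < real k / m"
      using eventually_happens'[OF _ order_tendstoD(2)[OF \<nu>.cdf_lim_at_bot k(1)]] by auto
    obtain v where v: "real k / m < cdf \<nu> v"
      using eventually_happens'[OF _ order_tendstoD(1)[OF \<nu>.cdf_lim_at_top_prob k(2)]] by auto
    have uv: "u \<le> v" using u v \<nu>.cdf_nondecreasing[of v u] by linarith
    show ?thesis
      using IVT'[of "cdf \<nu>" u "real k / m" v] u v uv cont
      by (metis continuous_at_imp_continuous_on less_eq_real_def)
  qed
  then obtain p where p: "\<And>k. 0 < k \<Longrightarrow> k < m \<Longrightarrow> cdf \<nu> (p k) = real k / m" by metis
  have conv: "(\<lambda>n. cdf (\<mu> n) x) \<longlonglongrightarrow> cdf \<nu> x" for x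
    using wc cont unfolding weak_conv_m_def weak_conv_def by auto
  have "\<forall>\<^sub>F n in sequentially. \<forall>k\<in>{0<..<m}. \<bar>cdf (\<mu> n) (p k) - cdf \<nu> (p k)\<bar> < 1 / m"
    using tendstoD[OF conv, of "1 / m"] m0 by (intro eventually_ball_finite) (auto simp: dist_real_def)
  then show "\<forall>\<^sub>F n in sequentially. dist (SUP x. \<bar>cdf (\<mu> n) x - cdf \<nu> x\<bar>) 0 < \<epsilon>"
  proof eventually_elim
    case (elim n)
    have le: "\<bar>cdf (\<mu> n) x - cdf \<nu> x\<bar> \<le> 2 / m" for x
      by (rule cdf_uniform_approx_of_grid[where p = p])
         (use m0 p elim in \<open>auto intro!: monoI \<mu>.cdf_nondecreasing \<nu>.cdf_nondecreasing
           simp: \<mu>.cdf_nonneg \<nu>.cdf_nonneg \<mu>.cdf_bounded_prob \<nu>.cdf_bounded_prob less_imp_le\<close>)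
    have "(SUP x. \<bar>cdf (\<mu> n) x - cdf \<nu> x\<bar>) \<le> 2 / m" by (rule cSUP_least) (use le in auto)
    moreover have "0 \<le> (SUP x. \<bar>cdf (\<mu> n) x - cdf \<nu> x\<bar>)"
      by (rule cSUP_upper2[of _ _ 0]) (use le in \<open>auto intro!: bdd_aboveI[of _ "2 / m"]\<close>)
    moreover have "2 / m < \<epsilon>" using m m0 e by (simp add: field_simps)
    ultimately show ?case by simp
  qed
qed

section \<open>The semicircle distribution\<close>

text \<open>The Catalan numbers at even indices and 0 at odd ones. The convolution does not separate
  the parities because integration by parts yields it in this form.\<close>

fun semicircle_moment :: "nat \<Rightarrow> real" where
  "semicircle_moment 0 = 1"
| "semicircle_moment (Suc 0) = 0"
| "semicircle_moment (Suc (Suc k)) = (\<Sum>a\<le>k. semicircle_moment a * semicircle_moment (k - a))"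

text \<open>At k = 0 the empty sum gives the first moment, so the expansion of W^(k+1) can treat k =
  0 and k > 0 alike.\<close>

lemma semicircle_moment_Suc:
  "semicircle_moment (Suc k) = (\<Sum>a<k. semicircle_moment a * semicircle_moment (k - 1 - a))"
  by (cases k) (simp_all add: lessThan_Suc_atMost)

(* The generating function C satisfies C = 1 + X^2 C^2, so D = 1 - 2 X^2 C is a square root of
   1 - 4 X^2 and hence solves the linear equation D' (1 - 4 X^2) = - 4 X D. *)
lemma semicircle_moment_linear_recurrence:
  "(real k + 4) * semicircle_moment (Suc (Suc k)) = 4 * (real k + 1) * semicircle_moment k"
proof -
  define C where "C = Abs_fps semicircle_moment"
  have sq: "fps_nth (C * C) n = (\<Sum>a\<le>n. semicircle_moment a * semicircle_moment (n - a))" for n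
    by (simp add: fps_mult_nth C_def atLeast0AtMost)
  have C: "C = 1 + fps_X ^ 2 * (C * C)"
  proof (rule fps_ext)
    fix n show "fps_nth C n = fps_nth (1 + fps_X ^ 2 * (C * C)) n"
      by (cases n rule: semicircle_moment.cases)
         (simp_all add: fps_X_power_mult_nth sq, simp_all add: C_def)
  qed
  define D where "D = 1 - 2 * fps_X ^ 2 * C"
  have D2: "D ^ 2 = 1 - 4 * fps_X ^ 2"
  proof -
    have "D ^ 2 = 1 - 4 * fps_X ^ 2 * (C - fps_X ^ 2 * (C * C))"
      unfolding D_def by (simp add: power2_eq_square algebra_simps)
    also have "C - fps_X ^ 2 * (C * C) = 1" using C by (metis add_diff_cancel_right')
    finally show ?thesis by simp
  qed
  have "fps_deriv (D ^ 2) = fps_deriv (1 - 4 * fps_X ^ 2)" by (simp only: D2)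
  then have "2 * (D * fps_deriv D) = 2 * (- 4 * fps_X)"
    by (simp add: power2_eq_square algebra_simps fps_deriv_mult)
  then have "D * fps_deriv D = - 4 * fps_X" by (subst (asm) mult_cancel_left) simp
  then have "D ^ 2 * fps_deriv D = - 4 * fps_X * D"
    by (simp add: power2_eq_square mult.assoc mult.left_commute)
  then have eq: "fps_deriv D - 4 * (fps_X ^ 2 * fps_deriv D) = - (4 * (fps_X * D))"
    unfolding D2 by (simp add: algebra_simps)
  have Dn: "fps_nth D (n + 2) = - 2 * semicircle_moment n" for n
  proof -
    have "D = 1 - 2 * (fps_X ^ 2 * C)" unfolding D_def by (simp add: mult.assoc)
    then have "fps_nth D (n + 2) = - fps_nth (2 * (fps_X ^ 2 * C)) (n + 2)" by simp
    also have "\<dots> = - 2 * fps_nth (fps_X ^ 2 * C) (n + 2)" by (simp add: numeral_fps_const)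
    finally show ?thesis by (simp add: C_def fps_X_power_mult_nth)
  qed
  \<comment> \<open>\<open>Dn\<close> shifts indices by two, since D = 1 - 2 X^2 C; the coefficient
    of X^(k+3) in the differential equation therefore relates the moments k + 2 and k.\<close>
  have "fps_nth (fps_deriv D - 4 * (fps_X ^ 2 * fps_deriv D)) (k + 3) = fps_nth (- (4 * (fps_X * D))) (k + 3)"
    by (simp only: eq)
  then have "(real k + 4) * fps_nth D (k + 4) - 4 * ((real k + 2) * fps_nth D (k + 2)) = - 4 * fps_nth D (k + 2)"
    by (simp add: numeral_fps_const fps_X_power_mult_nth eval_nat_numeral) (simp add: algebra_simps)
  moreover have "fps_nth D (k + 4) = - 2 * semicircle_moment (Suc (Suc k))"
    using Dn[of "Suc (Suc k)"] by (simp add: eval_nat_numeral)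
  ultimately show ?thesis unfolding Dn by (simp add: algebra_simps)
qed

section \<open>Integrals against the semicircle density\<close>

lemma semicircle_density_nonneg: "semicircle_density x \<ge> 0"
  unfolding semicircle_density_def
  by (cases "\<bar>x\<bar> \<le> 2") (use abs_le_square_iff[of x 2] in auto)

lemma semicircle_density_measurable [measurable]: "semicircle_density \<in> borel_measurable borel"
  unfolding semicircle_density_def[abs_def] by measurable

text \<open>Moves from Lebesgue integration over the line to the gauge integral over [-2, 2], where
  antiderivatives evaluate the moments.\<close>

lemma semicircle_sqrt_integral:
  fixes p :: "real \<Rightarrow> real"
  assumes "continuous_on {-2..2} p"
  shows "integrable lborel (\<lambda>x. semicircle_density x * p x)"
    and "(\<integral>x. semicircle_density x * p x \<partial>lborel) = 1 / (2 * pi) * integral {-2..2} (\<lambda>x. sqrt (4 - x\<^sup>2) * p x)"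
proof -
  let ?h = "\<lambda>x. sqrt (4 - x\<^sup>2) * p x"
  have si: "set_integrable lborel {-2..2} ?h"
    by (intro borel_integrable_atLeastAtMost' continuous_intros assms)
  have eq: "semicircle_density x * p x = 1 / (2 * pi) * (indicator {-2..2} x *\<^sub>R ?h x)" for x
    unfolding semicircle_density_def by (auto simp: indicator_def abs_le_iff)
  show "integrable lborel (\<lambda>x. semicircle_density x * p x)"
    unfolding eq using si unfolding set_integrable_def by (rule integrable_mult_right)
  show "(\<integral>x. semicircle_density x * p x \<partial>lborel) = 1 / (2 * pi) * integral {-2..2} ?h"
    unfolding eq using set_borel_integral_eq_integral(2)[OF si]
    by (simp add: set_lebesgue_integral_def)
qed

text \<open>The square root has no derivative at the endpoints, hence the open interval. The
  antiderivatives used below are continuous on [-2, 2], which is what the fundamental theorem asks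
  for at the ends.\<close>

lemma semicircle_sqrt_deriv:
  assumes "x \<in> {-2<..<2::real}"
  shows "((\<lambda>x. sqrt (4 - x\<^sup>2)) has_real_derivative (- x / sqrt (4 - x\<^sup>2))) (at x)" and "4 - x\<^sup>2 > 0"
proof -
  have "x\<^sup>2 < 2\<^sup>2" using assms by (intro power2_strict_mono) auto
  then show p: "4 - x\<^sup>2 > 0" by simp
  show "((\<lambda>x. sqrt (4 - x\<^sup>2)) has_real_derivative (- x / sqrt (4 - x\<^sup>2))) (at x)"
    using p by (auto intro!: derivative_eq_intros simp: field_simps)
qed

lemma semicircle_sqrt_total: "integral {-2..2} (\<lambda>x. sqrt (4 - x\<^sup>2)) = 2 * pi"
proof -
  let ?F = "\<lambda>x::real. x * sqrt (4 - x\<^sup>2) / 2 + 2 * arcsin (x / 2)"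
  have "((\<lambda>x. sqrt (4 - x\<^sup>2)) has_integral (?F 2 - ?F (-2))) {-2..2}"
  proof (rule fundamental_theorem_of_calculus_interior)
    show "continuous_on {-2..2} ?F" by (intro continuous_intros) auto
    fix x :: real assume x: "x \<in> {-2<..<2}"
    define s where "s = sqrt (4 - x\<^sup>2)"
    note d = semicircle_sqrt_deriv[OF x]
    define S where "S = (\<lambda>x::real. sqrt (4 - x\<^sup>2))"
    define T where "T = (\<lambda>x::real. arcsin (x / 2))"
    have Sx: "S x = s" and dS: "(S has_real_derivative (- x / s)) (at x)"
      using d(1) unfolding S_def s_def by simp_all
    have s: "s > 0" "s * s = 4 - x\<^sup>2" using d(2) unfolding s_def by auto
    have as: "sqrt (1 - (x / 2)\<^sup>2) = s / 2"
    proof -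
      have "1 - (x / 2)\<^sup>2 = (s / 2)\<^sup>2" using s(2) by (simp add: power2_eq_square field_simps)
      then show ?thesis using s(1) by (simp add: real_sqrt_abs)
    qed
    have "((\<lambda>x. arcsin (x / 2)) has_real_derivative inverse (sqrt (1 - (x / 2)\<^sup>2)) * (1 / 2)) (at x)"
      using x by (intro DERIV_chain2[of arcsin] DERIV_arcsin derivative_eq_intros) auto
    then have dT: "(T has_real_derivative inverse (s / 2) * (1 / 2)) (at x)"
      unfolding as T_def .
    have "((\<lambda>x. x * S x / 2 + 2 * T x) has_real_derivative
        ((1 * s + - x / s * x) / 2 + 2 * (inverse (s / 2) * (1 / 2)))) (at x)"
      using DERIV_add[OF DERIV_cdivide[OF DERIV_mult[OF DERIV_ident dS], of 2] DERIV_cmult[OF dT, of 2]]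
      unfolding Sx .
    then have "(?F has_real_derivative ((1 * s + - x / s * x) / 2 + 2 * (inverse (s / 2) * (1 / 2)))) (at x)"
      unfolding S_def T_def .
    moreover have "(1 * s + - x / s * x) / 2 + 2 * (inverse (s / 2) * (1 / 2)) = s"
    proof -
      have "- x / s * x = - (4 - s * s) / s" using s(2) by (simp add: power2_eq_square)
      also have "\<dots> = s - 4 / s" using s(1) by (simp add: diff_divide_distrib)
      finally show ?thesis by (simp add: inverse_eq_divide diff_divide_distrib)
    qed
    ultimately have "(?F has_real_derivative s) (at x)" by (rule DERIV_cong)
    then show "(?F has_vector_derivative sqrt (4 - x\<^sup>2)) (at x)"
      unfolding has_real_derivative_iff_has_vector_derivative s_def .
  qed simp
  then have "integral {-2..2} (\<lambda>x::real. sqrt (4 - x\<^sup>2)) = ?F 2 - ?F (-2)" by (rule integral_unique)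
  also have "\<dots> = 2 * pi" by simp
  finally show ?thesis .
qed

lemma semicircle_sqrt_odd: "integral {-2..2} (\<lambda>x. sqrt (4 - x\<^sup>2) * x) = 0"
proof -
  let ?F = "\<lambda>x::real. - (4 - x\<^sup>2) * sqrt (4 - x\<^sup>2) / 3"
  have "((\<lambda>x. sqrt (4 - x\<^sup>2) * x) has_integral (?F 2 - ?F (-2))) {-2..2}"
  proof (rule fundamental_theorem_of_calculus_interior)
    show "continuous_on {-2..2} ?F" by (intro continuous_intros) auto
    fix x :: real assume x: "x \<in> {-2<..<2}"
    define s where "s = sqrt (4 - x\<^sup>2)"
    note d = semicircle_sqrt_deriv[OF x]
    define S where "S = (\<lambda>x::real. sqrt (4 - x\<^sup>2))"
    have Sx: "S x = s" and dS: "(S has_real_derivative (- x / s)) (at x)"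
      using d(1) unfolding S_def s_def by simp_all
    have s: "s > 0" "4 - x\<^sup>2 = s * s" using d(2) unfolding s_def by auto
    have "((\<lambda>x. - (4 - x\<^sup>2) * S x / 3) has_real_derivative ((2 * x * s + - (4 - x\<^sup>2) * (- x / s)) / 3)) (at x)"
      by (rule derivative_eq_intros dS refl)+ (simp_all add: Sx)
    then have "(?F has_real_derivative ((2 * x * s + - (4 - x\<^sup>2) * (- x / s)) / 3)) (at x)"
      unfolding S_def .
    moreover have "(2 * x * s + - (4 - x\<^sup>2) * (- x / s)) / 3 = s * x"
      unfolding s(2) using s(1) by (simp add: field_simps)
    ultimately have "(?F has_real_derivative s * x) (at x)" by (rule DERIV_cong)
    then show "(?F has_vector_derivative (sqrt (4 - x\<^sup>2) * x)) (at x)"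
      unfolding has_real_derivative_iff_has_vector_derivative s_def .
  qed simp
  from integral_unique[OF this] show ?thesis by simp
qed

text \<open>The two sides are the integrals of the two terms in the derivative of x^(k+1) (4 -
  x^2)^(3/2), a function that vanishes at -2 and at 2.\<close>

lemma semicircle_sqrt_recurrence:
  "(real k + 4) * integral {-2..2} (\<lambda>x. sqrt (4 - x\<^sup>2) * x ^ (k + 2))
     = 4 * (real k + 1) * integral {-2..2} (\<lambda>x. sqrt (4 - x\<^sup>2) * x ^ k)"
proof -
  let ?F = "\<lambda>x::real. x ^ (k + 1) * ((4 - x\<^sup>2) * sqrt (4 - x\<^sup>2))"
  let ?f = "\<lambda>x::real. 4 * (real k + 1) * (sqrt (4 - x\<^sup>2) * x ^ k) - (real k + 4) * (sqrt (4 - x\<^sup>2) * x ^ (k + 2))"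
  have "(?f has_integral (?F 2 - ?F (-2))) {-2..2}"
  proof (rule fundamental_theorem_of_calculus_interior)
    show "continuous_on {-2..2} ?F" by (intro continuous_intros)
    fix x :: real assume x: "x \<in> {-2<..<2}"
    define s where "s = sqrt (4 - x\<^sup>2)"
    note d = semicircle_sqrt_deriv[OF x]
    define S where "S = (\<lambda>x::real. sqrt (4 - x\<^sup>2))"
    have Sx: "S x = s" and dS: "(S has_real_derivative (- x / s)) (at x)"
      using d(1) unfolding S_def s_def by simp_all
    have s: "s > 0" "4 - x\<^sup>2 = s * s" using d(2) unfolding s_def by auto
    have dP: "((\<lambda>x. x ^ (k + 1)) has_real_derivative (real k + 1) * x ^ k) (at x)"
      using DERIV_pow[of "k + 1" x] by (simp add: add.commute)
    have dQ: "((\<lambda>x. 4 - x\<^sup>2) has_real_derivative - (2 * x)) (at x)"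
      by (auto intro!: derivative_eq_intros)
    have "(?F has_real_derivative (real k + 1) * x ^ k * ((4 - x\<^sup>2) * s)
        + (- (2 * x) * s + - x / s * (4 - x\<^sup>2)) * x ^ (k + 1)) (at x)"
      using DERIV_mult[OF dP DERIV_mult[OF dQ dS]] unfolding Sx unfolding S_def .
    also have "(- (2 * x) * s + - x / s * (4 - x\<^sup>2)) * x ^ (k + 1) = - 3 * s * x ^ (k + 2)"
    proof -
      have "- x / s * (4 - x\<^sup>2) = - x * s" unfolding s(2) using s(1) by simp
      show ?thesis unfolding \<open>- x / s * (4 - x\<^sup>2) = - x * s\<close> by (simp add: algebra_simps)
    qed
    also have "(real k + 1) * x ^ k * ((4 - x\<^sup>2) * s) + - 3 * s * x ^ (k + 2)
        = 4 * (real k + 1) * (s * x ^ k) - (real k + 4) * (s * x ^ (k + 2))"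
      by (simp add: algebra_simps power2_eq_square)
    finally show "(?F has_vector_derivative ?f x) (at x)"
      unfolding has_real_derivative_iff_has_vector_derivative s_def .
  qed simp
  from integral_unique[OF this] have "integral {-2..2} ?f = 0" by simp
  moreover have "integral {-2..2} ?f = 4 * (real k + 1) * integral {-2..2} (\<lambda>x. sqrt (4 - x\<^sup>2) * x ^ k)
      - (real k + 4) * integral {-2..2} (\<lambda>x. sqrt (4 - x\<^sup>2) * x ^ (k + 2))"
  proof -
    have int: "(\<lambda>x. sqrt (4 - x\<^sup>2) * x ^ m) integrable_on {-2..2::real}" for m
      by (intro integrable_continuous_interval continuous_intros)
    show ?thesis
      by (intro integral_unique has_integral_diff has_integral_mult_right integrable_integral int)
  qed
  ultimately show ?thesis by linarith
qed

text \<open>The convolution identity is hard to see on the integrals. They do satisfy the linear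
  two-step recurrence that the generating function gives for \<open>semicircle_moment\<close>, and
  the first two values agree.\<close>

lemma semicircle_moments: "(\<integral>x. semicircle_density x * x ^ k \<partial>lborel) = semicircle_moment k"
proof -
  have I: "(\<integral>x. semicircle_density x * x ^ k \<partial>lborel)
      = 1 / (2 * pi) * integral {-2..2} (\<lambda>x. sqrt (4 - x\<^sup>2) * x ^ k)" for k
    by (rule semicircle_sqrt_integral(2)) (intro continuous_intros)
  show ?thesis
  proof (induction k rule: induct_nat_012)
    case 0
    show ?case unfolding I by (simp add: semicircle_sqrt_total)
  next
    case 1
    show ?case unfolding I by (simp add: semicircle_sqrt_odd)
  next
    case (ge2 k)
    have "(real k + 4) * (\<integral>x. semicircle_density x * x ^ Suc (Suc k) \<partial>lborel)
        = 4 * (real k + 1) * (\<integral>x. semicircle_density x * x ^ k \<partial>lborel)"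
      unfolding I using arg_cong[OF semicircle_sqrt_recurrence[of k], of "\<lambda>t. 1 / (2 * pi) * t"]
      unfolding add_2_eq_Suc' by (simp only: ac_simps)
    also have "\<dots> = (real k + 4) * semicircle_moment (Suc (Suc k))"
      by (simp only: ge2(1) semicircle_moment_linear_recurrence)
    finally show ?case by (subst (asm) mult_cancel_left) linarith
  qed
qed

definition semicircle_distribution :: "real measure" where
  "semicircle_distribution = density lborel (\<lambda>x. ennreal (semicircle_density x))"

lemma integral_semicircle_distribution:
  assumes [measurable]: "f \<in> borel_measurable borel"
  shows "(\<integral>x. f x \<partial>semicircle_distribution) = (\<integral>x. semicircle_density x * f x \<partial>lborel)"
  unfolding semicircle_distribution_def
  by (subst integral_density) (auto simp: semicircle_density_nonneg)

lemma semicircle_integrable: "integrable lborel semicircle_density"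
  using semicircle_sqrt_integral(1)[of "\<lambda>_. 1"] by simp

lemma semicircle_total: "(\<integral>x. semicircle_density x \<partial>lborel) = 1"
  using semicircle_moments[of 0] by simp

lemma real_distribution_semicircle: "real_distribution semicircle_distribution"
proof -
  have "emeasure semicircle_distribution (space semicircle_distribution) = 1"
    using semicircle_total semicircle_integrable unfolding semicircle_distribution_def
    by (simp add: emeasure_density nn_integral_eq_integral semicircle_density_nonneg)
  then have "prob_space semicircle_distribution" by (rule prob_spaceI)
  then show ?thesis
    unfolding real_distribution_def real_distribution_axioms_def semicircle_distribution_def by simp
qed

lemma semicircle_distribution_bounded: "AE x in semicircle_distribution. \<bar>x\<bar> \<le> 2"
proof -
  have "semicircle_density x > 0 \<longrightarrow> \<bar>x\<bar> \<le> 2" for x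
    unfolding semicircle_density_def by (cases "\<bar>x\<bar> \<le> 2") simp_all
  then show ?thesis
    unfolding semicircle_distribution_def by (subst AE_density) simp_all
qed

lemma cdf_semicircle: "cdf semicircle_distribution x = semicircle_cdf x"
proof -
  interpret real_distribution semicircle_distribution by (rule real_distribution_semicircle)
  have "cdf semicircle_distribution x = (\<integral>u. indicator {..x} u \<partial>semicircle_distribution)"
    by (simp add: cdf_def)
  also have "\<dots> = (\<integral>u. semicircle_density u * indicator {..x} u \<partial>lborel)"
    by (rule integral_semicircle_distribution) measurable
  finally show ?thesis
    unfolding semicircle_cdf_def set_lebesgue_integral_def by (simp add: mult.commute)
qed

lemma isCont_cdf_semicircle: "isCont (cdf semicircle_distribution) x"
proof -
  interpret real_distribution semicircle_distribution by (rule real_distribution_semicircle)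
  have "emeasure semicircle_distribution {x} = 0"
    unfolding semicircle_distribution_def
    by (subst emeasure_density)
       (simp_all add: nn_integral_null_set null_setsI)
  then show ?thesis by (simp add: isCont_cdf measure_def)
qed

section \<open>Eigenvalues of symmetric matrices\<close>

text \<open>With s the squared norm of an eigenvector, evaluating the quadratic form in two ways
  gives e s = conj(e) s, and s is not 0.\<close>

lemma hermitian_eigenvalue_real:
  fixes A :: "complex mat"
  assumes A: "A \<in> carrier_mat n n"
    and herm: "\<And>i j. i < n \<Longrightarrow> j < n \<Longrightarrow> A $$ (j, i) = cnj (A $$ (i, j))"
    and ev: "eigenvalue A e"
  shows "Im e = 0"
proof -
  obtain v where v: "v \<in> carrier_vec n" "v \<noteq> 0\<^sub>v n" "A *\<^sub>v v = e \<cdot>\<^sub>v v"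
    using ev A unfolding eigenvalue_def eigenvector_def by auto
  define s where "s = (\<Sum>i<n. v $ i * cnj (v $ i))"
  have row: "(\<Sum>j<n. A $$ (i, j) * v $ j) = e * v $ i" if "i < n" for i
  proof -
    have "(\<Sum>j<n. A $$ (i, j) * v $ j) = (A *\<^sub>v v) $ i"
      using A v(1) that by (simp add: scalar_prod_def lessThan_atLeast0)
    also have "\<dots> = e * v $ i" using v that by simp
    finally show ?thesis .
  qed
  have "e * s = (\<Sum>i<n. (\<Sum>j<n. A $$ (i, j) * v $ j) * cnj (v $ i))"
    unfolding s_def sum_distrib_left by (intro sum.cong) (auto simp: row)
  also have "\<dots> = (\<Sum>i<n. \<Sum>j<n. v $ j * cnj (A $$ (j, i) * v $ i))"
    unfolding sum_distrib_right by (intro sum.cong refl) (subst herm, auto)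
  also have "\<dots> = (\<Sum>j<n. v $ j * cnj (\<Sum>i<n. A $$ (j, i) * v $ i))"
    by (subst sum.swap) (simp add: sum_distrib_left)
  also have "\<dots> = cnj e * s"
    unfolding s_def sum_distrib_left by (intro sum.cong) (auto simp: row)
  finally have "(e - cnj e) * s = 0" by (simp add: algebra_simps)
  moreover have "s \<noteq> 0"
  proof
    assume "s = 0"
    moreover have "s = of_real (\<Sum>i<n. (cmod (v $ i))\<^sup>2)"
      unfolding s_def by (simp only: of_real_sum complex_norm_square)
    ultimately have "(\<Sum>i<n. (cmod (v $ i))\<^sup>2) = 0"
      using of_real_eq_0_iff by metis
    then have "v $ i = 0" if "i < n" for i
      using that by (simp add: sum_nonneg_eq_0_iff)
    then have "v = 0\<^sub>v n" using v(1) by (intro eq_vecI) auto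
    then show False using v(2) by simp
  qed
  ultimately have "e = cnj e" by simp
  then show ?thesis by (simp add: complex_eq_iff)
qed

text \<open>The factorisation exists over the complex numbers; its roots are eigenvalues of a
  Hermitian matrix, hence real, and the embedding of real polynomials is injective. The real roots
  collected by \<open>proots\<close> therefore exhaust the dimension.\<close>

lemma symmetric_char_poly_splits:
  fixes A :: "real mat"
  assumes A: "A \<in> carrier_mat n n"
    and sym: "\<And>i j. i < n \<Longrightarrow> j < n \<Longrightarrow> A $$ (j, i) = A $$ (i, j)"
  shows "\<exists>es. char_poly A = (\<Prod>e\<leftarrow>es. [:- e, 1:])"
proof -
  interpret of_real_poly: map_poly_inj_idom_hom complex_of_real ..
  let ?C = "map_mat complex_of_real A"
  have C: "?C \<in> carrier_mat n n" using A by simp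
  obtain as where as: "char_poly ?C = (\<Prod>a\<leftarrow>as. [:- a, 1:])"
    using char_poly_factorized[OF C] by blast
  have re: "complex_of_real (Re a) = a" if "a \<in> set as" for a
  proof -
    have "poly (char_poly ?C) a = 0"
      unfolding as using that by (auto simp: poly_prod_list prod_list_zero_iff)
    then have "eigenvalue ?C a" using eigenvalue_root_char_poly[OF C] by simp
    then have "Im a = 0"
      by (rule hermitian_eigenvalue_real[OF C, rotated]) (use A sym in auto)
    then show ?thesis by (simp add: complex_eq_iff)
  qed
  have "map_poly complex_of_real (\<Prod>e\<leftarrow>map Re as. [:- e, 1:]) = (\<Prod>a\<leftarrow>as. [:- a, 1:])"
    using re by (induction as) (simp_all add: of_real_poly.hom_mult del: mult_pCons_left)
  also have "\<dots> = map_poly complex_of_real (char_poly A)"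
    unfolding as[symmetric] by (rule of_real_hom.char_poly_hom[OF A])
  finally show ?thesis by (metis of_real_poly.injectivity)
qed

lemma trace_conjugate:
  fixes B :: "'a :: comm_ring_1 mat"
  assumes B: "B \<in> carrier_mat n n" and P: "P \<in> carrier_mat n n" and Q: "Q \<in> carrier_mat n n"
    and QP: "Q * P = 1\<^sub>m n"
  shows "(\<Sum>i<n. (P * B * Q) $$ (i, i)) = (\<Sum>i<n. B $$ (i, i))"
proof -
  have comm: "(\<Sum>i<n. (X * Y) $$ (i, i)) = (\<Sum>i<n. (Y * X) $$ (i, i))"
    if "X \<in> carrier_mat n n" "Y \<in> carrier_mat n n" for X Y :: "'a mat"
  proof -
    have "(\<Sum>i<n. (X * Y) $$ (i, i)) = (\<Sum>i<n. \<Sum>j<n. X $$ (i, j) * Y $$ (j, i))"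
      using that by (intro sum.cong) (auto simp: scalar_prod_def lessThan_atLeast0)
    also have "\<dots> = (\<Sum>j<n. \<Sum>i<n. Y $$ (j, i) * X $$ (i, j))"
      by (subst sum.swap) (simp add: mult.commute)
    also have "\<dots> = (\<Sum>j<n. (Y * X) $$ (j, j))"
      using that by (intro sum.cong) (auto simp: scalar_prod_def lessThan_atLeast0)
    finally show ?thesis .
  qed
  have "(\<Sum>i<n. (P * B * Q) $$ (i, i)) = (\<Sum>i<n. (Q * (P * B)) $$ (i, i))"
    using B P Q by (intro comm) auto
  also have "Q * (P * B) = (Q * P) * B" using B P Q by simp
  also have "\<dots> = B" using B QP by simp
  finally show ?thesis .
qed

lemma upper_triangular_pow:
  fixes B :: "'a :: comm_ring_1 mat"
  assumes B: "B \<in> carrier_mat n n" and ut: "upper_triangular B"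
  shows "upper_triangular (B ^\<^sub>m k) \<and> (\<forall>i<n. (B ^\<^sub>m k) $$ (i, i) = (B $$ (i, i)) ^ k)"
proof (induction k)
  case 0
  then show ?case using B by simp
next
  case (Suc k)
  let ?P = "B ^\<^sub>m k"
  have P: "?P \<in> carrier_mat n n" using B by simp
  have entry: "(?P * B) $$ (i, j) = (\<Sum>l<n. ?P $$ (i, l) * B $$ (l, j))" if "i < n" "j < n" for i j
    using that B P by (simp add: scalar_prod_def lessThan_atLeast0)
  have low: "?P $$ (i, l) * B $$ (l, j) = 0" if "j \<le> i" "i < n" "l < n" "l \<noteq> i \<or> j < i" for i j l
  proof (cases "l < i")
    case True
    then have "?P $$ (i, l) = 0" using Suc P that by (intro upper_triangularD) auto
    then show ?thesis by simp
  next
    case False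
    then have "B $$ (l, j) = 0" using ut B that by (intro upper_triangularD) auto
    then show ?thesis by simp
  qed
  have "(?P * B) $$ (i, j) = 0" if "j < i" "i < n" for i j
    using that low by (subst entry) (auto intro!: sum.neutral)
  then have "upper_triangular (?P * B)"
    using P B by (intro upper_triangularI) auto
  moreover have "(?P * B) $$ (i, i) = (B $$ (i, i)) ^ Suc k" if "i < n" for i
  proof -
    have "(?P * B) $$ (i, i) = (\<Sum>l<n. if l = i then ?P $$ (i, i) * B $$ (i, i) else 0)"
      unfolding entry[OF that that] using that low[of i i] by (intro sum.cong) auto
    then show ?thesis using that Suc by simp
  qed
  ultimately show ?case by simp
qed

lemma proots_linear_factors:
  "proots (\<Prod>e\<leftarrow>es. [:- e, 1:]) = mset (es :: real list)"
proof (induction es)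
  case (Cons e es)
  have "proots [:- e, 1:] = {#e#}"
  proof (rule multiset_eqI)
    fix a show "count (proots [:- e, 1:]) a = count {#e#} a"
    proof (cases "a = e")
      case True then show ?thesis using order_power_n_n[of e 1] by simp
    next
      case False then show ?thesis by (simp add: order_0I)
    qed
  qed
  moreover have "(\<Prod>e\<leftarrow>es. [:- e, 1:]) \<noteq> 0" by (auto simp: prod_list_zero_iff)
  ultimately show ?case using Cons by (simp add: proots_mult del: mult_pCons_left)
qed simp

text \<open>In a Schur form P B Q the diagonal of B lists the roots of the characteristic
  polynomial, the diagonal of B^k lists their powers, and conjugation preserves the trace. Power
  sums depend only on the multiset of roots, so the sorting does not matter here.\<close>

theorem symmetric_ordered_eigenvalues:
  fixes A :: "real mat"
  assumes A: "A \<in> carrier_mat n n"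
    and sym: "\<And>i j. i < n \<Longrightarrow> j < n \<Longrightarrow> A $$ (j, i) = A $$ (i, j)"
  shows "length (ordered_eigenvalues A) = n"
    and "(\<Sum>i<n. (ordered_eigenvalues A ! i) ^ k) = (\<Sum>i<n. (A ^\<^sub>m k) $$ (i, i))"
proof -
  obtain es where es: "char_poly A = (\<Prod>e\<leftarrow>es. [:- e, 1:])"
    using symmetric_char_poly_splits[OF A sym] by blast
  obtain B P Q where BPQ: "schur_decomposition A es = (B, P, Q)" by (metis prod_cases3)
  from schur_decomposition[OF A es BPQ] have wit: "similar_mat_wit A B P Q"
    and ut: "upper_triangular B" and dg: "diag_mat B = es" by auto
  note w = similar_mat_witD2[OF A wit]
  have len: "length es = n" using dg w by (auto simp: diag_mat_def)
  have mo: "mset (ordered_eigenvalues A) = mset es"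
    unfolding ordered_eigenvalues_def es proots_linear_factors by simp
  show lo: "length (ordered_eigenvalues A) = n"
    using len mset_eq_length[OF mo] by simp
  have "similar_mat_wit (A ^\<^sub>m k) (B ^\<^sub>m k) P Q" by (rule similar_mat_wit_pow[OF wit])
  then have wk: "A ^\<^sub>m k = P * (B ^\<^sub>m k) * Q"
    using similar_mat_witD2[OF pow_carrier_mat[OF A]] by blast
  have "(\<Sum>i<n. (ordered_eigenvalues A ! i) ^ k) = sum_list (map (\<lambda>x. x ^ k) (ordered_eigenvalues A))"
    using lo by (simp add: sum_list_sum_nth lessThan_atLeast0)
  also have "\<dots> = sum_list (map (\<lambda>x. x ^ k) es)"
    by (metis mo mset_map sum_mset_sum_list)
  also have "\<dots> = (\<Sum>i<n. (B $$ (i, i)) ^ k)"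
    using len by (simp add: sum_list_sum_nth lessThan_atLeast0 dg[symmetric] diag_mat_def)
  also have "\<dots> = (\<Sum>i<n. (B ^\<^sub>m k) $$ (i, i))"
    using upper_triangular_pow[OF w(5) ut] by simp
  also have "\<dots> = (\<Sum>i<n. (A ^\<^sub>m k) $$ (i, i))"
    unfolding wk using w by (intro trace_conjugate[symmetric]) auto
  finally show "(\<Sum>i<n. (ordered_eigenvalues A ! i) ^ k) = (\<Sum>i<n. (A ^\<^sub>m k) $$ (i, i))" .
qed

section \<open>Measurability of the ordered eigenvalues\<close>

lemma sorted_ordered_eigenvalues: "sorted (ordered_eigenvalues A)"
  unfolding ordered_eigenvalues_def by simp

text \<open>Traces of powers are measurable, whereas the eigenvalues come from sorting a multiset of
  roots. With the indicator as a pointwise limit of polynomials, the number of eigenvalues up to x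
  is a limit of combinations of such traces. Stage m approximates on [-m, m] with error below 1 / (m
  + 1), so every t is eventually covered.\<close>

lemma indicator_limit_of_polynomials:
  "\<exists>d a. \<forall>t. (\<lambda>m. \<Sum>i\<le>d m. a m i * t ^ i) \<longlonglongrightarrow> indicat_real {..x} t"
proof -
  \<comment> \<open>The ramp descends to the right of \<open>x\<close>, so the limit at
    \<open>x\<close> itself is 1, as the closed half-line demands.\<close>
  define f where "f m = cts_step x (x + inverse (real (Suc m)))" for m
  have f: "continuous_on UNIV (f m)" for m
    unfolding f_def by (intro uniformly_continuous_imp_continuous cts_step_uniformly_continuous) simp
  have "\<exists>d a. \<forall>t\<in>{- real m..real m}. \<bar>f m t - (\<Sum>i\<le>d. a i * t ^ i)\<bar> < inverse (real (Suc m))" for m :: nat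
  proof -
    obtain g where g: "real_polynomial_function g"
      "\<And>t. t \<in> {- real m..real m} \<Longrightarrow> \<bar>f m t - g t\<bar> < inverse (real (Suc m))"
      using Stone_Weierstrass_real_polynomial_function[of "{- real m..real m}" "f m" "inverse (real (Suc m))"] f
      by (metis compact_Icc continuous_on_subset top_greatest inverse_positive_iff_positive of_nat_0_less_iff zero_less_Suc)
    obtain a d where "g = (\<lambda>t. \<Sum>i\<le>d. a i * t ^ i)"
      using g(1) unfolding real_polynomial_function_iff_sum by blast
    with g(2) show ?thesis by blast
  qed
  then obtain d a where da: "\<And>m t. t \<in> {- real m..real m} \<Longrightarrow>
      \<bar>f m t - (\<Sum>i\<le>d m. a m i * t ^ i)\<bar> < inverse (real (Suc m))"
    by metis
  have "(\<lambda>m. \<Sum>i\<le>d m. a m i * t ^ i) \<longlonglongrightarrow> indicat_real {..x} t" for t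
  proof -
    have lim: "(\<lambda>m. inverse (real (Suc m))) \<longlonglongrightarrow> 0" by (rule LIMSEQ_inverse_real_of_nat)
    have "\<forall>\<^sub>F m in sequentially. f m t = indicat_real {..x} t"
    proof (cases "t \<le> x")
      case True
      then show ?thesis by (simp add: f_def cts_step_def)
    next
      case False
      then have "\<forall>\<^sub>F m in sequentially. inverse (real (Suc m)) < t - x"
        by (intro order_tendstoD(2)[OF lim]) simp
      then show ?thesis
        by eventually_elim (use False in \<open>auto simp: f_def cts_step_def\<close>)
    qed
    then have 1: "(\<lambda>m. f m t) \<longlonglongrightarrow> indicat_real {..x} t" by (rule tendsto_eventually)
    obtain m0 :: nat where m0: "\<bar>t\<bar> \<le> real m0" using real_arch_simple by blast
    have "\<forall>\<^sub>F m in sequentially. norm (f m t - (\<Sum>i\<le>d m. a m i * t ^ i)) \<le> inverse (real (Suc m))"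
    proof (rule eventually_mono[OF eventually_ge_at_top[of m0]])
      fix m assume "m0 \<le> m"
      then have "t \<in> {- real m..real m}" using m0 by (auto simp: abs_le_iff)
      from da[OF this] show "norm (f m t - (\<Sum>i\<le>d m. a m i * t ^ i)) \<le> inverse (real (Suc m))"
        by simp
    qed
    then have 2: "(\<lambda>m. f m t - (\<Sum>i\<le>d m. a m i * t ^ i)) \<longlonglongrightarrow> 0"
      using lim by (rule Lim_null_comparison)
    from tendsto_diff[OF 1 2] show ?thesis by simp
  qed
  then show ?thesis by blast
qed

text \<open>In a sorted list an entry is at most x exactly when enough entries are. The counting
  function, a limit of polynomials in the power sums, thus describes the level sets of each single
  entry.\<close>

lemma sorted_measurable_of_power_sums:
  fixes lam :: "'a \<Rightarrow> nat \<Rightarrow> real"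
  assumes sorted: "\<And>\<omega> i j. i \<le> j \<Longrightarrow> j < n \<Longrightarrow> lam \<omega> i \<le> lam \<omega> j"
    and meas: "\<And>k. (\<lambda>\<omega>. \<Sum>i<n. lam \<omega> i ^ k) \<in> borel_measurable M"
    and i: "i < n"
  shows "(\<lambda>\<omega>. lam \<omega> i) \<in> borel_measurable M"
  unfolding borel_measurable_iff_le
proof
  fix x
  define N where "N \<omega> = (\<Sum>j<n. indicat_real {..x} (lam \<omega> j))" for \<omega>
  obtain d a where da: "\<And>t. (\<lambda>m. \<Sum>k\<le>d m. a m k * t ^ k) \<longlonglongrightarrow> indicat_real {..x} t"
    using indicator_limit_of_polynomials[of x] by blast
  have "(\<Sum>j<n. \<Sum>k\<le>d m. a m k * lam \<omega> j ^ k) = (\<Sum>k\<le>d m. a m k * (\<Sum>j<n. lam \<omega> j ^ k))" for m \<omega>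
    by (subst sum.swap) (simp add: sum_distrib_left)
  then have "(\<lambda>\<omega>. \<Sum>j<n. \<Sum>k\<le>d m. a m k * lam \<omega> j ^ k) \<in> borel_measurable M" for m
    using meas by simp
  moreover have "(\<lambda>m. \<Sum>j<n. \<Sum>k\<le>d m. a m k * lam \<omega> j ^ k) \<longlonglongrightarrow> N \<omega>" for \<omega>
    unfolding N_def by (intro tendsto_sum da)
  ultimately have N: "N \<in> borel_measurable M" by (rule borel_measurable_LIMSEQ_real[rotated])
  have Ncard: "N \<omega> = real (card {j. j < n \<and> lam \<omega> j \<le> x})" for \<omega>
  proof -
    have "N \<omega> = (\<Sum>j\<in>{..<n}. if lam \<omega> j \<le> x then 1 else 0)"
      unfolding N_def by (intro sum.cong) (auto simp: indicator_def)
    also have "\<dots> = (\<Sum>j\<in>{j\<in>{..<n}. lam \<omega> j \<le> x}. 1)" by (rule sum.inter_filter[symmetric]) simp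
    finally show ?thesis by simp
  qed
  \<comment> \<open>Positions start at 0: entry i is at most x iff at least i + 1 entries are, hence
    the strict inequality.\<close>
  have iff: "lam \<omega> i \<le> x \<longleftrightarrow> real i < N \<omega>" for \<omega>
  proof
    assume "lam \<omega> i \<le> x"
    then have "{..i} \<subseteq> {j. j < n \<and> lam \<omega> j \<le> x}" using sorted i by (auto intro: order_trans)
    then have "card {..i} \<le> card {j. j < n \<and> lam \<omega> j \<le> x}" by (intro card_mono) auto
    then show "real i < N \<omega>" unfolding Ncard by simp
  next
    assume *: "real i < N \<omega>"
    show "lam \<omega> i \<le> x"
    proof (rule ccontr)
      assume "\<not> lam \<omega> i \<le> x"
      have "{j. j < n \<and> lam \<omega> j \<le> x} \<subseteq> {..<i}"
      proof
        fix j assume "j \<in> {j. j < n \<and> lam \<omega> j \<le> x}"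
        then have "\<not> i \<le> j" using sorted[of i j \<omega>] \<open>\<not> lam \<omega> i \<le> x\<close> by auto
        then show "j \<in> {..<i}" by simp
      qed
      then have "card {j. j < n \<and> lam \<omega> j \<le> x} \<le> card {..<i}" by (intro card_mono) auto
      then show False using * unfolding Ncard by simp
    qed
  qed
  show "{\<omega> \<in> space M. lam \<omega> i \<le> x} \<in> sets M"
    unfolding iff using N by measurable
qed

text \<open>The law of an eigenvalue whose index is drawn uniformly and independently of the matrix.
  Its distribution function is the expected empirical one and its moments are expected normalised
  traces, so theorems on probability measures of the line apply to the averaged spectrum.\<close>

definition mixture_distribution :: "'a measure \<Rightarrow> nat \<Rightarrow> ('a \<Rightarrow> nat \<Rightarrow> real) \<Rightarrow> real measure" where
  "mixture_distribution M n lam =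
     distr (uniform_count_measure {..<n} \<Otimes>\<^sub>M M) borel (\<lambda>(i, \<omega>). lam \<omega> i)"

context prob_space
begin

context
  fixes n :: nat and lam :: "'a \<Rightarrow> nat \<Rightarrow> real"
  assumes n: "n > 0" and lam: "\<And>i. i < n \<Longrightarrow> (\<lambda>\<omega>. lam \<omega> i) \<in> borel_measurable M"
begin

lemma mixture_measurable: "(\<lambda>(i, \<omega>). lam \<omega> i) \<in> borel_measurable (uniform_count_measure {..<n} \<Otimes>\<^sub>M M)"
proof -
  have "(\<lambda>(i, \<omega>). lam \<omega> i) \<in> borel_measurable (count_space {..<n} \<Otimes>\<^sub>M M)"
    using lam by (intro measurable_pair_measure_countable1) auto
  then show ?thesis
    by (subst measurable_cong_sets[OF sets_pair_measure_cong refl, of _ "count_space {..<n}" M M])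
       (simp_all add: sets_uniform_count_measure)
qed

lemma prob_space_index: "prob_space (uniform_count_measure {..<n})"
  using n by (intro prob_space_uniform_count_measure) auto

lemma real_distribution_mixture: "real_distribution (mixture_distribution M n lam)"
proof -
  interpret U: prob_space "uniform_count_measure {..<n}" by (rule prob_space_index)
  interpret UM: pair_prob_space "uniform_count_measure {..<n}" M ..
  show ?thesis
    unfolding mixture_distribution_def
    using mixture_measurable UM.prob_space_distr by (simp add: real_distribution_def real_distribution_axioms_def)
qed

lemma mixture_integral:
  assumes f[measurable]: "f \<in> borel_measurable borel"
    and int: "\<And>i. i < n \<Longrightarrow> integrable M (\<lambda>\<omega>. f (lam \<omega> i))"
  shows "integrable (mixture_distribution M n lam) (f :: real \<Rightarrow> real)"
    and "(\<integral>x. f x \<partial>mixture_distribution M n lam) = 1 / real n * (\<Sum>i<n. expectation (\<lambda>\<omega>. f (lam \<omega> i)))"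
proof -
  let ?U = "uniform_count_measure {..<n}"
  interpret U: prob_space ?U by (rule prob_space_index)
  interpret UM: pair_prob_space ?U M ..
  note m[measurable] = mixture_measurable
  have U_int: "integrable ?U g" for g :: "nat \<Rightarrow> real"
    unfolding uniform_count_measure_def by (rule integrable_point_measure_finite) simp
  have U_eq: "(\<integral>i. g i \<partial>?U) = 1 / real n * (\<Sum>i<n. g i)" for g :: "nat \<Rightarrow> real"
    unfolding uniform_count_measure_def
    by (subst lebesgue_integral_point_measure_finite) (auto simp: sum_distrib_left)
  have i: "integrable (?U \<Otimes>\<^sub>M M) (\<lambda>z. f ((\<lambda>(i, \<omega>). lam \<omega> i) z))"
  proof (rule UM.Fubini_integrable)
    show "(\<lambda>z. f ((\<lambda>(i, \<omega>). lam \<omega> i) z)) \<in> borel_measurable (?U \<Otimes>\<^sub>M M)" by measurable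
    show "AE i in ?U. integrable M (\<lambda>\<omega>. f ((\<lambda>(i, \<omega>). lam \<omega> i) (i, \<omega>)))"
      using int by (intro AE_I2) (simp add: space_uniform_count_measure)
  qed (rule U_int)
  show "integrable (mixture_distribution M n lam) f"
    unfolding mixture_distribution_def using i by (subst integrable_distr_eq[OF m]) auto
  have "(\<integral>x. f x \<partial>mixture_distribution M n lam) = (\<integral>z. f ((\<lambda>(i, \<omega>). lam \<omega> i) z) \<partial>(?U \<Otimes>\<^sub>M M))"
    unfolding mixture_distribution_def by (rule integral_distr[OF m]) simp
  also have "\<dots> = (\<integral>i. (\<integral>\<omega>. f (lam \<omega> i) \<partial>M) \<partial>?U)"
    using UM.integral_fst'[OF i] by simp
  also have "\<dots> = 1 / real n * (\<Sum>i<n. expectation (\<lambda>\<omega>. f (lam \<omega> i)))" by (rule U_eq)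
  finally show "(\<integral>x. f x \<partial>mixture_distribution M n lam) = 1 / real n * (\<Sum>i<n. expectation (\<lambda>\<omega>. f (lam \<omega> i)))" .
qed

lemma mixture_cdf:
  "cdf (mixture_distribution M n lam) x = 1 / real n * (\<Sum>i<n. expectation (\<lambda>\<omega>. indicat_real {..x} (lam \<omega> i)))"
proof -
  interpret Q: real_distribution "mixture_distribution M n lam" by (rule real_distribution_mixture)
  have "cdf (mixture_distribution M n lam) x = (\<integral>u. indicat_real {..x} u \<partial>mixture_distribution M n lam)"
    by (simp add: cdf_def)
  also have "\<dots> = 1 / real n * (\<Sum>i<n. expectation (\<lambda>\<omega>. indicat_real {..x} (lam \<omega> i)))"
    using lam by (intro mixture_integral(2) integrable_const_bound[of _ 1]) auto
  finally show ?thesis .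
qed

end

end

section \<open>Gaussian integration by parts\<close>

text \<open>A polynomial is kept as a list of monomials, each a coefficient with a word of
  variables; a repeated letter is a power. Values and formal derivatives are then recursions on
  lists.\<close>

definition poly_eval :: "(real \<times> 'e list) list \<Rightarrow> ('e \<Rightarrow> real) \<Rightarrow> real" where
  "poly_eval r x = (\<Sum>(c, es)\<leftarrow>r. c * prod_list (map x es))"

fun mono_deriv :: "'e \<Rightarrow> 'e list \<Rightarrow> ('e \<Rightarrow> real) \<Rightarrow> real" where
  "mono_deriv e [] x = 0"
| "mono_deriv e (f # es) x = (if f = e then 1 else 0) * prod_list (map x es) + x f * mono_deriv e es x"

definition poly_deriv :: "'e \<Rightarrow> (real \<times> 'e list) list \<Rightarrow> ('e \<Rightarrow> real) \<Rightarrow> real" where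
  "poly_deriv e r x = (\<Sum>(c, es)\<leftarrow>r. c * mono_deriv e es x)"

text \<open>A certificate that \<open>f\<close> is a polynomial function of variables in
  \<open>I\<close> and \<open>f'\<close> its formal partial derivative. As a relation between
  functions it is closed under sums and products, so matrix powers can be differentiated without
  handling monomials.\<close>

definition pder :: "'e set \<Rightarrow> 'e \<Rightarrow> (('e \<Rightarrow> real) \<Rightarrow> real) \<Rightarrow> (('e \<Rightarrow> real) \<Rightarrow> real) \<Rightarrow> bool" where
  "pder I e f f' \<longleftrightarrow> (\<exists>r. (\<forall>(c, es) \<in> set r. set es \<subseteq> I) \<and> f = poly_eval r \<and> f' = poly_deriv e r)"

lemma pder_const: "pder I e (\<lambda>x. c) (\<lambda>x. 0)"
  unfolding pder_def by (rule exI[of _ "[(c, [])]"]) (auto simp: poly_eval_def poly_deriv_def)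

lemma pder_var: "a \<in> I \<Longrightarrow> pder I e (\<lambda>x. x a) (\<lambda>x. if a = e then 1 else 0)"
  unfolding pder_def by (rule exI[of _ "[(1, [a])]"]) (auto simp: poly_eval_def poly_deriv_def)

lemma pder_add:
  assumes "pder I e f f'" "pder I e g g'"
  shows "pder I e (\<lambda>x. f x + g x) (\<lambda>x. f' x + g' x)"
proof -
  obtain r s where r: "\<forall>(c, es) \<in> set r. set es \<subseteq> I" "f = poly_eval r" "f' = poly_deriv e r"
    and s: "\<forall>(c, es) \<in> set s. set es \<subseteq> I" "g = poly_eval s" "g' = poly_deriv e s"
    using assms unfolding pder_def by blast
  show ?thesis unfolding pder_def
    by (rule exI[of _ "r @ s"]) (use r s in \<open>auto simp: poly_eval_def poly_deriv_def\<close>)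
qed

lemma mono_deriv_append:
  "mono_deriv e (es @ fs) x = mono_deriv e es x * prod_list (map x fs) + prod_list (map x es) * mono_deriv e fs x"
  by (induction es) (auto simp: algebra_simps)

lemma pder_mult:
  assumes "pder I e f f'" "pder I e g g'"
  shows "pder I e (\<lambda>x. f x * g x) (\<lambda>x. f' x * g x + f x * g' x)"
proof -
  obtain r s where r: "\<forall>(c, es) \<in> set r. set es \<subseteq> I" "f = poly_eval r" "f' = poly_deriv e r"
    and s: "\<forall>(c, es) \<in> set s. set es \<subseteq> I" "g = poly_eval s" "g' = poly_deriv e s"
    using assms unfolding pder_def by blast
  \<comment> \<open>Multiplying out: \<open>m\<close> is the product of one monomial with all of
    \<open>s\<close>, words being concatenated.\<close>
  define m where "m = (\<lambda>(c, es). map (\<lambda>(d, fs). (c * d :: real, es @ fs)) s)"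
  have ev1: "poly_eval (m (c, es)) x = c * prod_list (map x es) * poly_eval s x" for c es x
    unfolding m_def poly_eval_def by (induction s) (auto simp: algebra_simps)
  have de1: "poly_deriv e (m (c, es)) x = c * mono_deriv e es x * poly_eval s x
      + c * prod_list (map x es) * poly_deriv e s x" for c es x
    unfolding m_def poly_eval_def poly_deriv_def
    by (induction s) (auto simp: algebra_simps mono_deriv_append)
  have ev: "poly_eval (concat (map m r)) x = poly_eval r x * poly_eval s x" for x
  proof (induction r)
    case (Cons a r)
    have "poly_eval (concat (map m (a # r))) x = poly_eval (m a) x + poly_eval (concat (map m r)) x"
      by (simp add: poly_eval_def)
    then show ?case using Cons by (cases a) (simp add: ev1, simp add: poly_eval_def algebra_simps)
  qed (simp add: poly_eval_def)
  have de: "poly_deriv e (concat (map m r)) x = poly_deriv e r x * poly_eval s x + poly_eval r x * poly_deriv e s x" for x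
  proof (induction r)
    case (Cons a r)
    have "poly_deriv e (concat (map m (a # r))) x = poly_deriv e (m a) x + poly_deriv e (concat (map m r)) x"
      by (simp add: poly_deriv_def)
    then show ?case using Cons
      by (cases a) (simp add: de1, simp add: poly_eval_def poly_deriv_def algebra_simps)
  qed (simp add: poly_deriv_def poly_eval_def)
  have "\<forall>(c, es) \<in> set (concat (map m r)). set es \<subseteq> I"
    using r(1) s(1) unfolding m_def by fastforce
  then show ?thesis unfolding pder_def
    by (intro exI[of _ "concat (map m r)"]) (auto simp: ev de r s)
qed

lemma pder_sum:
  assumes "finite A" "\<And>i. i \<in> A \<Longrightarrow> pder I e (f i) (f' i)"
  shows "pder I e (\<lambda>x. \<Sum>i\<in>A. f i x) (\<lambda>x. \<Sum>i\<in>A. f' i x)"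
  using assms by (induction A rule: finite_induct) (auto intro: pder_const pder_add)

lemma pder_cong:
  assumes "pder I e f f'" "\<And>x. f' x = g' x"
  shows "pder I e f g'"
  using assms by (metis ext)

lemma pder_diff_const:
  assumes "pder I e f f'" shows "pder I e (\<lambda>x. f x - c) f'"
  using pder_add[OF assms pder_const[of I e "- c"]] by simp

text \<open>Order in a word is immaterial; grouping by multiplicity exhibits one factor for each
  variable, to which independence applies.\<close>

lemma prod_list_map_eq_prod_count:
  assumes "finite I" "set es \<subseteq> I"
  shows "prod_list (map (x :: 'e \<Rightarrow> real) es) = (\<Prod>f\<in>I. x f ^ count (mset es) f)"
  using assms(2)
proof (induction es)
  case (Cons a es)
  have "(\<Prod>f\<in>I. x f ^ count (mset (a # es)) f) = (\<Prod>f\<in>I. (if f = a then x a else 1) * x f ^ count (mset es) f)"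
    by (intro prod.cong) auto
  also have "\<dots> = x a * (\<Prod>f\<in>I. x f ^ count (mset es) f)"
    using Cons.prems assms(1) by (simp add: prod.distrib prod.delta)
  finally show ?case using Cons by simp
qed simp

text \<open>The Leibniz sum over the occurrences of \<open>e\<close> collapses to the power rule.
  For multiplicity 0 the truncated exponent is harmless, as the factor in front is 0.\<close>

lemma mono_deriv_eq_prod_count:
  assumes "finite I" "set es \<subseteq> I" "e \<in> I"
  shows "mono_deriv e es x = real (count (mset es) e) * x e ^ (count (mset es) e - 1)
           * (\<Prod>f\<in>I - {e}. x f ^ count (mset es) f)"
  using assms(2)
proof (induction es)
  case (Cons a es)
  let ?k = "count (mset es) e" and ?R = "\<lambda>es. \<Prod>f\<in>I - {e}. x f ^ count (mset es) f"
  have pl: "prod_list (map x es) = x e ^ ?k * ?R es"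
    using prod_list_map_eq_prod_count[OF assms(1), of es x] Cons.prems assms(1,3)
    by (simp add: prod.remove)
  have IH: "mono_deriv e es x = real ?k * x e ^ (?k - 1) * ?R es" using Cons by simp
  show ?case
  proof (cases "a = e")
    case True
    have "?R (a # es) = ?R es" using True by (intro prod.cong) auto
    moreover have "x e * (real ?k * x e ^ (?k - 1)) = real ?k * x e ^ ?k" by (cases ?k) auto
    ultimately show ?thesis using True by (simp add: pl IH algebra_simps)
  next
    case False
    have "?R (a # es) = (\<Prod>f\<in>I - {e}. (if f = a then x a else 1) * x f ^ count (mset es) f)"
      by (intro prod.cong) auto
    also have "\<dots> = x a * ?R es"
      using False Cons.prems assms(1) by (simp add: prod.distrib prod.delta)
    finally show ?thesis using False by (simp add: IH)
  qed
qed simp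

(* The moment recursion characterises centred Gaussians of variance v e, including the
   degenerate ones. *)
locale gaussian_family = prob_space M for M :: "'a measure" +
  fixes I :: "'e set" and X :: "'e \<Rightarrow> 'a \<Rightarrow> real" and v :: "'e \<Rightarrow> real"
  assumes finite_I: "finite I"
    and indep: "indep_vars (\<lambda>_. borel) X I"
    and power_integrable: "\<And>e k. e \<in> I \<Longrightarrow> integrable M (\<lambda>\<omega>. X e \<omega> ^ k)"
    and power_moment: "\<And>e k. e \<in> I \<Longrightarrow>
          expectation (\<lambda>\<omega>. X e \<omega> ^ Suc k) = v e * real k * expectation (\<lambda>\<omega>. X e \<omega> ^ (k - 1))"
begin

abbreviation smp :: "'a \<Rightarrow> 'e \<Rightarrow> real" where "smp \<omega> \<equiv> \<lambda>e. X e \<omega>"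

lemma indep_powers: "indep_vars (\<lambda>_. borel) (\<lambda>e \<omega>. X e \<omega> ^ m e) I"
  using indep_vars_compose2[OF indep, of "\<lambda>e x. x ^ m e" "\<lambda>_. borel"] by simp

lemma prod_powers_integrable: "integrable M (\<lambda>\<omega>. \<Prod>e\<in>I. X e \<omega> ^ m e)"
  by (rule indep_vars_integrable[OF finite_I indep_powers power_integrable])

lemma prod_powers_expectation:
  "expectation (\<lambda>\<omega>. \<Prod>e\<in>I. X e \<omega> ^ m e) = (\<Prod>e\<in>I. expectation (\<lambda>\<omega>. X e \<omega> ^ m e))"
  by (rule indep_vars_lebesgue_integral[OF finite_I indep_powers power_integrable])

lemma monomial_integrable:
  assumes "set es \<subseteq> I" shows "integrable M (\<lambda>\<omega>. prod_list (map (smp \<omega>) es))"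
  unfolding prod_list_map_eq_prod_count[OF finite_I assms] by (rule prod_powers_integrable)

lemma split_power_prod:
  assumes "e \<in> I"
  shows "x e ^ j * (\<Prod>f\<in>I - {e}. x f ^ m f) = (\<Prod>f\<in>I. (x f :: real) ^ (m(e := j)) f)"
  using assms finite_I by (subst prod.remove[of I e]) (auto intro!: prod.cong)

lemma split_power_expectation:
  assumes "e \<in> I"
  shows "expectation (\<lambda>\<omega>. X e \<omega> ^ j * (\<Prod>f\<in>I - {e}. X f \<omega> ^ m f))
    = expectation (\<lambda>\<omega>. X e \<omega> ^ j) * (\<Prod>f\<in>I - {e}. expectation (\<lambda>\<omega>. X f \<omega> ^ m f))"
proof -
  have "expectation (\<lambda>\<omega>. X e \<omega> ^ j * (\<Prod>f\<in>I - {e}. X f \<omega> ^ m f))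
      = (\<Prod>f\<in>I. expectation (\<lambda>\<omega>. X f \<omega> ^ (m(e := j)) f))"
    using split_power_prod[OF assms, of "smp _"] by (simp add: prod_powers_expectation)
  also have "\<dots> = expectation (\<lambda>\<omega>. X e \<omega> ^ j) * (\<Prod>f\<in>I - {e}. expectation (\<lambda>\<omega>. X f \<omega> ^ m f))"
    using assms finite_I by (subst prod.remove[of I e]) (auto intro!: prod.cong)
  finally show ?thesis .
qed

lemma mono_deriv_integrable:
  assumes "e \<in> I" "set es \<subseteq> I" shows "integrable M (\<lambda>\<omega>. mono_deriv e es (smp \<omega>))"
  unfolding mono_deriv_eq_prod_count[OF finite_I assms(2,1)] mult.assoc
  using split_power_prod[OF assms(1), of "smp _"] prod_powers_integrable by simp

text \<open>Independence splits off the variable e. The moment recursion of this single variable,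
  with k its multiplicity in the word, replaces the expectation of X_e^(k+1) by v_e times that of k
  X_e^(k-1), which is the derivative of X_e^k.\<close>

lemma wick_monomial:
  assumes e: "e \<in> I" and es: "set es \<subseteq> I"
  shows "integrable M (\<lambda>\<omega>. X e \<omega> * prod_list (map (smp \<omega>) es))"
    and "expectation (\<lambda>\<omega>. X e \<omega> * prod_list (map (smp \<omega>) es)) = v e * expectation (\<lambda>\<omega>. mono_deriv e es (smp \<omega>))"
proof -
  let ?m = "count (mset es)"
  have "set (e # es) \<subseteq> I" using e es by simp
  from monomial_integrable[OF this] show "integrable M (\<lambda>\<omega>. X e \<omega> * prod_list (map (smp \<omega>) es))" by simp
  have "X e \<omega> * prod_list (map (smp \<omega>) es) = X e \<omega> ^ Suc (?m e) * (\<Prod>f\<in>I - {e}. X f \<omega> ^ ?m f)" for \<omega>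
    using prod_list_map_eq_prod_count[OF finite_I es, of "smp \<omega>"] prod.remove[OF finite_I e, of "\<lambda>f. X f \<omega> ^ ?m f"]
    by simp
  then have "expectation (\<lambda>\<omega>. X e \<omega> * prod_list (map (smp \<omega>) es))
      = v e * real (?m e) * expectation (\<lambda>\<omega>. X e \<omega> ^ (?m e - 1)) * (\<Prod>f\<in>I - {e}. expectation (\<lambda>\<omega>. X f \<omega> ^ ?m f))"
    by (simp only: split_power_expectation[OF e] power_moment[OF e])
  also have "\<dots> = v e * expectation (\<lambda>\<omega>. mono_deriv e es (smp \<omega>))"
    unfolding mono_deriv_eq_prod_count[OF finite_I es e] mult.assoc
    by (simp only: integral_mult_right_zero split_power_expectation[OF e])
  finally show "expectation (\<lambda>\<omega>. X e \<omega> * prod_list (map (smp \<omega>) es)) = v e * expectation (\<lambda>\<omega>. mono_deriv e es (smp \<omega>))" .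
qed

text \<open>Stein's identity for polynomials, extended from monomials by linearity. Integrability
  travels through the same induction because expectations are added only for integrable
  terms.\<close>

lemma gaussian_integration_by_parts:
  assumes e: "e \<in> I" and d: "pder I e f f'"
  shows "integrable M (\<lambda>\<omega>. f (smp \<omega>))" and "integrable M (\<lambda>\<omega>. f' (smp \<omega>))"
    and "integrable M (\<lambda>\<omega>. X e \<omega> * f (smp \<omega>))"
    and "expectation (\<lambda>\<omega>. X e \<omega> * f (smp \<omega>)) = v e * expectation (\<lambda>\<omega>. f' (smp \<omega>))"
proof -
  obtain r where r: "\<forall>(c, es) \<in> set r. set es \<subseteq> I" "f = poly_eval r" "f' = poly_deriv e r"
    using d unfolding pder_def by blast
  have "integrable M (\<lambda>\<omega>. poly_eval r (smp \<omega>)) \<and> integrable M (\<lambda>\<omega>. poly_deriv e r (smp \<omega>)) \<and>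
    integrable M (\<lambda>\<omega>. X e \<omega> * poly_eval r (smp \<omega>)) \<and>
    expectation (\<lambda>\<omega>. X e \<omega> * poly_eval r (smp \<omega>)) = v e * expectation (\<lambda>\<omega>. poly_deriv e r (smp \<omega>))"
    using r(1)
  proof (induction r)
    case Nil
    then show ?case by (simp add: poly_eval_def poly_deriv_def)
  next
    case (Cons a r)
    obtain c es where a: "a = (c, es)" by force
    have es: "set es \<subseteq> I" using Cons.prems a by auto
    have 1: "poly_eval (a # r) x = c * prod_list (map x es) + poly_eval r x"
      and 2: "poly_deriv e (a # r) x = c * mono_deriv e es x + poly_deriv e r x" for x
      by (simp_all add: a poly_eval_def poly_deriv_def)
    have 3: "X e \<omega> * poly_eval (a # r) (smp \<omega>) = c * (X e \<omega> * prod_list (map (smp \<omega>) es)) + X e \<omega> * poly_eval r (smp \<omega>)" for \<omega>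
      by (simp add: 1 algebra_simps)
    have IH: "integrable M (\<lambda>\<omega>. poly_eval r (smp \<omega>))" "integrable M (\<lambda>\<omega>. poly_deriv e r (smp \<omega>))"
      "integrable M (\<lambda>\<omega>. X e \<omega> * poly_eval r (smp \<omega>))"
      "expectation (\<lambda>\<omega>. X e \<omega> * poly_eval r (smp \<omega>)) = v e * expectation (\<lambda>\<omega>. poly_deriv e r (smp \<omega>))"
      using Cons by auto
    note int = IH(1-3) wick_monomial(1)[OF e es] monomial_integrable[OF es] mono_deriv_integrable[OF e es]
    have "expectation (\<lambda>\<omega>. X e \<omega> * poly_eval (a # r) (smp \<omega>)) = v e * expectation (\<lambda>\<omega>. poly_deriv e (a # r) (smp \<omega>))"
      unfolding 3 unfolding 2 using int IH(4) wick_monomial(2)[OF e es]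
      by (simp add: Bochner_Integration.integral_add algebra_simps)
    moreover have "integrable M (\<lambda>\<omega>. poly_eval (a # r) (smp \<omega>))" "integrable M (\<lambda>\<omega>. poly_deriv e (a # r) (smp \<omega>))"
      "integrable M (\<lambda>\<omega>. X e \<omega> * poly_eval (a # r) (smp \<omega>))"
      unfolding 3 unfolding 1 2 using int by simp_all
    ultimately show ?case by blast
  qed
  then show "integrable M (\<lambda>\<omega>. f (smp \<omega>))" "integrable M (\<lambda>\<omega>. f' (smp \<omega>))"
    "integrable M (\<lambda>\<omega>. X e \<omega> * f (smp \<omega>))"
    "expectation (\<lambda>\<omega>. X e \<omega> * f (smp \<omega>)) = v e * expectation (\<lambda>\<omega>. f' (smp \<omega>))"
    using r by auto
qed

end

section \<open>Moments of a single Gaussian variable\<close>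

context prob_space
begin

text \<open>A point mass with mean 0 has variance 0, and both sides vanish. For standard deviation t
  > 0 the even moments are t^(2 m) (2 m)! / (2^m m!), with consecutive ratio t^2 (2 m + 1), and the
  odd moments are 0; at k = 0 the factor k matches the vanishing mean.\<close>

lemma centred_gaussian_moments:
  assumes g: "gaussian_rv M Z" and mean: "expectation Z = 0" and var: "expectation (\<lambda>\<omega>. (Z \<omega>)\<^sup>2) = s"
  shows "integrable M (\<lambda>\<omega>. Z \<omega> ^ k)"
    and "expectation (\<lambda>\<omega>. Z \<omega> ^ Suc k) = s * real k * expectation (\<lambda>\<omega>. Z \<omega> ^ (k - 1))"
proof -
  have Z[measurable]: "Z \<in> borel_measurable M" using g unfolding gaussian_rv_def by blast
  have E: "expectation (\<lambda>\<omega>. f (Z \<omega>)) = (\<integral>x. f x \<partial>distr M borel Z)"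
    and I: "integrable M (\<lambda>\<omega>. f (Z \<omega>)) \<longleftrightarrow> integrable (distr M borel Z) f"
    if "f \<in> borel_measurable borel" for f :: "real \<Rightarrow> real"
    using that by (simp_all add: integral_distr integrable_distr_eq)
  from g consider (normal) \<mu> t where "t > 0" "distr M borel Z = density lborel (\<lambda>x. ennreal (normal_density \<mu> t x))"
    | (point) \<mu> where "distr M borel Z = return borel \<mu>"
    unfolding gaussian_rv_def by blast
  then have "integrable M (\<lambda>\<omega>. Z \<omega> ^ k) \<and>
    expectation (\<lambda>\<omega>. Z \<omega> ^ Suc k) = s * real k * expectation (\<lambda>\<omega>. Z \<omega> ^ (k - 1))"
  proof cases
    case point
    have R: "expectation (\<lambda>\<omega>. f (Z \<omega>)) = f \<mu>" if "f \<in> borel_measurable borel" for f :: "real \<Rightarrow> real"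
      using that by (simp add: E point integral_return)
    have "\<mu> = 0" using R[of "\<lambda>x. x"] mean by simp
    then have "s = 0" using R[of "\<lambda>x. x\<^sup>2"] var by simp
    have "integrable M (\<lambda>\<omega>. Z \<omega> ^ k)"
    proof -
      have "integrable (return borel \<mu>) (\<lambda>x. x ^ k)"
        by (intro integrableI_bounded) (simp_all add: nn_integral_return)
      then show ?thesis using I[of "\<lambda>x. x ^ k"] unfolding point by simp
    qed
    then show ?thesis using R[of "\<lambda>x. x ^ Suc k"] \<open>\<mu> = 0\<close> \<open>s = 0\<close> by simp
  next
    case normal
    have N: "expectation (\<lambda>\<omega>. f (Z \<omega>)) = (\<integral>x. normal_density \<mu> t x * f x \<partial>lborel)"
      if "f \<in> borel_measurable borel" for f :: "real \<Rightarrow> real"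
      using that by (simp add: E normal(2) integral_density normal_density_nonneg)
    have "\<mu> = 0" using N[of "\<lambda>x. x"] mean integral_normal_moment_nz_1[OF normal(1)] by simp
    then have even: "expectation (\<lambda>\<omega>. Z \<omega> ^ (2 * m)) = fact (2 * m) / ((2 / t\<^sup>2) ^ m * fact m)"
      and odd: "expectation (\<lambda>\<omega>. Z \<omega> ^ (2 * m + 1)) = 0" for m
      using N[of "\<lambda>x. x ^ (2 * m)"] N[of "\<lambda>x. x ^ (2 * m + 1)"]
        integral_normal_moment_even[OF normal(1), of 0 m] integral_normal_moment_odd[OF normal(1), of 0 m]
      by simp_all
    have s: "s = t\<^sup>2" using even[of 1] var by (simp add: numeral_2_eq_2)
    have "integrable lborel (\<lambda>x. normal_density 0 t x * x ^ k)"
      using integrable_normal_moment[OF normal(1), of 0 k] by simp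
    then have "integrable M (\<lambda>\<omega>. Z \<omega> ^ k)"
      using I[of "\<lambda>x. x ^ k"] unfolding normal(2) \<open>\<mu> = 0\<close>
      by (simp add: integrable_density normal_density_nonneg)
    moreover have "expectation (\<lambda>\<omega>. Z \<omega> ^ Suc k) = s * real k * expectation (\<lambda>\<omega>. Z \<omega> ^ (k - 1))"
    proof (cases "odd k")
      case True
      then obtain m where k: "k = 2 * m + 1" by (rule oddE)
      have "(fact (2 * Suc m) :: real) = (2 * real m + 2) * ((2 * real m + 1) * fact (2 * m))"
        by (simp add: algebra_simps)
      then have "fact (2 * Suc m) / ((2 / t\<^sup>2) ^ Suc m * fact (Suc m))
          = t\<^sup>2 * (2 * real m + 1) * (fact (2 * m) / ((2 / t\<^sup>2) ^ m * fact m))"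
      proof -
        have aux: "(2 * r + 2) * ((2 * r + 1) * F) / ((2 / q) * p * ((r + 1) * G)) = q * (2 * r + 1) * (F / (p * G))"
          if "r \<ge> 0" "q > 0" "p > 0" "G > 0" for r q p F G :: real
        proof -
          have e: "(2 * r + 2) * ((2 * r + 1) * F) = ((r + 1) * 2) * ((2 * r + 1) * F)"
            "(2 / q) * p * ((r + 1) * G) = ((r + 1) * 2) * (p * G / q)" by simp_all
          have "(r + 1) * 2 \<noteq> 0" using that by simp
          then show ?thesis unfolding e by (subst mult_divide_mult_cancel_left) (use that in simp_all)
        qed
        show ?thesis
          using aux[of "real m" "t\<^sup>2" "(2 / t\<^sup>2) ^ m" "fact m" "fact (2 * m)"] normal(1)
          unfolding \<open>fact (2 * Suc m) = (2 * real m + 2) * ((2 * real m + 1) * fact (2 * m))\<close>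
          by (simp add: add.commute)
      qed
      then show ?thesis using even[of "Suc m"] even[of m] unfolding k s by simp
    next
      case False
      then obtain m where k: "k = 2 * m" by (metis evenE)
      show ?thesis
      proof (cases m)
        case 0
        then show ?thesis using mean k by simp
      next
        case (Suc m')
        then show ?thesis using odd[of m] odd[of m'] unfolding k by simp
      qed
    qed
    ultimately show ?thesis by blast
  qed
  then show "integrable M (\<lambda>\<omega>. Z \<omega> ^ k)"
    "expectation (\<lambda>\<omega>. Z \<omega> ^ Suc k) = s * real k * expectation (\<lambda>\<omega>. Z \<omega> ^ (k - 1))" by auto
qed

end

section \<open>Powers of a Gaussian matrix\<close>

text \<open>Positions (i, j) and (j, i) share one variable. Functions of the matrix thus become
  functions of independent variables, and symmetry is built into the indexing.\<close>

definition edge :: "nat \<Rightarrow> nat \<Rightarrow> nat \<times> nat" where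
  "edge i j = (min i j, max i j)"

lemma edge_commute: "edge i j = edge j i"
  unfolding edge_def by (simp add: min.commute max.commute)

lemma edge_eq_iff: "edge i j = edge p q \<longleftrightarrow> (i = p \<and> j = q) \<or> (i = q \<and> j = p)"
  unfolding edge_def by (auto simp: min_def max_def split: if_splits)

definition upper_indices :: "nat \<Rightarrow> (nat \<times> nat) set" where
  "upper_indices n = {(i, j). 1 \<le> i \<and> i \<le> j \<and> j \<le> n}"

lemma edge_upper: "i \<in> {1..n} \<Longrightarrow> j \<in> {1..n} \<Longrightarrow> edge i j \<in> upper_indices n"
  unfolding edge_def upper_indices_def by auto

lemma finite_upper_indices: "finite (upper_indices n)"
  by (rule finite_subset[of _ "{1..n} \<times> {1..n}"]) (auto simp: upper_indices_def)

text \<open>Entries of powers as explicit functions of the variables, so that \<open>pder\<close>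
  applies; indices run from 1 as in the array. \<open>mat_power_eq_wpow\<close> makes the link to
  library matrices.\<close>

fun wpow :: "nat \<Rightarrow> (nat \<times> nat \<Rightarrow> real) \<Rightarrow> nat \<Rightarrow> nat \<Rightarrow> nat \<Rightarrow> real" where
  "wpow n x 0 i j = (if i = j then 1 else 0)"
| "wpow n x (Suc k) i j = (\<Sum>l=1..n. x (edge i l) * wpow n x k l j)"

lemma wpow_add:
  assumes "i \<in> {1..n}"
  shows "wpow n x (a + b) i j = (\<Sum>l=1..n. wpow n x a i l * wpow n x b l j)"
  using assms
proof (induction a arbitrary: i)
  case 0
  have "(\<Sum>l=1..n. wpow n x 0 i l * wpow n x b l j) = (\<Sum>l=1..n. if i = l then wpow n x b i j else 0)"
    by (intro sum.cong) auto
  then show ?case using 0 by simp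
next
  case (Suc a)
  have "wpow n x (Suc a + b) i j = (\<Sum>m=1..n. x (edge i m) * (\<Sum>l=1..n. wpow n x a m l * wpow n x b l j))"
    using Suc by simp
  also have "\<dots> = (\<Sum>l=1..n. \<Sum>m=1..n. x (edge i m) * wpow n x a m l * wpow n x b l j)"
    by (subst sum.swap) (simp add: sum_distrib_left mult.assoc)
  finally show ?case by (simp add: sum_distrib_right)
qed

lemma wpow_1: "i \<in> {1..n} \<Longrightarrow> j \<in> {1..n} \<Longrightarrow> wpow n x (Suc 0) i j = x (edge i j)"
proof -
  assume *: "i \<in> {1..n}" "j \<in> {1..n}"
  have "wpow n x (Suc 0) i j = (\<Sum>l=1..n. if l = j then x (edge i j) else 0)"
    unfolding wpow.simps by (intro sum.cong) auto
  then show ?thesis using * by simp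
qed

lemma wpow_Suc_right:
  assumes "i \<in> {1..n}" "j \<in> {1..n}"
  shows "wpow n x (Suc k) i j = (\<Sum>l=1..n. wpow n x k i l * x (edge l j))"
proof -
  have "wpow n x (k + Suc 0) i j = (\<Sum>l=1..n. wpow n x k i l * wpow n x (Suc 0) l j)"
    by (rule wpow_add[OF assms(1)])
  also have "\<dots> = (\<Sum>l=1..n. wpow n x k i l * x (edge l j))"
    using assms(2) by (intro sum.cong refl) (simp only: wpow_1)
  finally show ?thesis by simp
qed

lemma wpow_commute:
  assumes "i \<in> {1..n}" "j \<in> {1..n}"
  shows "wpow n x k i j = wpow n x k j i"
  using assms
proof (induction k arbitrary: i j)
  case (Suc k)
  have "wpow n x (Suc k) i j = (\<Sum>l=1..n. wpow n x k i l * x (edge l j))"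
    by (rule wpow_Suc_right[OF Suc.prems])
  also have "\<dots> = (\<Sum>l=1..n. x (edge j l) * wpow n x k l i)"
    using Suc by (intro sum.cong refl) (simp add: edge_commute mult.commute)
  finally show ?case by simp
qed simp

lemma sum_wpow_square:
  assumes "j \<in> {1..n}"
  shows "(\<Sum>l=1..n. (wpow n x a l j)\<^sup>2) = wpow n x (a + a) j j"
  unfolding wpow_add[OF assms] power2_eq_square
  using assms by (intro sum.cong refl) (simp add: wpow_commute)

text \<open>The derivative of W^k is the sum of W^a (dW) W^(k-1-a). The variable of
  \<open>edge p q\<close> occupies the positions (p, q) and (q, p), which gives two terms for each
  a, or one when p = q.\<close>

lemma pder_wpow:
  assumes p: "p \<in> {1..n}" and q: "q \<in> {1..n}" and u: "u \<in> {1..n}"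
  shows "pder (upper_indices n) (edge p q) (\<lambda>x. wpow n x k u w)
    (\<lambda>x. \<Sum>a<k. wpow n x a u p * wpow n x (k - 1 - a) q w
       + (if p = q then 0 else 1) * (wpow n x a u q * wpow n x (k - 1 - a) p w))"
  using u
proof (induction k arbitrary: u)
  case 0
  show ?case by (simp add: pder_const)
next
  case (Suc k)
  let ?\<theta> = "if p = q then 0 else 1 :: real"
  let ?D = "\<lambda>x l. \<Sum>a<k. wpow n x a l p * wpow n x (k - 1 - a) q w + ?\<theta> * (wpow n x a l q * wpow n x (k - 1 - a) p w)"
  have "pder (upper_indices n) (edge p q) (\<lambda>x. \<Sum>l=1..n. x (edge u l) * wpow n x k l w)
     (\<lambda>x. \<Sum>l=1..n. (if edge u l = edge p q then 1 else 0) * wpow n x k l w + x (edge u l) * ?D x l)"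
    using Suc by (intro pder_sum pder_mult pder_var edge_upper) auto
  then have 1: "pder (upper_indices n) (edge p q) (\<lambda>x. wpow n x (Suc k) u w)
     (\<lambda>x. \<Sum>l=1..n. (if edge u l = edge p q then 1 else 0) * wpow n x k l w + x (edge u l) * ?D x l)"
    by simp
  show ?case
  proof (rule pder_cong[OF 1])
    fix x
    \<comment> \<open>The new leftmost factor supplies the term a = 0; the induction hypothesis
      supplies the others, with a shifted by one.\<close>
    have a: "(\<Sum>l=1..n. (if edge u l = edge p q then 1 else 0) * wpow n x k l w)
       = wpow n x 0 u p * wpow n x k q w + ?\<theta> * (wpow n x 0 u q * wpow n x k p w)"
    proof -
      have "(\<Sum>l=1..n. (if edge u l = edge p q then 1 else 0) * wpow n x k l w)
         = (\<Sum>l=1..n. (if l = q then wpow n x 0 u p * wpow n x k q w else 0)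
              + (if l = p then ?\<theta> * (wpow n x 0 u q * wpow n x k p w) else 0))"
        by (intro sum.cong) (auto simp: edge_eq_iff)
      then show ?thesis using p q by (simp add: sum.distrib)
    qed
    have b: "(\<Sum>l=1..n. x (edge u l) * ?D x l)
        = (\<Sum>a<k. wpow n x (Suc a) u p * wpow n x (k - 1 - a) q w
            + ?\<theta> * (wpow n x (Suc a) u q * wpow n x (k - 1 - a) p w))"
    proof -
      have "(\<Sum>l=1..n. x (edge u l) * ?D x l)
        = (\<Sum>a<k. \<Sum>l=1..n. x (edge u l) * (wpow n x a l p * wpow n x (k - 1 - a) q w
            + ?\<theta> * (wpow n x a l q * wpow n x (k - 1 - a) p w)))"
        unfolding sum_distrib_left by (rule sum.swap)
      also have "\<dots> = (\<Sum>a<k. wpow n x (Suc a) u p * wpow n x (k - 1 - a) q w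
            + ?\<theta> * (wpow n x (Suc a) u q * wpow n x (k - 1 - a) p w))"
        by (intro sum.cong refl) (simp add: sum.distrib sum_distrib_left sum_distrib_right algebra_simps)
      finally show ?thesis .
    qed
    show "(\<Sum>l=1..n. (if edge u l = edge p q then 1 else 0) * wpow n x k l w + x (edge u l) * ?D x l)
      = (\<Sum>a<Suc k. wpow n x a u p * wpow n x (Suc k - 1 - a) q w
          + ?\<theta> * (wpow n x a u q * wpow n x (Suc k - 1 - a) p w))"
      unfolding sum.distrib[of "\<lambda>l. (if edge u l = edge p q then 1 else 0) * wpow n x k l w"]
        a b sum.lessThan_Suc_shift
      by simp
  qed
qed

section \<open>Uniform bounds for expected products of entries of powers\<close>

definition wprod :: "nat \<Rightarrow> (nat \<times> nat \<Rightarrow> real) \<Rightarrow> (nat \<times> nat \<times> nat) list \<Rightarrow> real" where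
  "wprod n x fs = prod_list (map (\<lambda>(k, u, w). wpow n x k u w) fs)"

text \<open>A triple (k, u, w) stands for (W^k)_uw, which is homogeneous of degree k in the entries
  of W; this is the degree of the whole product.\<close>

definition wdeg :: "(nat \<times> nat \<times> nat) list \<Rightarrow> nat" where
  "wdeg fs = sum_list (map fst fs)"

text \<open>The summands of the derivative are kept as a list and not as a sum, because their
  number, their degrees and their numbers of factors drive the moment bound.\<close>

fun wfactor_deriv :: "nat \<Rightarrow> nat \<Rightarrow> nat \<times> nat \<times> nat \<Rightarrow> (nat \<times> nat \<times> nat) list list" where
  "wfactor_deriv p q (k, u, w) = concat (map (\<lambda>a. [(a, u, p), (k - 1 - a, q, w)] #
      (if p = q then [] else [[(a, u, q), (k - 1 - a, p, w)]])) [0..<k])"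

fun wprod_deriv :: "nat \<Rightarrow> nat \<Rightarrow> (nat \<times> nat \<times> nat) list \<Rightarrow> (nat \<times> nat \<times> nat) list list" where
  "wprod_deriv p q [] = []"
| "wprod_deriv p q (f # fs) = map (\<lambda>g. g @ fs) (wfactor_deriv p q f) @ map ((#) f) (wprod_deriv p q fs)"

lemma wprod_simps [simp]:
  "wprod n x [] = 1"
  "wprod n x ((k, u, w) # fs) = wpow n x k u w * wprod n x fs"
  "wprod n x (fs @ gs) = wprod n x fs * wprod n x gs"
  by (simp_all add: wprod_def)

lemma wdeg_simps [simp]:
  "wdeg [] = 0" "wdeg (f # fs) = fst f + wdeg fs" "wdeg (fs @ gs) = wdeg fs + wdeg gs"
  by (simp_all add: wdeg_def)

lemma sum_wfactor_deriv:
  "(\<Sum>gs\<leftarrow>wfactor_deriv p q (k, u, w). wprod n x gs)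
     = (\<Sum>a<k. wpow n x a u p * wpow n x (k - 1 - a) q w
       + (if p = q then 0 else 1) * (wpow n x a u q * wpow n x (k - 1 - a) p w))"
proof -
  have "(\<Sum>gs\<leftarrow>concat (map h as). wprod n x gs) = (\<Sum>a\<leftarrow>as. \<Sum>gs\<leftarrow>h a. wprod n x gs)"
    for h :: "nat \<Rightarrow> (nat \<times> nat \<times> nat) list list" and as
    by (induction as) auto
  then have "(\<Sum>gs\<leftarrow>wfactor_deriv p q (k, u, w). wprod n x gs)
    = (\<Sum>a\<leftarrow>[0..<k]. wpow n x a u p * wpow n x (k - 1 - a) q w
       + (if p = q then 0 else 1) * (wpow n x a u q * wpow n x (k - 1 - a) p w))"
    by (simp cong: map_cong)
  then show ?thesis by (simp add: sum_list_distinct_conv_sum_set atLeast0LessThan)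
qed

lemma pder_wprod:
  assumes p: "p \<in> {1..n}" and q: "q \<in> {1..n}"
    and fs: "\<forall>(k, u, w) \<in> set fs. u \<in> {1..n} \<and> w \<in> {1..n}"
  shows "pder (upper_indices n) (edge p q) (\<lambda>x. wprod n x fs) (\<lambda>x. \<Sum>gs\<leftarrow>wprod_deriv p q fs. wprod n x gs)"
  using fs
proof (induction fs)
  case Nil
  show ?case by (simp add: pder_const)
next
  case (Cons f fs)
  obtain k u w where f: "f = (k, u, w)" by (metis prod_cases3)
  have "pder (upper_indices n) (edge p q) (\<lambda>x. wpow n x k u w * wprod n x fs)
     (\<lambda>x. (\<Sum>gs\<leftarrow>wfactor_deriv p q (k, u, w). wprod n x gs) * wprod n x fs
        + wpow n x k u w * (\<Sum>gs\<leftarrow>wprod_deriv p q fs. wprod n x gs))"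
    unfolding sum_wfactor_deriv using Cons f by (intro pder_mult pder_wpow p q) auto
  then show ?case
    by (simp add: f o_def sum_list_mult_const sum_list_const_mult del: wfactor_deriv.simps)
qed

lemma wfactor_deriv_props:
  assumes "gs \<in> set (wfactor_deriv p q (k, u, w))" "{u, w, p, q} \<subseteq> A"
  shows "Suc (wdeg gs) = k \<and> (\<forall>(k', u', w') \<in> set gs. u' \<in> A \<and> w' \<in> A)"
  using assms by (auto split: if_splits)

lemma wprod_deriv_props:
  assumes "gs \<in> set (wprod_deriv p q fs)" "p \<in> A" "q \<in> A" "\<forall>(k, u, w) \<in> set fs. u \<in> A \<and> w \<in> A"
  shows "Suc (wdeg gs) = wdeg fs \<and> (\<forall>(k, u, w) \<in> set gs. u \<in> A \<and> w \<in> A)"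
  using assms
proof (induction fs arbitrary: gs)
  case (Cons f fs)
  obtain k u w where f: "f = (k, u, w)" by (metis prod_cases3)
  from Cons.prems(1) consider g where "g \<in> set (wfactor_deriv p q f)" "gs = g @ fs"
    | g where "g \<in> set (wprod_deriv p q fs)" "gs = f # g" by auto
  then show ?case
  proof cases
    case 1
    then have "Suc (wdeg g) = k \<and> (\<forall>(k', u', w') \<in> set g. u' \<in> A \<and> w' \<in> A)"
      using Cons.prems f by (intro wfactor_deriv_props[of g p q k u w A]) auto
    then show ?thesis using 1 Cons.prems f by auto
  next
    case 2
    then show ?thesis using Cons.IH[of g] Cons.prems f by auto
  qed
qed simp

text \<open>A factor of degree k has k places at which it can be differentiated, each giving at most
  two terms.\<close>

lemma length_wprod_deriv: "length (wprod_deriv p q fs) \<le> 2 * wdeg fs"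
proof (induction fs)
  case (Cons f fs)
  have L: "length (concat (map h [0..<k])) \<le> 2 * k" if "\<And>a. length (h a) \<le> 2"
    for k and h :: "nat \<Rightarrow> 'b list"
  proof (induction k)
    case (Suc k)
    then show ?case using that[of k] by simp
  qed simp
  then have "length (wfactor_deriv p q f) \<le> 2 * fst f"
    by (cases f) (simp only: wfactor_deriv.simps fst_conv, rule L, simp)
  then show ?case using Cons by simp
qed simp

text \<open>Differentiation splits one factor in two and leaves the others as they are.\<close>

lemma length_mem_wprod_deriv:
  assumes "gs \<in> set (wprod_deriv p q fs)"
  shows "length gs \<le> Suc (length fs)"
proof -
  have "length g = 2" if "g \<in> set (wfactor_deriv p q h)" for g h
    using that by (cases h) (auto split: if_splits)
  then show ?thesis
    using assms by (induction fs arbitrary: gs) (auto simp del: wfactor_deriv.simps)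
qed

declare wfactor_deriv.simps [simp del] wprod_deriv.simps [simp del]

text \<open>In degree d + 2 one entry is pulled out and another is removed by differentiation:
  \<open>T\<close> bounds a row of variances, 2 (d + 1) the number of terms in the derivative of a
  product of degree d + 1, and each term has degree d. The value 0 in degree one reflects centring.
  The dimension does not enter.\<close>

fun moment_const :: "real \<Rightarrow> nat \<Rightarrow> real" where
  "moment_const T 0 = 1"
| "moment_const T (Suc 0) = 0"
| "moment_const T (Suc (Suc d)) = T * (2 * real (Suc d) * moment_const T d)"

lemma moment_const_nonneg: "T \<ge> 0 \<Longrightarrow> moment_const T d \<ge> 0"
  by (induction T d rule: moment_const.induct) auto

locale gaussian_matrix = gaussian_family M "upper_indices n" X v
  for M :: "'a measure" and n X v +
  fixes T :: real
  assumes var_nonneg: "\<And>e. e \<in> upper_indices n \<Longrightarrow> v e \<ge> 0"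
    and row_bound: "\<And>j. j \<in> {1..n} \<Longrightarrow> (\<Sum>l=1..n. v (edge j l)) \<le> T"
    and T_nonneg: "T \<ge> 0"
begin

lemma wprod_integrable:
  assumes "\<forall>(k, u, w) \<in> set fs. u \<in> {1..n} \<and> w \<in> {1..n}"
  shows "integrable M (\<lambda>\<omega>. wprod n (smp \<omega>) fs)"
proof (cases "n = 0")
  case True
  then have "fs = []" using assms by (cases fs) auto
  then show ?thesis by simp
next
  case False
  \<comment> \<open>Integrability is read off from integration by parts, which asks for some
    variable; the edge at index 1 serves. In dimension 0 only the empty product has admissible
    indices.\<close>
  then have "1 \<in> {1..n}" by simp
  from gaussian_integration_by_parts(1)[OF edge_upper pder_wprod, OF this this this this assms]
  show ?thesis .
qed

text \<open>Pulling an entry out of the first factor and integrating by parts lowers the degree by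
  two and adds at most one factor, so the measure decreases; a factor of exponent 0 is an entry of
  the identity and is dropped. The row sum of variances absorbs the sum over the new index, which
  keeps the bound uniform in n.\<close>

lemma wprod_moment_bound:
  assumes "\<forall>(k, u, w) \<in> set fs. u \<in> {1..n} \<and> w \<in> {1..n}"
  shows "\<bar>expectation (\<lambda>\<omega>. wprod n (smp \<omega>) fs)\<bar> \<le> moment_const T (wdeg fs)"
  using assms
proof (induction "length fs + 2 * wdeg fs" arbitrary: fs rule: less_induct)
  case less
  show ?case
  proof (cases fs)
    case Nil
    then show ?thesis using prob_space by simp
  next
    case (Cons f fs')
    obtain k u w where f: "f = (k, u, w)" by (metis prod_cases3)
    have uw: "u \<in> {1..n}" "w \<in> {1..n}" and fs': "\<forall>(k, u, w) \<in> set fs'. u \<in> {1..n} \<and> w \<in> {1..n}"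
      using less.prems Cons f by auto
    show ?thesis
    proof (cases k)
      case 0
      have "\<bar>expectation (\<lambda>\<omega>. wprod n (smp \<omega>) fs')\<bar> \<le> moment_const T (wdeg fs')"
        using Cons f 0 by (intro less.hyps fs') simp
      then show ?thesis using Cons f 0 moment_const_nonneg[OF T_nonneg] by simp
    next
      case (Suc k')
      let ?d = "wdeg fs' + k'"
      \<comment> \<open>\<open>B\<close> bounds the expected derivative of what remains, a product
        of degree \<open>?d\<close>. In degree 0 there is nothing to differentiate and the
        expectation is 0.\<close>
      define B where "B = (case ?d of 0 \<Rightarrow> 0 | Suc d' \<Rightarrow> 2 * real (Suc d') * moment_const T d')"
      have each: "\<bar>expectation (\<lambda>\<omega>. X (edge u l) \<omega> * wprod n (smp \<omega>) ((k', l, w) # fs'))\<bar> \<le> v (edge u l) * B"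
        and int: "integrable M (\<lambda>\<omega>. X (edge u l) \<omega> * wprod n (smp \<omega>) ((k', l, w) # fs'))"
        if l: "l \<in> {1..n}" for l
      proof -
        let ?fs = "(k', l, w) # fs'" and ?gs = "wprod_deriv u l ((k', l, w) # fs')"
        have ok: "\<forall>(k, u, w) \<in> set ?fs. u \<in> {1..n} \<and> w \<in> {1..n}" using l uw fs' by auto
        note ibp = gaussian_integration_by_parts[OF edge_upper[OF uw(1) l] pder_wprod[OF uw(1) l ok]]
        show "integrable M (\<lambda>\<omega>. X (edge u l) \<omega> * wprod n (smp \<omega>) ?fs)" by (rule ibp(3))
        have gs: "Suc (wdeg gs) = ?d \<and> (\<forall>(k, u, w) \<in> set gs. u \<in> {1..n} \<and> w \<in> {1..n})"
          if "gs \<in> set ?gs" for gs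
          using wprod_deriv_props[OF that uw(1) l ok] by (simp add: add.commute)
        have lengs: "length gs \<le> length fs + 1" if "gs \<in> set ?gs" for gs
          using length_mem_wprod_deriv[OF that] Cons by simp
        have one: "\<bar>expectation (\<lambda>\<omega>. wprod n (smp \<omega>) gs)\<bar> \<le> moment_const T (?d - 1)"
          if "gs \<in> set ?gs" for gs
        proof -
          have "length gs + 2 * wdeg gs < length fs + 2 * wdeg fs"
            using gs[OF that] lengs[OF that] Cons f Suc by simp
          from less.hyps[OF this] gs[OF that] show ?thesis by (metis diff_Suc_1)
        qed
        have sl: "expectation (\<lambda>\<omega>. \<Sum>gs\<leftarrow>hs. wprod n (smp \<omega>) gs) = (\<Sum>gs\<leftarrow>hs. expectation (\<lambda>\<omega>. wprod n (smp \<omega>) gs))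
           \<and> integrable M (\<lambda>\<omega>. \<Sum>gs\<leftarrow>hs. wprod n (smp \<omega>) gs)
           \<and> \<bar>\<Sum>gs\<leftarrow>hs. expectation (\<lambda>\<omega>. wprod n (smp \<omega>) gs)\<bar> \<le> real (length hs) * moment_const T (?d - 1)"
          if "set hs \<subseteq> set ?gs" for hs
          using that
        proof (induction hs)
          case (Cons h hs)
          have "integrable M (\<lambda>\<omega>. wprod n (smp \<omega>) h)"
            using gs[of h] Cons.prems by (intro wprod_integrable) simp
          moreover have "\<bar>expectation (\<lambda>\<omega>. wprod n (smp \<omega>) h)\<bar> \<le> moment_const T (?d - 1)"
            using one Cons.prems by auto
          ultimately show ?case using Cons by (auto simp: algebra_simps)
        qed simp
        have "\<bar>\<Sum>gs\<leftarrow>?gs. expectation (\<lambda>\<omega>. wprod n (smp \<omega>) gs)\<bar> \<le> B"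
        proof (cases ?d)
          case 0
          then have "?gs = []" using length_wprod_deriv[of u l ?fs] by simp
          then show ?thesis unfolding B_def using 0 by simp
        next
          case (Suc d')
          have "\<bar>\<Sum>gs\<leftarrow>?gs. expectation (\<lambda>\<omega>. wprod n (smp \<omega>) gs)\<bar> \<le> real (length ?gs) * moment_const T d'"
            using sl[of ?gs] Suc by simp
          also have "\<dots> \<le> (2 * real (Suc d')) * moment_const T d'"
          proof (rule mult_right_mono[OF _ moment_const_nonneg[OF T_nonneg]])
            have "length ?gs \<le> 2 * Suc d'"
              using length_wprod_deriv[of u l ?fs] Suc by simp
            then show "real (length ?gs) \<le> 2 * real (Suc d')" by linarith
          qed
          finally show ?thesis unfolding B_def using Suc by simp
        qed
        moreover have "v (edge u l) \<ge> 0" by (rule var_nonneg[OF edge_upper[OF uw(1) l]])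
        ultimately show "\<bar>expectation (\<lambda>\<omega>. X (edge u l) \<omega> * wprod n (smp \<omega>) ?fs)\<bar> \<le> v (edge u l) * B"
          unfolding ibp(4) using sl[of ?gs] by (simp add: abs_mult mult_left_mono)
      qed
      have "wprod n x fs = (\<Sum>l=1..n. x (edge u l) * wprod n x ((k', l, w) # fs'))" for x
        using Cons f Suc by (simp add: sum_distrib_right mult.assoc)
      then have "\<bar>expectation (\<lambda>\<omega>. wprod n (smp \<omega>) fs)\<bar>
          = \<bar>\<Sum>l=1..n. expectation (\<lambda>\<omega>. X (edge u l) \<omega> * wprod n (smp \<omega>) ((k', l, w) # fs'))\<bar>"
        using int by (simp add: Bochner_Integration.integral_sum del: wprod_simps(2))
      also have "\<dots> \<le> (\<Sum>l=1..n. v (edge u l) * B)"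
        by (rule order_trans[OF sum_abs sum_mono]) (rule each)
      also have "\<dots> = (\<Sum>l=1..n. v (edge u l)) * B" by (simp add: sum_distrib_right)
      also have "\<dots> \<le> T * B"
      proof (rule mult_right_mono[OF row_bound[OF uw(1)]])
        show "B \<ge> 0" unfolding B_def
          by (cases ?d) (auto intro!: mult_nonneg_nonneg simp: moment_const_nonneg[OF T_nonneg])
      qed
      also have "T * B \<le> moment_const T (wdeg fs)"
      proof -
        have "wdeg fs = Suc ?d" using Cons f Suc by simp
        then show ?thesis unfolding B_def by (cases ?d) simp_all
      qed
      finally show ?thesis .
    qed
  qed
qed

lemma wpow_power_integrable:
  assumes "u \<in> {1..n}" "w \<in> {1..n}"
  shows "integrable M (\<lambda>\<omega>. wpow n (smp \<omega>) k u w ^ m)"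
    and "\<bar>expectation (\<lambda>\<omega>. wpow n (smp \<omega>) k u w ^ m)\<bar> \<le> moment_const T (k * m)"
proof -
  have 1: "wprod n x (replicate m (k, u, w)) = wpow n x k u w ^ m" for x
    by (simp add: wprod_def map_replicate prod_list_replicate)
  have 2: "wdeg (replicate m (k, u, w)) = k * m"
    by (simp add: wdeg_def map_replicate sum_list_replicate)
  have 3: "\<forall>(k, u, w) \<in> set (replicate m (k, u, w)). u \<in> {1..n} \<and> w \<in> {1..n}"
    using assms by (auto simp: set_replicate_conv_if)
  show "integrable M (\<lambda>\<omega>. wpow n (smp \<omega>) k u w ^ m)"
    using wprod_integrable[OF 3] unfolding 1 .
  show "\<bar>expectation (\<lambda>\<omega>. wpow n (smp \<omega>) k u w ^ m)\<bar> \<le> moment_const T (k * m)"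
    using wprod_moment_bound[OF 3] unfolding 1 2 .
qed

end

section \<open>Diagonal entries of matrix powers\<close>

declare wpow.simps(2) [simp del] semicircle_moment.simps(3) [simp del]

text \<open>Conditions (a) and (b) are recast as statements on the variances alone; \<open>T\<close>
  bounds the row sums in every dimension.\<close>

locale gaussian_matrix_sequence = prob_space M for M :: "'a measure" +
  fixes X :: "nat \<Rightarrow> nat \<times> nat \<Rightarrow> 'a \<Rightarrow> real" and v :: "nat \<Rightarrow> nat \<times> nat \<Rightarrow> real" and T :: real
  assumes matrix: "\<And>n. gaussian_matrix M n (X n) (v n) T"
    and rows_to_1: "(\<lambda>n. 1 / real n * (\<Sum>j=1..n. \<bar>(\<Sum>l=1..n. v n (edge j l)) - 1\<bar>)) \<longlonglongrightarrow> 0"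
    and large_variances_negligible: "\<And>\<epsilon>. \<epsilon> > 0 \<Longrightarrow>
      (\<lambda>n. 1 / real n * (\<Sum>j=1..n. \<Sum>l=1..n. if v n (edge j l) > \<epsilon> then v n (edge j l) else 0)) \<longlonglongrightarrow> 0"
begin

sublocale W: gaussian_matrix M n "X n" "v n" T for n by (rule matrix)

lemma T_nonneg: "T \<ge> 0" by (rule W.T_nonneg)

abbreviation P :: "nat \<Rightarrow> nat \<Rightarrow> nat \<Rightarrow> nat \<Rightarrow> 'a \<Rightarrow> real" where
  "P n k u w \<omega> \<equiv> wpow n (\<lambda>e. X n e \<omega>) k u w"

text \<open>Moment bounds of every order, uniform in the dimension and in both indices. Closure
  under sums and products lets Cauchy-Schwarz be applied to composite expressions without tracking
  orders; even powers avoid absolute values.\<close>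

definition bounded_moments :: "(nat \<Rightarrow> nat \<Rightarrow> nat \<Rightarrow> 'a \<Rightarrow> real) \<Rightarrow> bool" where
  "bounded_moments F \<longleftrightarrow>
     (\<forall>n. \<forall>j\<in>{1..n}. \<forall>l\<in>{1..n}. F n j l \<in> borel_measurable M) \<and>
     (\<forall>m. \<exists>K. \<forall>n. \<forall>j\<in>{1..n}. \<forall>l\<in>{1..n}.
        integrable M (\<lambda>\<omega>. F n j l \<omega> ^ (2 * m)) \<and> expectation (\<lambda>\<omega>. F n j l \<omega> ^ (2 * m)) \<le> K)"

lemma bounded_moments_measurable:
  "bounded_moments F \<Longrightarrow> j \<in> {1..n} \<Longrightarrow> l \<in> {1..n} \<Longrightarrow> F n j l \<in> borel_measurable M"
  unfolding bounded_moments_def by blast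

lemma bounded_momentsE:
  assumes "bounded_moments F"
  obtains K where "K \<ge> 0" "\<And>n j l. j \<in> {1..n} \<Longrightarrow> l \<in> {1..n} \<Longrightarrow> integrable M (\<lambda>\<omega>. F n j l \<omega> ^ (2 * m))"
    "\<And>n j l. j \<in> {1..n} \<Longrightarrow> l \<in> {1..n} \<Longrightarrow> expectation (\<lambda>\<omega>. F n j l \<omega> ^ (2 * m)) \<le> K"
proof -
  from assms obtain K where "\<forall>n. \<forall>j\<in>{1..n}. \<forall>l\<in>{1..n}.
        integrable M (\<lambda>\<omega>. F n j l \<omega> ^ (2 * m)) \<and> expectation (\<lambda>\<omega>. F n j l \<omega> ^ (2 * m)) \<le> K"
    unfolding bounded_moments_def by blast
  then show ?thesis by (intro that[of "max K 0"]) (auto simp: le_max_iff_disj)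
qed

text \<open>The common source of closure under sums and products. The exponent p may differ from m:
  the moment of order 2 m of a product is controlled by moments of order 4 m of its factors.\<close>

lemma bounded_moments_dominated:
  assumes F: "bounded_moments F" and G: "bounded_moments G"
    and H: "\<And>n j l. j \<in> {1..n} \<Longrightarrow> l \<in> {1..n} \<Longrightarrow> H n j l \<in> borel_measurable M"
    and dom: "\<And>m. \<exists>c p. \<forall>n j l \<omega>. j \<in> {1..n} \<longrightarrow> l \<in> {1..n} \<longrightarrow>
        H n j l \<omega> ^ (2 * m) \<le> c * (F n j l \<omega> ^ (2 * p) + G n j l \<omega> ^ (2 * p))"
  shows "bounded_moments H"
  unfolding bounded_moments_def
proof (intro conjI allI ballI)
  fix n j l :: nat assume "j \<in> {1..n}" "l \<in> {1..n}" then show "H n j l \<in> borel_measurable M" by (rule H)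
next
  fix m
  obtain c p where c: "\<And>n j l \<omega>. j \<in> {1..n} \<Longrightarrow> l \<in> {1..n} \<Longrightarrow>
      H n j l \<omega> ^ (2 * m) \<le> c * (F n j l \<omega> ^ (2 * p) + G n j l \<omega> ^ (2 * p))"
    using dom[of m] by metis
  obtain K where K: "K \<ge> 0"
    "\<And>n j l. j \<in> {1..n} \<Longrightarrow> l \<in> {1..n} \<Longrightarrow> integrable M (\<lambda>\<omega>. F n j l \<omega> ^ (2 * p))"
    "\<And>n j l. j \<in> {1..n} \<Longrightarrow> l \<in> {1..n} \<Longrightarrow> expectation (\<lambda>\<omega>. F n j l \<omega> ^ (2 * p)) \<le> K"
    using bounded_momentsE[OF F] by metis
  obtain L where L: "L \<ge> 0"
    "\<And>n j l. j \<in> {1..n} \<Longrightarrow> l \<in> {1..n} \<Longrightarrow> integrable M (\<lambda>\<omega>. G n j l \<omega> ^ (2 * p))"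
    "\<And>n j l. j \<in> {1..n} \<Longrightarrow> l \<in> {1..n} \<Longrightarrow> expectation (\<lambda>\<omega>. G n j l \<omega> ^ (2 * p)) \<le> L"
    using bounded_momentsE[OF G] by metis
  show "\<exists>K. \<forall>n. \<forall>j\<in>{1..n}. \<forall>l\<in>{1..n}.
     integrable M (\<lambda>\<omega>. H n j l \<omega> ^ (2 * m)) \<and> expectation (\<lambda>\<omega>. H n j l \<omega> ^ (2 * m)) \<le> K"
  proof (intro exI[of _ "\<bar>c\<bar> * (K + L)"] allI ballI)
    fix n j l :: nat assume jl: "j \<in> {1..n}" "l \<in> {1..n}"
    let ?B = "\<lambda>\<omega>. \<bar>c\<bar> * (F n j l \<omega> ^ (2 * p) + G n j l \<omega> ^ (2 * p))"
    have iB: "integrable M ?B" using K(2)[OF jl] L(2)[OF jl] by simp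
    have le: "H n j l \<omega> ^ (2 * m) \<le> ?B \<omega>" for \<omega>
      by (rule order_trans[OF c[OF jl]]) (intro mult_right_mono add_nonneg_nonneg zero_le_even_power, auto)
    have iH: "integrable M (\<lambda>\<omega>. H n j l \<omega> ^ (2 * m))"
    proof (rule Bochner_Integration.integrable_bound[OF iB])
      show "(\<lambda>\<omega>. H n j l \<omega> ^ (2 * m)) \<in> borel_measurable M" using H[OF jl] by simp
      have "norm (H n j l \<omega> ^ (2 * m)) \<le> norm (?B \<omega>)" for \<omega>
      proof -
        have "0 \<le> H n j l \<omega> ^ (2 * m)" by (intro zero_le_even_power) simp
        then show ?thesis using le[of \<omega>] by simp
      qed
      then show "AE \<omega> in M. norm (H n j l \<omega> ^ (2 * m)) \<le> norm (?B \<omega>)" by simp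
    qed
    have "expectation (\<lambda>\<omega>. H n j l \<omega> ^ (2 * m)) \<le> expectation ?B"
      by (rule integral_mono[OF iH iB le])
    also have "\<dots> = \<bar>c\<bar> * (expectation (\<lambda>\<omega>. F n j l \<omega> ^ (2 * p)) + expectation (\<lambda>\<omega>. G n j l \<omega> ^ (2 * p)))"
      using K(2)[OF jl] L(2)[OF jl] by simp
    also have "\<dots> \<le> \<bar>c\<bar> * (K + L)"
      using K(3)[OF jl] L(3)[OF jl] by (intro mult_left_mono add_mono) auto
    finally show "integrable M (\<lambda>\<omega>. H n j l \<omega> ^ (2 * m)) \<and> expectation (\<lambda>\<omega>. H n j l \<omega> ^ (2 * m)) \<le> \<bar>c\<bar> * (K + L)"
      using iH by blast
  qed
qed

lemma bounded_moments_mult: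
  assumes F: "bounded_moments F" and G: "bounded_moments G"
  shows "bounded_moments (\<lambda>n j l \<omega>. F n j l \<omega> * G n j l \<omega>)"
proof (rule bounded_moments_dominated[OF F G])
  fix n j l :: nat assume "j \<in> {1..n}" "l \<in> {1..n}"
  then show "(\<lambda>\<omega>. F n j l \<omega> * G n j l \<omega>) \<in> borel_measurable M"
    using F G by (intro borel_measurable_times bounded_moments_measurable)
next
  fix m
  have "(a * b) ^ (2 * m) \<le> 1 * (a ^ (2 * (2 * m)) + b ^ (2 * (2 * m)))" for a b :: real
  proof -
    have "0 \<le> (a ^ (2 * m) - b ^ (2 * m))\<^sup>2 + (a ^ (2 * m))\<^sup>2 + (b ^ (2 * m))\<^sup>2" by simp
    then have "a ^ (2 * m) * b ^ (2 * m) \<le> (a ^ (2 * m))\<^sup>2 + (b ^ (2 * m))\<^sup>2"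
      by (simp add: power2_diff)
    then show ?thesis by (simp add: power_mult_distrib power_mult[symmetric] mult.commute)
  qed
  then show "\<exists>c p. \<forall>n j l \<omega>. j \<in> {1..n} \<longrightarrow> l \<in> {1..n} \<longrightarrow>
      (F n j l \<omega> * G n j l \<omega>) ^ (2 * m) \<le> c * (F n j l \<omega> ^ (2 * p) + G n j l \<omega> ^ (2 * p))"
    by blast
qed

lemma bounded_moments_add:
  assumes F: "bounded_moments F" and G: "bounded_moments G"
  shows "bounded_moments (\<lambda>n j l \<omega>. F n j l \<omega> + G n j l \<omega>)"
proof (rule bounded_moments_dominated[OF F G])
  fix n j l :: nat assume "j \<in> {1..n}" "l \<in> {1..n}"
  then show "(\<lambda>\<omega>. F n j l \<omega> + G n j l \<omega>) \<in> borel_measurable M"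
    using F G by (intro borel_measurable_add bounded_moments_measurable)
next
  fix m
  have "(a + b) ^ (2 * m) \<le> 2 ^ (2 * m) * (a ^ (2 * m) + b ^ (2 * m))" for a b :: real
  proof -
    have "(a + b) ^ (2 * m) = \<bar>a + b\<bar> ^ (2 * m)" by (simp add: power_even_abs)
    also have "\<dots> \<le> (2 * max \<bar>a\<bar> \<bar>b\<bar>) ^ (2 * m)" by (intro power_mono) auto
    also have "\<dots> = 2 ^ (2 * m) * (max \<bar>a\<bar> \<bar>b\<bar>) ^ (2 * m)" by (rule power_mult_distrib)
    also have "\<dots> \<le> 2 ^ (2 * m) * (\<bar>a\<bar> ^ (2 * m) + \<bar>b\<bar> ^ (2 * m))"
      by (intro mult_left_mono) (auto simp: max_def)
    finally show ?thesis by (simp add: power_even_abs)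
  qed
  then show "\<exists>c p. \<forall>n j l \<omega>. j \<in> {1..n} \<longrightarrow> l \<in> {1..n} \<longrightarrow>
      (F n j l \<omega> + G n j l \<omega>) ^ (2 * m) \<le> c * (F n j l \<omega> ^ (2 * p) + G n j l \<omega> ^ (2 * p))"
    by blast
qed

lemma bounded_moments_bounded:
  assumes "\<And>n j l. \<bar>c n j l\<bar> \<le> B"
  shows "bounded_moments (\<lambda>n j l \<omega>. c n j l)"
  unfolding bounded_moments_def
proof (intro conjI allI ballI)
  fix m
  have "c n j l ^ (2 * m) \<le> B ^ (2 * m)" for n j l
    using power_mono[OF assms[of n j l], of "2 * m"] by (simp add: power_even_abs)
  then show "\<exists>K. \<forall>n. \<forall>j\<in>{1..n}. \<forall>l\<in>{1..n}. integrable M (\<lambda>\<omega>. c n j l ^ (2 * m))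
      \<and> expectation (\<lambda>\<omega>. c n j l ^ (2 * m)) \<le> K"
    using prob_space by (intro exI[of _ "B ^ (2 * m)"]) auto
qed simp

lemma bounded_moments_const: "bounded_moments (\<lambda>n j l \<omega>. c)"
  by (rule bounded_moments_bounded[of _ "\<bar>c\<bar>"]) simp

lemma bounded_moments_diff_const:
  "bounded_moments F \<Longrightarrow> bounded_moments (\<lambda>n j l \<omega>. F n j l \<omega> - c)"
  using bounded_moments_add[OF _ bounded_moments_const[of "- c"]] by simp

lemma bounded_moments_sum:
  assumes "finite A" "\<And>a. a \<in> A \<Longrightarrow> bounded_moments (F a)"
  shows "bounded_moments (\<lambda>n j l \<omega>. \<Sum>a\<in>A. F a n j l \<omega>)"
  using assms by (induction A rule: finite_induct) (auto intro: bounded_moments_const bounded_moments_add)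

text \<open>The index maps select which of the entries (l, l), (j, j), (l, j), (j, l) is meant, so
  one statement serves all factors that integration by parts produces.\<close>

lemma bounded_moments_P:
  assumes "\<And>n j l. j \<in> {1..n} \<Longrightarrow> l \<in> {1..n} \<Longrightarrow> f j l \<in> {1..n} \<and> g j l \<in> {1..n}"
  shows "bounded_moments (\<lambda>n j l. P n k (f j l) (g j l))"
  unfolding bounded_moments_def
proof (intro conjI allI ballI)
  fix n j l :: nat assume "j \<in> {1..n}" "l \<in> {1..n}"
  with assms have "f j l \<in> {1..n}" "g j l \<in> {1..n}" by auto
  from W.wpow_power_integrable(1)[OF this, of k 1] show "P n k (f j l) (g j l) \<in> borel_measurable M"
    by simp
next
  fix m
  show "\<exists>K. \<forall>n. \<forall>j\<in>{1..n}. \<forall>l\<in>{1..n}. integrable M (\<lambda>\<omega>. P n k (f j l) (g j l) \<omega> ^ (2 * m))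
      \<and> expectation (\<lambda>\<omega>. P n k (f j l) (g j l) \<omega> ^ (2 * m)) \<le> K"
  proof (intro exI[of _ "moment_const T (k * (2 * m))"] allI ballI)
    fix n j l :: nat assume "j \<in> {1..n}" "l \<in> {1..n}"
    with assms have "f j l \<in> {1..n}" "g j l \<in> {1..n}" by auto
    from W.wpow_power_integrable[OF this, of k "2 * m"]
    show "integrable M (\<lambda>\<omega>. P n k (f j l) (g j l) \<omega> ^ (2 * m))
      \<and> expectation (\<lambda>\<omega>. P n k (f j l) (g j l) \<omega> ^ (2 * m)) \<le> moment_const T (k * (2 * m))" by auto
  qed
qed

lemma bounded_moments_square_integrable:
  assumes "bounded_moments F" "j \<in> {1..n}" "l \<in> {1..n}"
  shows "integrable M (\<lambda>\<omega>. (F n j l \<omega>)\<^sup>2)"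
  using bounded_momentsE[OF assms(1), of 1] assms(2,3) by (metis mult_1_right)

lemma bounded_moments_integrable:
  assumes F: "bounded_moments F" and jl: "j \<in> {1..n}" "l \<in> {1..n}"
  shows "integrable M (F n j l)"
proof (rule square_integrable_imp_integrable)
  show "F n j l \<in> borel_measurable M" by (rule bounded_moments_measurable[OF F jl])
  show "integrable M (\<lambda>\<omega>. (F n j l \<omega>)\<^sup>2)" by (rule bounded_moments_square_integrable[OF F jl])
qed

text \<open>The weights S_jl are those with which integration by parts delivers its terms. A row has
  total weight at most \<open>T\<close>, so bounded expectations have bounded averages.\<close>

definition avg :: "(nat \<Rightarrow> nat \<Rightarrow> nat \<Rightarrow> 'a \<Rightarrow> real) \<Rightarrow> nat \<Rightarrow> real" where
  "avg F n = 1 / real n * (\<Sum>j=1..n. \<Sum>l=1..n. v n (edge j l) * expectation (F n j l))"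

lemma v_nonneg: "j \<in> {1..n} \<Longrightarrow> l \<in> {1..n} \<Longrightarrow> v n (edge j l) \<ge> 0"
  by (rule W.var_nonneg[OF edge_upper])

lemma avg_add:
  assumes "bounded_moments F" "bounded_moments G"
  shows "avg (\<lambda>n j l \<omega>. F n j l \<omega> + G n j l \<omega>) n = avg F n + avg G n"
proof -
  have "avg (\<lambda>n j l \<omega>. F n j l \<omega> + G n j l \<omega>) n
     = 1 / real n * (\<Sum>j=1..n. \<Sum>l=1..n. v n (edge j l) * expectation (F n j l) + v n (edge j l) * expectation (G n j l))"
    unfolding avg_def using assms
    by (intro arg_cong[where f = "\<lambda>t. 1 / real n * t"] sum.cong refl)
       (simp add: bounded_moments_integrable distrib_left)
  then show ?thesis unfolding avg_def by (simp add: sum.distrib distrib_left)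
qed

lemma avg_sum_tendsto_0:
  assumes "finite A" "\<And>a. a \<in> A \<Longrightarrow> bounded_moments (F a)" "\<And>a. a \<in> A \<Longrightarrow> avg (F a) \<longlonglongrightarrow> 0"
  shows "avg (\<lambda>n j l \<omega>. \<Sum>a\<in>A. F a n j l \<omega>) \<longlonglongrightarrow> 0"
  using assms
proof (induction A rule: finite_induct)
  case empty
  show ?case by (simp add: avg_def[abs_def])
next
  case (insert a A)
  have "avg (\<lambda>n j l \<omega>. F a n j l \<omega> + (\<Sum>a\<in>A. F a n j l \<omega>)) = (\<lambda>n. avg (F a) n + avg (\<lambda>n j l \<omega>. \<Sum>a\<in>A. F a n j l \<omega>) n)"
    using insert by (intro ext avg_add bounded_moments_sum) auto
  moreover have "(\<lambda>n. avg (F a) n + avg (\<lambda>n j l \<omega>. \<Sum>a\<in>A. F a n j l \<omega>) n) \<longlonglongrightarrow> 0 + 0"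
    using insert by (intro tendsto_add) auto
  ultimately show ?case using insert.hyps by simp
qed

lemma avg_add_tendsto_0:
  assumes "bounded_moments F" "bounded_moments G" "avg F \<longlonglongrightarrow> 0" "avg G \<longlonglongrightarrow> 0"
  shows "avg (\<lambda>n j l \<omega>. F n j l \<omega> + G n j l \<omega>) \<longlonglongrightarrow> 0"
proof -
  have "avg (\<lambda>n j l \<omega>. F n j l \<omega> + G n j l \<omega>) = (\<lambda>n. avg F n + avg G n)"
    using assms by (intro ext avg_add)
  then show ?thesis using tendsto_add[OF assms(3,4)] by simp
qed

lemma avg_bounded:
  assumes "\<And>j l. j \<in> {1..n} \<Longrightarrow> l \<in> {1..n} \<Longrightarrow> expectation (F n j l) \<le> K" and K: "K \<ge> 0"
  shows "avg F n \<le> T * K"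
proof -
  have "avg F n \<le> 1 / real n * (\<Sum>j=1..n. \<Sum>l=1..n. v n (edge j l) * K)"
    unfolding avg_def using assms by (intro mult_left_mono sum_mono v_nonneg) auto
  also have "\<dots> = 1 / real n * (\<Sum>j=1..n. (\<Sum>l=1..n. v n (edge j l)) * K)"
    by (simp add: sum_distrib_right)
  also have "\<dots> \<le> 1 / real n * (\<Sum>j=1..n. T * K)"
    using K by (intro mult_left_mono sum_mono mult_right_mono W.row_bound) auto
  also have "\<dots> \<le> T * K" using T_nonneg K by (cases "n = 0") auto
  finally show ?thesis .
qed

(* Cauchy-Schwarz, in the form |UV| <= U^2 / (2 r) + r V^2 / 2 with a free r > 0. *)
lemma avg_product_tendsto_0:
  assumes U: "bounded_moments U" and V: "bounded_moments V"
    and small: "avg (\<lambda>n j l \<omega>. (U n j l \<omega>)\<^sup>2) \<longlonglongrightarrow> 0"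
  shows "avg (\<lambda>n j l \<omega>. U n j l \<omega> * V n j l \<omega>) \<longlonglongrightarrow> 0"
proof (rule tendstoI)
  fix \<epsilon> :: real assume \<epsilon>: "\<epsilon> > 0"
  note iU = bounded_moments_square_integrable[OF U] and iV = bounded_moments_square_integrable[OF V]
  note iUV = bounded_moments_integrable[OF bounded_moments_mult[OF U V]]
  obtain K where K: "K \<ge> 0" and KV: "\<And>n j l. j \<in> {1..n} \<Longrightarrow> l \<in> {1..n} \<Longrightarrow> expectation (\<lambda>\<omega>. (V n j l \<omega>)\<^sup>2) \<le> K"
    using bounded_momentsE[OF V, of 1] by (metis mult_1_right)
  \<comment> \<open>Small enough that the part with V^2, whose average is at most T K, costs at most
    \<epsilon> / 2; the summand 1 covers T K = 0.\<close>
  define r where "r = \<epsilon> / (T * K + 1)"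
  have TK: "T * K \<ge> 0" using T_nonneg K by simp
  have r: "r > 0" unfolding r_def using \<epsilon> TK by simp
  have rTK: "r * (T * K) \<le> \<epsilon>" unfolding r_def using \<epsilon> TK by (simp add: field_simps)
  have am: "\<bar>a * b\<bar> \<le> 1 / (2 * r) * a\<^sup>2 + r / 2 * b\<^sup>2" for a b :: real
  proof -
    have "0 \<le> (\<bar>a\<bar> - r * \<bar>b\<bar>)\<^sup>2" by simp
    then have "2 * r * \<bar>a * b\<bar> \<le> a\<^sup>2 + r\<^sup>2 * b\<^sup>2" by (simp add: power2_diff power_mult_distrib abs_mult ac_simps)
    then show ?thesis using r by (simp add: field_simps power2_eq_square)
  qed
  have bound: "\<bar>avg (\<lambda>n j l \<omega>. U n j l \<omega> * V n j l \<omega>) n\<bar>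
      \<le> 1 / (2 * r) * avg (\<lambda>n j l \<omega>. (U n j l \<omega>)\<^sup>2) n + \<epsilon> / 2" for n
  proof -
    let ?e = "\<lambda>j l. 1 / (2 * r) * expectation (\<lambda>\<omega>. (U n j l \<omega>)\<^sup>2) + r / 2 * expectation (\<lambda>\<omega>. (V n j l \<omega>)\<^sup>2)"
    have one: "\<bar>expectation (\<lambda>\<omega>. U n j l \<omega> * V n j l \<omega>)\<bar> \<le> ?e j l"
      if jl: "j \<in> {1..n}" "l \<in> {1..n}" for j l
    proof -
      have "\<bar>expectation (\<lambda>\<omega>. U n j l \<omega> * V n j l \<omega>)\<bar> \<le> expectation (\<lambda>\<omega>. \<bar>U n j l \<omega> * V n j l \<omega>\<bar>)"
        by (rule integral_abs_bound)
      also have "\<dots> \<le> expectation (\<lambda>\<omega>. 1 / (2 * r) * (U n j l \<omega>)\<^sup>2 + r / 2 * (V n j l \<omega>)\<^sup>2)"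
        using iU[OF jl] iV[OF jl] iUV[OF jl] by (intro integral_mono am) auto
      also have "\<dots> = ?e j l" using iU[OF jl] iV[OF jl] by simp
      finally show ?thesis .
    qed
    have "\<bar>avg (\<lambda>n j l \<omega>. U n j l \<omega> * V n j l \<omega>) n\<bar>
      \<le> 1 / real n * (\<Sum>j=1..n. \<Sum>l=1..n. \<bar>v n (edge j l) * expectation (\<lambda>\<omega>. U n j l \<omega> * V n j l \<omega>)\<bar>)"
      unfolding avg_def abs_mult[of "1 / real n"]
      by (intro mult_mono order_trans[OF sum_abs] sum_mono) auto
    also have "\<dots> \<le> 1 / real n * (\<Sum>j=1..n. \<Sum>l=1..n. v n (edge j l) * ?e j l)"
      using one by (intro mult_left_mono sum_mono) (auto simp: abs_mult v_nonneg intro!: mult_mono)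
    also have "\<dots> = 1 / (2 * r) * avg (\<lambda>n j l \<omega>. (U n j l \<omega>)\<^sup>2) n + r / 2 * avg (\<lambda>n j l \<omega>. (V n j l \<omega>)\<^sup>2) n"
      unfolding avg_def sum_distrib_left distrib_left sum.distrib by (simp add: mult_ac)
    also have "\<dots> \<le> 1 / (2 * r) * avg (\<lambda>n j l \<omega>. (U n j l \<omega>)\<^sup>2) n + r / 2 * (T * K)"
      using r K KV by (intro add_left_mono mult_left_mono avg_bounded) auto
    finally show ?thesis using rTK by simp
  qed
  have "(\<lambda>n. 1 / (2 * r) * avg (\<lambda>n j l \<omega>. (U n j l \<omega>)\<^sup>2) n) \<longlonglongrightarrow> 1 / (2 * r) * 0"
    by (intro tendsto_intros small)
  then have "\<forall>\<^sub>F n in sequentially. 1 / (2 * r) * avg (\<lambda>n j l \<omega>. (U n j l \<omega>)\<^sup>2) n < \<epsilon> / 2"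
    using \<epsilon> by (intro order_tendstoD) auto
  then show "\<forall>\<^sub>F n in sequentially. dist (avg (\<lambda>n j l \<omega>. U n j l \<omega> * V n j l \<omega>) n) 0 < \<epsilon>"
  proof eventually_elim
    case (elim n)
    then show ?case using bound[of n] by (simp add: dist_real_def)
  qed
qed

(* Without the weights the squares of a row of W^a add up to a diagonal entry of W^(2a), so
   small weights make the average small. *)
lemma avg_off_diagonal_square: "avg (\<lambda>n j l \<omega>. (P n a l j \<omega>)\<^sup>2) \<longlonglongrightarrow> 0"
proof (rule tendstoI)
  fix \<delta> :: real assume \<delta>: "\<delta> > 0"
  \<comment> \<open>Both orders equal 2 a: the first form bounds the expectation of one squared
    entry, the second that of a sum of squares along a row, which is a diagonal entry of
    W^(2a).\<close>
  define K where "K = moment_const T (a * 2) + moment_const T (a + a)"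
  have K0: "moment_const T m \<ge> 0" for m by (rule moment_const_nonneg[OF T_nonneg])
  \<comment> \<open>Gives \<epsilon> K < \<delta>; the room that is left takes up the pairs of large
    variance once n is large.\<close>
  define \<epsilon> where "\<epsilon> = \<delta> / (2 * (K + 1))"
  have K: "K \<ge> 0" unfolding K_def using K0 by simp
  have \<epsilon>: "\<epsilon> > 0" unfolding \<epsilon>_def using \<delta> K by simp
  let ?L = "\<lambda>n. 1 / real n * (\<Sum>j=1..n. \<Sum>l=1..n. if v n (edge j l) > \<epsilon> then v n (edge j l) else 0)"
  have bound: "avg (\<lambda>n j l \<omega>. (P n a l j \<omega>)\<^sup>2) n \<le> \<epsilon> * K + K * ?L n" for n
  proof -
    let ?E = "\<lambda>j l. expectation (\<lambda>\<omega>. (P n a l j \<omega>)\<^sup>2)"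
    let ?big = "\<lambda>j l. if v n (edge j l) > \<epsilon> then v n (edge j l) else 0"
    have E: "?E j l \<ge> 0" "?E j l \<le> K" if "j \<in> {1..n}" "l \<in> {1..n}" for j l
      using W.wpow_power_integrable(2)[OF that(2,1), of a 2] K0[of "a + a"] unfolding K_def by auto
    have row: "(\<Sum>l=1..n. ?E j l) \<le> K" if j: "j \<in> {1..n}" for j
    proof -
      have "(\<Sum>l=1..n. ?E j l) = expectation (\<lambda>\<omega>. \<Sum>l=1..n. (P n a l j \<omega>)\<^sup>2)"
        using W.wpow_power_integrable(1) j by (intro Bochner_Integration.integral_sum[symmetric]) auto
      also have "\<dots> = expectation (\<lambda>\<omega>. P n (a + a) j j \<omega> ^ 1)"
        by (simp only: sum_wpow_square[OF j] power_one_right)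
      also have "\<dots> \<le> K"
        using W.wpow_power_integrable(2)[OF j j, of "a + a" 1] K0[of "a * 2"] unfolding K_def by simp
      finally show ?thesis .
    qed
    have "avg (\<lambda>n j l \<omega>. (P n a l j \<omega>)\<^sup>2) n
       \<le> 1 / real n * (\<Sum>j=1..n. \<Sum>l=1..n. \<epsilon> * ?E j l + K * ?big j l)"
      unfolding avg_def
    proof (intro mult_left_mono sum_mono)
      fix j l assume jl: "j \<in> {1..n}" "l \<in> {1..n}"
      show "v n (edge j l) * ?E j l \<le> \<epsilon> * ?E j l + K * ?big j l"
      proof (cases "v n (edge j l) > \<epsilon>")
        case True
        have "v n (edge j l) * ?E j l \<le> v n (edge j l) * K"
          using E[OF jl] v_nonneg[OF jl] by (intro mult_left_mono) auto
        moreover have "0 \<le> \<epsilon> * ?E j l" using E[OF jl] \<epsilon> by (intro mult_nonneg_nonneg) auto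
        ultimately show ?thesis using True by (simp add: mult.commute)
      next
        case False
        then show ?thesis using E[OF jl] by (simp add: mult_right_mono)
      qed
    qed simp
    also have "\<dots> = 1 / real n * (\<Sum>j=1..n. \<epsilon> * (\<Sum>l=1..n. ?E j l)) + K * ?L n"
      unfolding sum.distrib sum_distrib_left[symmetric] by (simp add: distrib_left)
    also have "\<dots> \<le> 1 / real n * (\<Sum>j=1..n. \<epsilon> * K) + K * ?L n"
      using \<epsilon> row by (intro add_right_mono mult_left_mono sum_mono) auto
    also have "\<dots> \<le> \<epsilon> * K + K * ?L n" using \<epsilon> K by (cases "n = 0") auto
    finally show ?thesis .
  qed
  have pos: "avg (\<lambda>n j l \<omega>. (P n a l j \<omega>)\<^sup>2) n \<ge> 0" for n
    unfolding avg_def by (intro mult_nonneg_nonneg sum_nonneg v_nonneg) auto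
  have "K / (2 * (K + 1)) < 1" using K by simp
  then have "\<delta> * (K / (2 * (K + 1))) < \<delta> * 1" using \<delta> by (intro mult_strict_left_mono)
  then have \<epsilon>K: "\<epsilon> * K < \<delta>" unfolding \<epsilon>_def by simp
  have "(\<lambda>n. \<epsilon> * K + K * ?L n) \<longlonglongrightarrow> \<epsilon> * K + K * 0"
    by (intro tendsto_intros large_variances_negligible \<epsilon>)
  then have "\<forall>\<^sub>F n in sequentially. \<epsilon> * K + K * ?L n < \<delta>"
    using \<epsilon>K by (intro order_tendstoD) auto
  then show "\<forall>\<^sub>F n in sequentially. dist (avg (\<lambda>n j l \<omega>. (P n a l j \<omega>)\<^sup>2) n) 0 < \<delta>"
  proof eventually_elim
    case (elim n)
    then show ?case using bound[of n] pos[of n] by (simp add: dist_real_def)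
  qed
qed

section \<open>Mean square convergence of the diagonal entries\<close>

definition diag_error :: "nat \<Rightarrow> nat \<Rightarrow> real" where
  "diag_error k n = 1 / real n * (\<Sum>j=1..n. expectation (\<lambda>\<omega>. (P n k j j \<omega> - semicircle_moment k)\<^sup>2))"

lemma bounded_moments_diag:
  "bounded_moments (\<lambda>n j l \<omega>. P n k j j \<omega> - semicircle_moment k)"
  "bounded_moments (\<lambda>n j l \<omega>. P n k l l \<omega> - semicircle_moment k)"
  by (intro bounded_moments_diff_const bounded_moments_P conjI; simp)+

lemma avg_diag_row_le: "avg (\<lambda>n j l \<omega>. (P n k j j \<omega> - semicircle_moment k)\<^sup>2) n \<le> T * diag_error k n"
proof -
  have "avg (\<lambda>n j l \<omega>. (P n k j j \<omega> - semicircle_moment k)\<^sup>2) n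
    = 1 / real n * (\<Sum>j=1..n. (\<Sum>l=1..n. v n (edge j l)) * expectation (\<lambda>\<omega>. (P n k j j \<omega> - semicircle_moment k)\<^sup>2))"
    unfolding avg_def by (simp add: sum_distrib_right)
  also have "\<dots> \<le> 1 / real n * (\<Sum>j=1..n. T * expectation (\<lambda>\<omega>. (P n k j j \<omega> - semicircle_moment k)\<^sup>2))"
    by (intro mult_left_mono sum_mono mult_right_mono W.row_bound) auto
  finally show ?thesis unfolding diag_error_def by (simp add: sum_distrib_left mult_ac)
qed

text \<open>The weights are symmetric in j and l, so exchanging the sums exchanges the two versions.
  Both occur, as integration by parts pairs (W^a)_ll with (W^b)_jj.\<close>

lemma avg_diag_column_eq:
  "avg (\<lambda>n j l \<omega>. (P n k l l \<omega> - semicircle_moment k)\<^sup>2) n = avg (\<lambda>n j l \<omega>. (P n k j j \<omega> - semicircle_moment k)\<^sup>2) n"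
  unfolding avg_def by (subst sum.swap) (simp add: edge_commute)

lemma avg_diag_tendsto_0:
  assumes "diag_error k \<longlonglongrightarrow> 0"
  shows "avg (\<lambda>n j l \<omega>. (P n k j j \<omega> - semicircle_moment k)\<^sup>2) \<longlonglongrightarrow> 0"
    and "avg (\<lambda>n j l \<omega>. (P n k l l \<omega> - semicircle_moment k)\<^sup>2) \<longlonglongrightarrow> 0"
proof -
  have lim: "(\<lambda>n. T * diag_error k n) \<longlonglongrightarrow> 0" using tendsto_mult[OF tendsto_const assms, of T] by simp
  have pos: "avg (\<lambda>n j l \<omega>. (P n k j j \<omega> - semicircle_moment k)\<^sup>2) n \<ge> 0" for n
    unfolding avg_def by (intro mult_nonneg_nonneg sum_nonneg v_nonneg) auto
  show 1: "avg (\<lambda>n j l \<omega>. (P n k j j \<omega> - semicircle_moment k)\<^sup>2) \<longlonglongrightarrow> 0"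
    by (rule tendsto_sandwich[OF always_eventually always_eventually tendsto_const lim])
       (intro allI pos avg_diag_row_le)+
  have "avg (\<lambda>n j l \<omega>. (P n k l l \<omega> - semicircle_moment k)\<^sup>2)
      = avg (\<lambda>n j l \<omega>. (P n k j j \<omega> - semicircle_moment k)\<^sup>2)"
    by (rule ext) (rule avg_diag_column_eq)
  with 1 show "avg (\<lambda>n j l \<omega>. (P n k l l \<omega> - semicircle_moment k)\<^sup>2) \<longlonglongrightarrow> 0" by (simp only:)
qed

text \<open>The second term in the derivative of a matrix power is absent when the variable sits on
  the diagonal.\<close>

definition offdiag :: "nat \<Rightarrow> nat \<Rightarrow> real" where
  "offdiag j l = (if l = j then 0 else 1)"

(* What is left of the integration by parts of E[(W^(k+1))_jj g_j] once the products of
   diagonal entries have been replaced by their limits. *)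
definition remainder :: "nat \<Rightarrow> nat \<Rightarrow> nat \<Rightarrow> nat \<Rightarrow> 'a \<Rightarrow> real" where
  "remainder k n j l \<omega> =
     (\<Sum>a<k. (P n a l l \<omega> - semicircle_moment a) * (P n (k - 1 - a) j j \<omega> * (P n (Suc k) j j \<omega> - semicircle_moment (Suc k)))
       + ((P n (k - 1 - a) j j \<omega> - semicircle_moment (k - 1 - a)) * (semicircle_moment a * (P n (Suc k) j j \<omega> - semicircle_moment (Suc k)))
       + P n a l j \<omega> * (offdiag j l * P n (k - 1 - a) l j \<omega> * (P n (Suc k) j j \<omega> - semicircle_moment (Suc k)))))
     + P n k l j \<omega> * (\<Sum>a<Suc k. P n a j l \<omega> * P n (k - a) j j \<omega> + offdiag j l * (P n a j j \<omega> * P n (k - a) l j \<omega>))"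

lemma bounded_moments_offdiag: "bounded_moments (\<lambda>n j l \<omega>. offdiag j l)"
  by (rule bounded_moments_bounded[of _ 1]) (simp add: offdiag_def)

lemmas bounded_moments_intros = bounded_moments_add bounded_moments_sum bounded_moments_mult
  bounded_moments_diag bounded_moments_const bounded_moments_offdiag bounded_moments_P

lemma bounded_moments_remainder: "bounded_moments (remainder k)"
  unfolding remainder_def[abs_def] by (intro bounded_moments_intros) auto

text \<open>Every term is a product of a factor small in weighted mean square and one of bounded
  moments. In \<open>R1\<close> and \<open>R2\<close> the small factor is the deviation of a
  diagonal entry of the power a or k - 1 - a, both below k. In \<open>R3\<close>, from the
  transposed term of dW, and in \<open>R4\<close>, where the derivative falls on the test variable,
  it is (W^a)_lj or (W^k)_lj.\<close>

lemma remainder_tendsto_0: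
  assumes "\<And>a. a < k \<Longrightarrow> diag_error a \<longlonglongrightarrow> 0"
  shows "avg (remainder k) \<longlonglongrightarrow> 0"
proof -
  let ?c = semicircle_moment
  let ?G = "\<lambda>n j \<omega>. P n (Suc k) j j \<omega> - ?c (Suc k)"
  define R1 where "R1 a n j l \<omega> = (P n a l l \<omega> - ?c a) * (P n (k - 1 - a) j j \<omega> * ?G n j \<omega>)" for a n j l \<omega>
  define R2 where "R2 a n j l \<omega> = (P n (k - 1 - a) j j \<omega> - ?c (k - 1 - a)) * (?c a * ?G n j \<omega>)" for a n and j l :: nat and \<omega>
  define R3 where "R3 a n j l \<omega> = P n a l j \<omega> * (offdiag j l * P n (k - 1 - a) l j \<omega> * ?G n j \<omega>)" for a n j l \<omega>
  define R4 where "R4 n j l \<omega> = P n k l j \<omega> * (\<Sum>a<Suc k. P n a j l \<omega> * P n (k - a) j j \<omega>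
      + offdiag j l * (P n a j j \<omega> * P n (k - a) l j \<omega>))" for n j l \<omega>
  have R: "remainder k = (\<lambda>n j l \<omega>. (\<Sum>a<k. R1 a n j l \<omega> + (R2 a n j l \<omega> + R3 a n j l \<omega>)) + R4 n j l \<omega>)"
    unfolding remainder_def[abs_def] R1_def R2_def R3_def R4_def ..
  have bP: "bounded_moments (\<lambda>n j l. P n a l j)" for a by (rule bounded_moments_P) simp
  have b: "bounded_moments (R1 a)" "bounded_moments (R2 a)" "bounded_moments (R3 a)" "bounded_moments R4" for a
    unfolding R1_def[abs_def] R2_def[abs_def] R3_def[abs_def] R4_def[abs_def]
    by (intro bounded_moments_intros; simp)+
  have "avg (R1 a) \<longlonglongrightarrow> 0" if "a < k" for a
    unfolding R1_def[abs_def]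
    by (rule avg_product_tendsto_0[OF bounded_moments_diag(2) _ avg_diag_tendsto_0(2)[OF assms[OF that]]])
       (intro bounded_moments_intros; simp)
  moreover have "avg (R2 a) \<longlonglongrightarrow> 0" if "a < k" for a
  proof -
    have "k - 1 - a < k" using that by simp
    show ?thesis
      unfolding R2_def[abs_def]
      by (rule avg_product_tendsto_0[OF bounded_moments_diag(1) _ avg_diag_tendsto_0(1)[OF assms[OF \<open>k - 1 - a < k\<close>]]])
         (intro bounded_moments_intros; simp)
  qed
  moreover have "avg (R3 a) \<longlonglongrightarrow> 0" for a
    unfolding R3_def[abs_def]
    by (rule avg_product_tendsto_0[OF bP _ avg_off_diagonal_square]) (intro bounded_moments_intros; simp)
  moreover have "avg R4 \<longlonglongrightarrow> 0"
    unfolding R4_def[abs_def]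
    by (rule avg_product_tendsto_0[OF bP _ avg_off_diagonal_square]) (intro bounded_moments_intros; simp)
  ultimately show ?thesis
    unfolding R by (intro avg_add_tendsto_0 avg_sum_tendsto_0 bounded_moments_add bounded_moments_sum b) auto
qed

text \<open>With c the limit and g the deviation, E[g^2] is E[(W^(k+1))_jj g] minus c E[g]. The main
  term of the integration by parts is c E[g] times the row sum, so what survives besides the
  remainder is proportional to the row sum minus 1.\<close>

lemma diag_ibp:
  assumes j: "j \<in> {1..n}"
  shows "expectation (\<lambda>\<omega>. (P n (Suc k) j j \<omega> - semicircle_moment (Suc k))\<^sup>2)
     = (\<Sum>l=1..n. v n (edge j l) * expectation (remainder k n j l))
       + semicircle_moment (Suc k) * (((\<Sum>l=1..n. v n (edge j l)) - 1)
           * expectation (\<lambda>\<omega>. P n (Suc k) j j \<omega> - semicircle_moment (Suc k)))"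
proof -
  let ?c = semicircle_moment
  let ?g = "\<lambda>x. wpow n x (Suc k) j j - ?c (Suc k)"
  let ?G = "\<lambda>\<omega>. P n (Suc k) j j \<omega> - ?c (Suc k)"
  let ?Q = "\<lambda>l x. (\<Sum>a<k. wpow n x a l l * wpow n x (k - 1 - a) j j + offdiag j l * (wpow n x a l j * wpow n x (k - 1 - a) l j)) * ?g x
      + wpow n x k l j * (\<Sum>a<Suc k. wpow n x a j l * wpow n x (Suc k - 1 - a) j j + offdiag j l * (wpow n x a j j * wpow n x (Suc k - 1 - a) l j))"
  have iG: "integrable M ?G"
    by (rule bounded_moments_integrable[OF bounded_moments_diag(1) j j])
  have iR: "integrable M (remainder k n j l)" if "l \<in> {1..n}" for l
    by (rule bounded_moments_integrable[OF bounded_moments_remainder j that])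
  have each: "integrable M (\<lambda>\<omega>. X n (edge j l) \<omega> * (P n k l j \<omega> * ?G \<omega>)) \<and>
     expectation (\<lambda>\<omega>. X n (edge j l) \<omega> * (P n k l j \<omega> * ?G \<omega>))
       = v n (edge j l) * (expectation (remainder k n j l) + ?c (Suc k) * expectation ?G)"
    if l: "l \<in> {1..n}" for l
  proof -
    \<comment> \<open>Reading the variable as \<open>edge l j\<close> makes the derivative of
      (W^k)_lj begin with (W^a)_ll (W^b)_jj, the product of diagonal entries.\<close>
    have d: "pder (upper_indices n) (edge j l) (\<lambda>x. wpow n x k l j * ?g x) (?Q l)"
      unfolding edge_commute[of j l] offdiag_def
      by (intro pder_mult pder_diff_const pder_wpow j l)
    note ibp = W.gaussian_integration_by_parts[OF edge_upper[OF j l] d]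
    have "?Q l (\<lambda>e. X n e \<omega>) = remainder k n j l \<omega> + ?c (Suc k) * ?G \<omega>" for \<omega>
    proof -
      \<comment> \<open>Telescoping p q = (p - c) q + (q - d) c + c d, multiplied by G; the last
        product is the main term.\<close>
      have alg: "(p * q + o' * (r * r')) * G = (p - c) * (q * G) + ((q - d) * (c * G) + r * (o' * r' * G)) + c * d * G"
        for p q o' r r' G c d :: real by (simp add: algebra_simps)
      let ?p = "\<lambda>a. P n a l l \<omega>" and ?q = "\<lambda>a. P n a j j \<omega>" and ?r = "\<lambda>a. P n a l j \<omega>"
      have "(\<Sum>a<k. ?p a * ?q (k - 1 - a) + offdiag j l * (?r a * ?r (k - 1 - a))) * ?G \<omega>
        = (\<Sum>a<k. (?p a - ?c a) * (?q (k - 1 - a) * ?G \<omega>)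
            + ((?q (k - 1 - a) - ?c (k - 1 - a)) * (?c a * ?G \<omega>) + ?r a * (offdiag j l * ?r (k - 1 - a) * ?G \<omega>)))
          + (\<Sum>a<k. ?c a * ?c (k - 1 - a)) * ?G \<omega>"
        unfolding sum_distrib_right sum.distrib[symmetric] by (intro sum.cong refl alg)
      then show ?thesis unfolding remainder_def semicircle_moment_Suc[of k] by simp
    qed
    then have "expectation (\<lambda>\<omega>. ?Q l (\<lambda>e. X n e \<omega>)) = expectation (remainder k n j l) + ?c (Suc k) * expectation ?G"
      using iR[OF l] iG by (simp only: Bochner_Integration.integral_add integrable_mult_right integral_mult_right_zero)
    then show ?thesis using ibp(3,4) by simp
  qed
  have iPG: "integrable M (\<lambda>\<omega>. P n (Suc k) j j \<omega> * ?G \<omega>)"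
    by (rule bounded_moments_integrable[of "\<lambda>n j l \<omega>. P n (Suc k) j j \<omega> * (P n (Suc k) j j \<omega> - ?c (Suc k))", OF _ j j])
       (intro bounded_moments_intros; simp)
  have "P n (Suc k) j j \<omega> * ?G \<omega> = (\<Sum>l=1..n. X n (edge j l) \<omega> * (P n k l j \<omega> * ?G \<omega>))" for \<omega>
    unfolding wpow.simps(2)[of n _ k j j] sum_distrib_right by (simp only: mult.assoc)
  then have "expectation (\<lambda>\<omega>. P n (Suc k) j j \<omega> * ?G \<omega>)
     = (\<Sum>l=1..n. v n (edge j l) * (expectation (remainder k n j l) + ?c (Suc k) * expectation ?G))"
    using each by (simp only: Bochner_Integration.integral_sum cong: sum.cong)
  moreover have "expectation (\<lambda>\<omega>. (?G \<omega>)\<^sup>2) = expectation (\<lambda>\<omega>. P n (Suc k) j j \<omega> * ?G \<omega>) - ?c (Suc k) * expectation ?G"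
  proof -
    have "(?G \<omega>)\<^sup>2 = P n (Suc k) j j \<omega> * ?G \<omega> - ?c (Suc k) * ?G \<omega>" for \<omega>
      by (simp only: power2_eq_square left_diff_distrib)
    then show ?thesis using iPG iG
      by (simp only: Bochner_Integration.integral_diff integrable_mult_right integral_mult_right_zero)
  qed
  ultimately show ?thesis
    by (simp only: sum.distrib distrib_left sum_distrib_right[symmetric]) (simp only: algebra_simps)
qed

theorem diag_error_tendsto_0: "diag_error k \<longlonglongrightarrow> 0"
proof (induction k rule: less_induct)
  case (less k)
  show ?case
  proof (cases k)
    case 0
    then show ?thesis by (simp add: diag_error_def[abs_def])
  next
    case (Suc k')
    let ?c = "semicircle_moment (Suc k')"
    let ?E = "\<lambda>n j. expectation (\<lambda>\<omega>. P n (Suc k') j j \<omega> - ?c)"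
    let ?B = "\<lambda>n j. (\<Sum>l=1..n. v n (edge j l)) - 1"
    define K where "K = moment_const T (Suc k') + \<bar>?c\<bar>"
    have E: "\<bar>?E n j\<bar> \<le> K" if j: "j \<in> {1..n}" for n j
    proof -
      have "?E n j = expectation (P n (Suc k') j j) - ?c"
        using W.wpow_power_integrable(1)[OF j j, of "Suc k'" 1] prob_space
        by (simp add: Bochner_Integration.integral_diff)
      then show ?thesis
        using W.wpow_power_integrable(2)[OF j j, of "Suc k'" 1] unfolding K_def
        by simp
    qed
    have eq: "diag_error k n = avg (remainder k') n + ?c * (1 / real n * (\<Sum>j=1..n. ?B n j * ?E n j))" for n
    proof -
      have "diag_error k n = 1 / real n * (\<Sum>j=1..n. (\<Sum>l=1..n. v n (edge j l) * expectation (remainder k' n j l))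
         + ?c * (?B n j * ?E n j))"
        unfolding diag_error_def Suc
        by (intro arg_cong[where f = "\<lambda>t. 1 / real n * t"] sum.cong refl diag_ibp)
      then show ?thesis
        unfolding avg_def by (simp only: sum.distrib distrib_left sum_distrib_left[symmetric] mult.left_commute)
    qed
    \<comment> \<open>The expectations \<open>?E\<close> are uniformly bounded, so the defects of
      the row sums enter through their mean absolute value, which tends to 0 by condition
      (b).\<close>
    have "(\<lambda>n. 1 / real n * (\<Sum>j=1..n. ?B n j * ?E n j)) \<longlonglongrightarrow> 0"
    proof (rule Lim_null_comparison)
      show "\<forall>\<^sub>F n in sequentially. norm (1 / real n * (\<Sum>j=1..n. ?B n j * ?E n j))
          \<le> K * (1 / real n * (\<Sum>j=1..n. \<bar>?B n j\<bar>))"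
      proof (rule always_eventually, rule allI)
        fix n
        have "norm (1 / real n * (\<Sum>j=1..n. ?B n j * ?E n j)) \<le> 1 / real n * (\<Sum>j=1..n. \<bar>?B n j\<bar> * K)"
          unfolding real_norm_def abs_mult[of "1 / real n"]
          by (intro mult_mono order_trans[OF sum_abs] sum_mono)
             (auto simp only: abs_mult intro!: mult_left_mono E sum_nonneg, auto)
        also have "\<dots> = K * (1 / real n * (\<Sum>j=1..n. \<bar>?B n j\<bar>))"
          unfolding sum_distrib_right[symmetric] by simp
        finally show "norm (1 / real n * (\<Sum>j=1..n. ?B n j * ?E n j)) \<le> K * (1 / real n * (\<Sum>j=1..n. \<bar>?B n j\<bar>))" .
      qed
      show "(\<lambda>n. K * (1 / real n * (\<Sum>j=1..n. \<bar>?B n j\<bar>))) \<longlonglongrightarrow> 0"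
        using tendsto_mult[OF tendsto_const rows_to_1, of K] by simp
    qed
    then have "(\<lambda>n. avg (remainder k') n + ?c * (1 / real n * (\<Sum>j=1..n. ?B n j * ?E n j))) \<longlonglongrightarrow> 0 + ?c * 0"
      using less.IH Suc by (intro tendsto_intros remainder_tendsto_0) auto
    then show ?thesis unfolding eq[abs_def] by simp
  qed
qed

text \<open>Cauchy-Schwarz over the index j and again over the probability space bounds the
  deviation of the expected normalised trace by the square root of
  \<open>diag_error\<close>.\<close>

theorem trace_moments_tendsto:
  "(\<lambda>n. expectation (\<lambda>\<omega>. 1 / real n * (\<Sum>j=1..n. P n k j j \<omega>))) \<longlonglongrightarrow> semicircle_moment k"
proof -
  let ?c = "semicircle_moment k"
  have i: "integrable M (\<lambda>\<omega>. P n k j j \<omega>)" if "j \<in> {1..n}" for n j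
    using W.wpow_power_integrable(1)[OF that that, of k 1] by simp
  have eq: "\<bar>expectation (\<lambda>\<omega>. 1 / real n * (\<Sum>j=1..n. P n k j j \<omega>)) - ?c\<bar> \<le> sqrt (diag_error k n)" if n: "n > 0" for n
  proof -
    have iD: "integrable M (\<lambda>\<omega>. P n k j j \<omega> - ?c)" and iD2: "integrable M (\<lambda>\<omega>. (P n k j j \<omega> - ?c)\<^sup>2)"
      if "j \<in> {1..n}" for j
      using bounded_moments_integrable[OF bounded_moments_diag(1) that that]
        bounded_moments_square_integrable[OF bounded_moments_diag(1) that that] by auto
    have cs: "\<bar>\<Sum>j=1..n. 1 / real n * y j\<bar>\<^sup>2 \<le> (\<Sum>j=1..n. 1 / real n * (y j)\<^sup>2)" for y :: "nat \<Rightarrow> real"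
    proof -
      have "(\<Sum>j=1..n. y j)\<^sup>2 \<le> real n * (\<Sum>j=1..n. (y j)\<^sup>2)"
        using Cauchy_Schwarz_ineq_sum[of "\<lambda>_. 1" y "{1..n}"] by simp
      then have "(1 / real n)\<^sup>2 * (\<Sum>j=1..n. y j)\<^sup>2 \<le> (1 / real n)\<^sup>2 * (real n * (\<Sum>j=1..n. (y j)\<^sup>2))"
        by (intro mult_left_mono) auto
      also have "\<dots> = 1 / real n * (\<Sum>j=1..n. (y j)\<^sup>2)" using n by (simp add: power2_eq_square)
      finally show ?thesis
        unfolding sum_distrib_left[symmetric] power2_abs power_mult_distrib .
    qed
    have "expectation (\<lambda>\<omega>. 1 / real n * (\<Sum>j=1..n. P n k j j \<omega>)) = 1 / real n * (\<Sum>j=1..n. expectation (P n k j j))"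
      using i by simp
    moreover have "(\<Sum>j=1..n. 1 / real n * expectation (\<lambda>\<omega>. P n k j j \<omega> - ?c))
        = 1 / real n * (\<Sum>j=1..n. expectation (P n k j j) - ?c)"
      unfolding sum_distrib_left[symmetric] using i prob_space
      by (intro arg_cong[where f = "\<lambda>t. 1 / real n * t"] sum.cong refl) simp
    moreover have "\<dots> = 1 / real n * (\<Sum>j=1..n. expectation (P n k j j)) - ?c"
      using n by (simp add: sum_subtractf right_diff_distrib)
    ultimately have "expectation (\<lambda>\<omega>. 1 / real n * (\<Sum>j=1..n. P n k j j \<omega>)) - ?c
        = (\<Sum>j=1..n. 1 / real n * expectation (\<lambda>\<omega>. P n k j j \<omega> - ?c))"
      by linarith
    also have "\<bar>\<dots>\<bar>\<^sup>2 \<le> (\<Sum>j=1..n. 1 / real n * (expectation (\<lambda>\<omega>. P n k j j \<omega> - ?c))\<^sup>2)"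
      by (rule cs)
    also have "\<dots> \<le> (\<Sum>j=1..n. 1 / real n * expectation (\<lambda>\<omega>. (P n k j j \<omega> - ?c)\<^sup>2))"
    proof (intro sum_mono mult_left_mono)
      fix j assume "j \<in> {1..n}"
      from variance_eq[OF iD[OF this] iD2[OF this]]
        variance_positive[of "\<lambda>\<omega>. P n k j j \<omega> - ?c"]
      show "(expectation (\<lambda>\<omega>. P n k j j \<omega> - ?c))\<^sup>2 \<le> expectation (\<lambda>\<omega>. (P n k j j \<omega> - ?c)\<^sup>2)"
        by linarith
    qed simp
    also have "\<dots> = diag_error k n" unfolding diag_error_def by (simp add: sum_distrib_left)
    finally show ?thesis by (rule real_le_rsqrt)
  qed
  have "diag_error k \<longlonglongrightarrow> 0" by (rule diag_error_tendsto_0)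
  from tendsto_real_sqrt[OF this] have "(\<lambda>n. sqrt (diag_error k n)) \<longlonglongrightarrow> 0" by simp
  moreover have "\<forall>\<^sub>F n in sequentially.
      norm (expectation (\<lambda>\<omega>. 1 / real n * (\<Sum>j=1..n. P n k j j \<omega>)) - ?c) \<le> sqrt (diag_error k n)"
    unfolding real_norm_def by (rule eventually_mono[OF eventually_gt_at_top[of 0] eq])
  ultimately have "(\<lambda>n. expectation (\<lambda>\<omega>. 1 / real n * (\<Sum>j=1..n. P n k j j \<omega>)) - ?c) \<longlonglongrightarrow> 0"
    by (rule Lim_null_comparison[rotated])
  then show ?thesis by (rule LIM_zero_cancel)
qed

end

section \<open>The semicircle law\<close>

text \<open>Library indices start at 0, hence the successors. Library powers grow on the right and
  \<open>wpow\<close> on the left; \<open>wpow_Suc_right\<close> reconciles them.\<close>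

lemma mat_power_eq_wpow:
  assumes A: "A \<in> carrier_mat n n"
    and entry: "\<And>i j. i < n \<Longrightarrow> j < n \<Longrightarrow> A $$ (i, j) = x (edge (Suc i) (Suc j))"
    and i: "i < n" and j: "j < n"
  shows "(A ^\<^sub>m k) $$ (i, j) = wpow n x k (Suc i) (Suc j)"
  using i j
proof (induction k arbitrary: i j)
  case 0
  then show ?case using A by simp
next
  case (Suc k)
  have Ak: "A ^\<^sub>m k \<in> carrier_mat n n" using A by simp
  have "(A ^\<^sub>m Suc k) $$ (i, j) = (\<Sum>l<n. (A ^\<^sub>m k) $$ (i, l) * A $$ (l, j))"
    using A Ak Suc.prems by (simp add: scalar_prod_def lessThan_atLeast0)
  also have "\<dots> = (\<Sum>l<n. wpow n x k (Suc i) (Suc l) * x (edge (Suc l) (Suc j)))"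
    using Suc entry by (intro sum.cong) auto
  also have "\<dots> = (\<Sum>l=1..n. wpow n x k (Suc i) l * x (edge l (Suc j)))"
    by (simp only: One_nat_def sum.atLeast1_atMost_eq)
  also have "\<dots> = wpow n x (Suc k) (Suc i) (Suc j)"
    using Suc.prems by (intro wpow_Suc_right[symmetric]) auto
  finally show ?case .
qed

section \<open>The rescaled array\<close>

locale gaussian_array = prob_space M for M :: "'a measure" +
  fixes Y :: "nat \<Rightarrow> nat \<Rightarrow> 'a \<Rightarrow> real" and \<sigma> :: "nat \<Rightarrow> nat \<Rightarrow> real"
  assumes Y_sym: "\<And>i j. 1 \<le> i \<Longrightarrow> i < j \<Longrightarrow> Y j i = Y i j"
    and \<sigma>_sym: "\<And>i j. 1 \<le> i \<Longrightarrow> i < j \<Longrightarrow> \<sigma> j i = \<sigma> i j"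
    and indep: "\<And>n. indep_vars (\<lambda>_. borel) (\<lambda>(i, j). Y i j) {(i, j). 1 \<le> i \<and> i \<le> j \<and> j \<le> n}"
    and gauss: "\<And>i j. 1 \<le> i \<Longrightarrow> i \<le> j \<Longrightarrow> gaussian_rv M (Y i j)"
    and mean: "\<And>i j. 1 \<le> i \<Longrightarrow> i \<le> j \<Longrightarrow> expectation (Y i j) = 0"
    and var: "\<And>i j. 1 \<le> i \<Longrightarrow> i \<le> j \<Longrightarrow> expectation (\<lambda>\<omega>. (Y i j \<omega>)\<^sup>2) = (\<sigma> i j)\<^sup>2"
begin

definition entry :: "nat \<Rightarrow> nat \<times> nat \<Rightarrow> 'a \<Rightarrow> real" where
  "entry n e \<omega> = Y (fst e) (snd e) \<omega> / sqrt (real n)"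

definition entry_var :: "nat \<Rightarrow> nat \<times> nat \<Rightarrow> real" where
  "entry_var n e = (\<sigma> (fst e) (snd e))\<^sup>2 / real n"

lemma Y_edge: "1 \<le> i \<Longrightarrow> 1 \<le> j \<Longrightarrow> Y (fst (edge i j)) (snd (edge i j)) = Y i j"
  using Y_sym[of i j] Y_sym[of j i] by (cases i j rule: linorder_cases) (simp_all add: edge_def)

lemma \<sigma>_edge: "1 \<le> i \<Longrightarrow> 1 \<le> j \<Longrightarrow> \<sigma> (fst (edge i j)) (snd (edge i j)) = \<sigma> i j"
  using \<sigma>_sym[of i j] \<sigma>_sym[of j i] by (cases i j rule: linorder_cases) (simp_all add: edge_def)

text \<open>B_j^2 is a row sum of variances of W, so conditions (b) and (c) become statements on row
  sums.\<close>

lemma row_norm_square: "j \<in> {1..n} \<Longrightarrow> (row_norm \<sigma> n j)\<^sup>2 = (\<Sum>l=1..n. entry_var n (edge j l))"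
  unfolding row_norm_def entry_var_def
  by (simp add: sum_nonneg sum_divide_distrib \<sigma>_edge)

lemma gaussian_matrix_entries:
  assumes C: "\<And>n j. j \<in> {1..n} \<Longrightarrow> row_norm \<sigma> n j \<le> C"
  shows "gaussian_matrix M n (entry n) (entry_var n) (C\<^sup>2)"
proof (unfold_locales)
  show "finite (upper_indices n)" by (rule finite_upper_indices)
  have "indep_vars (\<lambda>_. borel) (\<lambda>e. (\<lambda>y. y / sqrt (real n)) \<circ> (\<lambda>(i, j). Y i j) e) (upper_indices n)"
    unfolding upper_indices_def by (rule indep_vars_compose[OF indep]) simp
  then show "indep_vars (\<lambda>_. borel) (entry n) (upper_indices n)"
    by (simp add: entry_def[abs_def] o_def case_prod_beta)
next
  fix e :: "nat \<times> nat" and k :: nat assume e: "e \<in> upper_indices n"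
  then have ij: "1 \<le> fst e" "fst e \<le> snd e" and n: "n > 0" unfolding upper_indices_def by auto
  note m = centred_gaussian_moments[OF gauss[OF ij] mean[OF ij] var[OF ij]]
  show "integrable M (\<lambda>\<omega>. entry n e \<omega> ^ k)"
    unfolding entry_def power_divide using m(1)[of k] by simp
  show "expectation (\<lambda>\<omega>. entry n e \<omega> ^ Suc k) = entry_var n e * real k * expectation (\<lambda>\<omega>. entry n e \<omega> ^ (k - 1))"
  \<comment> \<open>At k = 0 the exponent k - 1 is truncated, and centring makes both sides 0.
    Otherwise k + 1 exceeds k - 1 by two, and the two extra powers of sqrt n are the factor n that
    scales the variance.\<close>
  proof (cases k)
    case 0
    then show ?thesis using mean[OF ij] by (simp add: entry_def)
  next
    case (Suc k')
    have "sqrt (real n) ^ Suc k = real n * sqrt (real n) ^ k'" using Suc n by simp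
    then show ?thesis
      unfolding entry_def power_divide using m(2)[of k] Suc by (simp add: entry_var_def)
  qed
next
  fix e :: "nat \<times> nat" show "0 \<le> entry_var n e" unfolding entry_var_def by simp
next
  fix j assume j: "j \<in> {1..n}"
  have "0 \<le> row_norm \<sigma> n j" unfolding row_norm_def by (intro real_sqrt_ge_zero mult_nonneg_nonneg sum_nonneg) auto
  then show "(\<Sum>l=1..n. entry_var n (edge j l)) \<le> C\<^sup>2"
    unfolding row_norm_square[OF j, symmetric] using C[OF j] by (intro power_mono)
qed simp

text \<open>The part of the second moment below t is at most t^2, a quarter of the variance at most;
  three quarters lie in the truncated moment, hence 4 / 3.\<close>

lemma truncated_second_moment:
  assumes ij: "1 \<le> i" "i \<le> j" and t: "4 * t\<^sup>2 \<le> (\<sigma> i j)\<^sup>2" "t \<ge> 0"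
  shows "(\<sigma> i j)\<^sup>2 \<le> 4 / 3 * expectation (\<lambda>\<omega>. \<bar>Y i j \<omega>\<bar>\<^sup>2 * indicat_real {\<omega>. \<bar>Y i j \<omega>\<bar> \<ge> t} \<omega>)"
proof -
  have Y[measurable]: "Y i j \<in> borel_measurable M" using gauss[OF ij] unfolding gaussian_rv_def by blast
  note m = centred_gaussian_moments[OF gauss[OF ij] mean[OF ij] var[OF ij]]
  have i2: "integrable M (\<lambda>\<omega>. (Y i j \<omega>)\<^sup>2)" by (rule m(1))
  let ?Z = "\<lambda>\<omega>. \<bar>Y i j \<omega>\<bar>\<^sup>2 * indicat_real {\<omega>. \<bar>Y i j \<omega>\<bar> \<ge> t} \<omega>"
  have ind: "?Z = (\<lambda>\<omega>. if \<bar>Y i j \<omega>\<bar> \<ge> t then (Y i j \<omega>)\<^sup>2 else 0)"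
    by (auto simp: indicator_def)
  have iZ: "integrable M ?Z"
    unfolding ind by (rule Bochner_Integration.integrable_bound[OF i2]) auto
  have "(\<sigma> i j)\<^sup>2 = expectation (\<lambda>\<omega>. (Y i j \<omega>)\<^sup>2)" using var[OF ij] by simp
  also have "\<dots> \<le> expectation (\<lambda>\<omega>. ?Z \<omega> + t\<^sup>2)"
  proof (rule integral_mono[OF i2])
    fix \<omega> show "(Y i j \<omega>)\<^sup>2 \<le> ?Z \<omega> + t\<^sup>2"
    proof (cases "\<bar>Y i j \<omega>\<bar> \<ge> t")
      case False
      then have "\<bar>Y i j \<omega>\<bar>\<^sup>2 \<le> t\<^sup>2" by (intro power_mono) auto
      then show ?thesis using False by (simp add: indicator_def)
    qed simp
  qed (use iZ in simp)
  also have "\<dots> = expectation ?Z + t\<^sup>2" using iZ prob_space by simp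
  finally show ?thesis using t by simp
qed

text \<open>A rescaled variance above \<epsilon> means a variance above \<epsilon> n for the entry
  of Y. The level \<open>sqrt \<epsilon> / 2\<close> is chosen so that four times the squared
  threshold is exactly \<epsilon> n.\<close>

lemma large_variances_le_lindeberg_fraction:
  assumes \<epsilon>: "\<epsilon> > 0"
  shows "1 / real n * (\<Sum>j=1..n. \<Sum>l=1..n. if entry_var n (edge j l) > \<epsilon> then entry_var n (edge j l) else 0)
    \<le> 4 / 3 * lindeberg_fraction M Y n (sqrt \<epsilon> / 2)"
proof -
  let ?t = "sqrt \<epsilon> / 2 * sqrt (real n)"
  let ?Z = "\<lambda>j l. expectation (\<lambda>\<omega>. \<bar>Y j l \<omega>\<bar>\<^sup>2 * indicat_real {\<omega>. \<bar>Y j l \<omega>\<bar> \<ge> ?t} \<omega>)"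
  have t2: "4 * ?t\<^sup>2 = \<epsilon> * real n" using \<epsilon> by (simp add: power_mult_distrib power_divide)
  have each: "(if entry_var n (edge j l) > \<epsilon> then entry_var n (edge j l) else 0) \<le> 1 / real n * (4 / 3 * ?Z j l)"
    if jl: "j \<in> {1..n}" "l \<in> {1..n}" for j l
  proof (cases "entry_var n (edge j l) > \<epsilon>")
    case False
    have "?Z j l \<ge> 0" by (intro Bochner_Integration.integral_nonneg) simp
    then show ?thesis using False by simp
  next
    case True
    let ?i = "fst (edge j l)" and ?k = "snd (edge j l)"
    have ik: "1 \<le> ?i" "?i \<le> ?k" and n: "n > 0" using jl by (auto simp: edge_def)
    have "\<epsilon> * real n \<le> (\<sigma> ?i ?k)\<^sup>2" using True n by (simp add: entry_var_def pos_less_divide_eq)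
    then have "(\<sigma> ?i ?k)\<^sup>2 \<le> 4 / 3 * expectation (\<lambda>\<omega>. \<bar>Y ?i ?k \<omega>\<bar>\<^sup>2 * indicat_real {\<omega>. \<bar>Y ?i ?k \<omega>\<bar> \<ge> ?t} \<omega>)"
      using \<epsilon> by (intro truncated_second_moment ik) (simp_all only: t2, simp)
    also have "\<dots> = 4 / 3 * ?Z j l" using jl by (simp only: Y_edge atLeastAtMost_iff)
    finally have "(\<sigma> ?i ?k)\<^sup>2 / real n \<le> 4 / 3 * ?Z j l / real n" by (intro divide_right_mono) auto
    then show ?thesis using True by (simp add: entry_var_def)
  qed
  have "1 / real n * (\<Sum>j=1..n. \<Sum>l=1..n. if entry_var n (edge j l) > \<epsilon> then entry_var n (edge j l) else 0)
     \<le> 1 / real n * (\<Sum>j=1..n. \<Sum>l=1..n. 1 / real n * (4 / 3 * ?Z j l))"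
    by (intro mult_left_mono sum_mono each) auto
  also have "\<dots> = 4 / 3 * lindeberg_fraction M Y n (sqrt \<epsilon> / 2)"
    unfolding lindeberg_fraction_def sum_distrib_left[symmetric] by (simp add: power2_eq_square)
  finally show ?thesis .
qed

lemma gaussian_matrix_sequence_entries:
  assumes a: "\<And>\<tau>. \<tau> > 0 \<Longrightarrow> (\<lambda>n. lindeberg_fraction M Y n \<tau>) \<longlonglongrightarrow> 0"
    and b: "(\<lambda>n. 1 / real n * (\<Sum>i=1..n. \<bar>(row_norm \<sigma> n i)\<^sup>2 - 1\<bar>)) \<longlonglongrightarrow> 0"
    and C: "\<And>n j. j \<in> {1..n} \<Longrightarrow> row_norm \<sigma> n j \<le> C"
  shows "gaussian_matrix_sequence M entry entry_var (C\<^sup>2)"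
proof (intro gaussian_matrix_sequence.intro gaussian_matrix_sequence_axioms.intro prob_space_axioms)
  show "gaussian_matrix M n (entry n) (entry_var n) (C\<^sup>2)" for n by (rule gaussian_matrix_entries[OF C])
  have "(\<Sum>i=1..n. \<bar>(row_norm \<sigma> n i)\<^sup>2 - 1\<bar>) = (\<Sum>j=1..n. \<bar>(\<Sum>l=1..n. entry_var n (edge j l)) - 1\<bar>)" for n
    by (intro sum.cong refl) (simp only: row_norm_square)
  then show "(\<lambda>n. 1 / real n * (\<Sum>j=1..n. \<bar>(\<Sum>l=1..n. entry_var n (edge j l)) - 1\<bar>)) \<longlonglongrightarrow> 0"
    using b by simp
  fix \<epsilon> :: real assume \<epsilon>: "\<epsilon> > 0"
  let ?L = "\<lambda>n. 1 / real n * (\<Sum>j=1..n. \<Sum>l=1..n. if entry_var n (edge j l) > \<epsilon> then entry_var n (edge j l) else 0)"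
  have "(\<lambda>n. 4 / 3 * lindeberg_fraction M Y n (sqrt \<epsilon> / 2)) \<longlonglongrightarrow> 4 / 3 * 0"
    using \<epsilon> by (intro tendsto_intros a) simp
  then have lim: "(\<lambda>n. 4 / 3 * lindeberg_fraction M Y n (sqrt \<epsilon> / 2)) \<longlonglongrightarrow> 0" by simp
  have nonneg: "0 \<le> ?L n" for n
    using \<epsilon> by (intro mult_nonneg_nonneg sum_nonneg) auto
  show "?L \<longlonglongrightarrow> 0"
    by (rule tendsto_sandwich[OF always_eventually always_eventually tendsto_const lim])
       (intro allI nonneg large_variances_le_lindeberg_fraction \<epsilon>)+
qed

definition scaled_matrix :: "nat \<Rightarrow> 'a \<Rightarrow> real mat" where
  "scaled_matrix n \<omega> = (1 / sqrt (real n)) \<cdot>\<^sub>m random_matrix Y n \<omega>"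

abbreviation eigenvalue_list :: "nat \<Rightarrow> 'a \<Rightarrow> nat \<Rightarrow> real" where
  "eigenvalue_list n \<omega> i \<equiv> ordered_eigenvalues (scaled_matrix n \<omega>) ! i"

lemma scaled_matrix_carrier: "scaled_matrix n \<omega> \<in> carrier_mat n n"
  unfolding scaled_matrix_def random_matrix_def by simp

lemma scaled_matrix_entry:
  assumes "i < n" "j < n"
  shows "scaled_matrix n \<omega> $$ (i, j) = entry n (edge (Suc i) (Suc j)) \<omega>"
  unfolding scaled_matrix_def random_matrix_def entry_def using assms by (simp add: Y_edge)

lemma scaled_matrix_symmetric:
  assumes "i < n" "j < n"
  shows "scaled_matrix n \<omega> $$ (j, i) = scaled_matrix n \<omega> $$ (i, j)"
  using assms by (simp add: scaled_matrix_entry edge_commute)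

text \<open>Here the two descriptions of the trace of a power meet: by eigenvalues, and by the
  polynomials whose expectations have been computed in the limit.\<close>

lemma eigenvalue_power_sum:
  "(\<Sum>i<n. eigenvalue_list n \<omega> i ^ k) = (\<Sum>j=1..n. wpow n (\<lambda>e. entry n e \<omega>) k j j)"
proof -
  have "(\<Sum>i<n. eigenvalue_list n \<omega> i ^ k) = (\<Sum>i<n. (scaled_matrix n \<omega> ^\<^sub>m k) $$ (i, i))"
    by (rule symmetric_ordered_eigenvalues(2)[OF scaled_matrix_carrier scaled_matrix_symmetric])
  also have "\<dots> = (\<Sum>i<n. wpow n (\<lambda>e. entry n e \<omega>) k (Suc i) (Suc i))"
    by (intro sum.cong refl mat_power_eq_wpow[OF scaled_matrix_carrier scaled_matrix_entry]) auto
  finally show ?thesis by (simp only: One_nat_def sum.atLeast1_atMost_eq)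
qed

lemma eigenvalue_list_sorted:
  assumes "i \<le> j" "j < n"
  shows "eigenvalue_list n \<omega> i \<le> eigenvalue_list n \<omega> j"
  using assms symmetric_ordered_eigenvalues(1)[OF scaled_matrix_carrier scaled_matrix_symmetric]
  by (intro sorted_nth_mono sorted_ordered_eigenvalues) auto

theorem semicircle_law:
  assumes a: "\<And>\<tau>. \<tau> > 0 \<Longrightarrow> (\<lambda>n. lindeberg_fraction M Y n \<tau>) \<longlonglongrightarrow> 0"
    and b: "(\<lambda>n. 1 / real n * (\<Sum>i=1..n. \<bar>(row_norm \<sigma> n i)\<^sup>2 - 1\<bar>)) \<longlonglongrightarrow> 0"
    and C: "\<And>n j. j \<in> {1..n} \<Longrightarrow> row_norm \<sigma> n j \<le> C"
  shows "(\<lambda>n. SUP x. \<bar>expected_cdf M Y n x - semicircle_cdf x\<bar>) \<longlonglongrightarrow> 0"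
proof -
  interpret gaussian_matrix_sequence M entry entry_var "C\<^sup>2"
    by (rule gaussian_matrix_sequence_entries[OF a b C])
  let ?lam = eigenvalue_list
  have iP: "integrable M (\<lambda>\<omega>. \<Sum>j=1..n. P n k j j \<omega>)" for n k
    using W.wpow_power_integrable(1)[of _ n _ k 1] by (intro Bochner_Integration.integrable_sum) simp
  have meas: "(\<lambda>\<omega>. ?lam n \<omega> i) \<in> borel_measurable M" if "i < n" for n i
    using eigenvalue_list_sorted _ that
    by (rule sorted_measurable_of_power_sums) (use iP in \<open>simp_all add: eigenvalue_power_sum\<close>)
  have int: "integrable M (\<lambda>\<omega>. ?lam n \<omega> i ^ k)" if i: "i < n" for n i k
  proof (rule Bochner_Integration.integrable_bound)
    show "integrable M (\<lambda>\<omega>. 1 + (\<Sum>j=1..n. P n (2 * k) j j \<omega>))" using iP by simp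
    show "(\<lambda>\<omega>. ?lam n \<omega> i ^ k) \<in> borel_measurable M" using meas[OF i] by simp
    \<comment> \<open>Through |y| \<le> 1 + y^2 a power of one eigenvalue is dominated by an even
      power, and this by the trace of W^(2 k), a sum of nonnegative powers of eigenvalues.\<close>
    have "\<bar>?lam n \<omega> i ^ k\<bar> \<le> 1 + (\<Sum>j=1..n. P n (2 * k) j j \<omega>)" for \<omega>
    proof -
      have "\<bar>y\<bar> \<le> 1 + y\<^sup>2" for y :: real
      proof -
        have "0 \<le> (\<bar>y\<bar> - 1)\<^sup>2" by simp
        then have "2 * \<bar>y\<bar> \<le> 1 + y\<^sup>2" by (simp add: power2_diff)
        then show ?thesis by linarith
      qed
      then have "\<bar>?lam n \<omega> i ^ k\<bar> \<le> 1 + (?lam n \<omega> i ^ k)\<^sup>2" .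
      also have "(?lam n \<omega> i ^ k)\<^sup>2 = ?lam n \<omega> i ^ (2 * k)" by (simp add: power_mult[symmetric] mult.commute)
      also have "\<dots> \<le> (\<Sum>j<n. ?lam n \<omega> j ^ (2 * k))"
        using i by (intro member_le_sum) auto
      finally show ?thesis by (simp only: eigenvalue_power_sum)
    qed
    then show "AE \<omega> in M. norm (?lam n \<omega> i ^ k) \<le> norm (1 + (\<Sum>j=1..n. P n (2 * k) j j \<omega>))"
      by (intro AE_I2) (simp add: order_trans[OF _ abs_ge_self])
  qed
  \<comment> \<open>Dimension \<open>Suc n\<close> throughout: in dimension 0 there is no eigenvalue
    to draw and no probability measure. The shift is undone at the end.\<close>
  define Q where "Q n = mixture_distribution M (Suc n) (?lam (Suc n))" for n
  have Q: "real_distribution (Q n)" for n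
    unfolding Q_def by (rule real_distribution_mixture) (auto intro: meas)
  have Qk: "integrable (Q n) (\<lambda>x. x ^ k)"
    "(\<integral>x. x ^ k \<partial>Q n) = expectation (\<lambda>\<omega>. 1 / real (Suc n) * (\<Sum>j=1..Suc n. P (Suc n) k j j \<omega>))" for n k
  proof -
    show "integrable (Q n) (\<lambda>x. x ^ k)"
      unfolding Q_def by (rule mixture_integral(1)) (auto intro: meas int)
    have "(\<integral>x. x ^ k \<partial>Q n) = 1 / real (Suc n) * (\<Sum>i<Suc n. expectation (\<lambda>\<omega>. ?lam (Suc n) \<omega> i ^ k))"
      unfolding Q_def by (rule mixture_integral(2)) (auto intro: meas int)
    also have "\<dots> = 1 / real (Suc n) * expectation (\<lambda>\<omega>. \<Sum>i<Suc n. ?lam (Suc n) \<omega> i ^ k)"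
      by (subst Bochner_Integration.integral_sum) (auto intro: int)
    finally show "(\<integral>x. x ^ k \<partial>Q n) = expectation (\<lambda>\<omega>. 1 / real (Suc n) * (\<Sum>j=1..Suc n. P (Suc n) k j j \<omega>))"
      by (simp only: eigenvalue_power_sum integral_mult_right_zero)
  qed
  have cdf: "cdf (Q n) x = expected_cdf M Y (Suc n) x" for n x
  proof -
    have "cdf (Q n) x = 1 / real (Suc n) * (\<Sum>i<Suc n. expectation (\<lambda>\<omega>. indicat_real {..x} (?lam (Suc n) \<omega> i)))"
      unfolding Q_def by (rule mixture_cdf) (auto intro: meas)
    also have "\<dots> = expectation (\<lambda>\<omega>. 1 / real (Suc n) * (\<Sum>i<Suc n. indicat_real {..x} (?lam (Suc n) \<omega> i)))"
    proof -
      have "integrable M (\<lambda>\<omega>. indicat_real {..x} (?lam (Suc n) \<omega> i))" if "i < Suc n" for i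
        using meas[OF that] by (intro integrable_const_bound[of _ 1]) auto
      then have "expectation (\<lambda>\<omega>. \<Sum>i<Suc n. indicat_real {..x} (?lam (Suc n) \<omega> i))
          = (\<Sum>i<Suc n. expectation (\<lambda>\<omega>. indicat_real {..x} (?lam (Suc n) \<omega> i)))"
        by (intro Bochner_Integration.integral_sum) simp
      then show ?thesis by (simp only: integral_mult_right_zero)
    qed
    finally show ?thesis
      unfolding expected_cdf_def empirical_cdf_def scaled_matrix_def
      by (simp only: One_nat_def sum.atLeast1_atMost_eq diff_Suc_Suc minus_nat.diff_0)
  qed
  have "weak_conv_m Q semicircle_distribution"
  proof (rule weak_conv_of_moments[OF Q real_distribution_semicircle Qk(1) _ semicircle_distribution_bounded])
    fix k
    have "(\<integral>x. x ^ k \<partial>semicircle_distribution) = semicircle_moment k"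
      by (simp add: integral_semicircle_distribution semicircle_moments)
    then show "(\<lambda>n. \<integral>x. x ^ k \<partial>Q n) \<longlonglongrightarrow> (\<integral>x. x ^ k \<partial>semicircle_distribution)"
      unfolding Qk(2) using LIMSEQ_Suc[OF trace_moments_tendsto[of k]] by simp
  qed simp
  from weak_conv_imp_uniform_cdf_conv[OF Q real_distribution_semicircle this isCont_cdf_semicircle]
  have "(\<lambda>n. SUP x. \<bar>expected_cdf M Y (Suc n) x - semicircle_cdf x\<bar>) \<longlonglongrightarrow> 0"
    unfolding cdf cdf_semicircle .
  then show ?thesis by (rule LIMSEQ_imp_Suc)
qed

end

theorem theorem1p4:
  fixes M :: "'a measure"
    and Y :: "nat \<Rightarrow> nat \<Rightarrow> 'a \<Rightarrow> real"
    and \<sigma> :: "nat \<Rightarrow> nat \<Rightarrow> real"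
  assumes "prob_space M"
    and Y_sym: "\<And>i j. 1 \<le> i \<Longrightarrow> i < j \<Longrightarrow> Y j i = Y i j"
    and \<sigma>_sym: "\<And>i j. 1 \<le> i \<Longrightarrow> i < j \<Longrightarrow> \<sigma> j i = \<sigma> i j"
    and indep: "\<And>n. prob_space.indep_vars M (\<lambda>_. borel) (\<lambda>(i, j). Y i j)
                   {(i, j). 1 \<le> i \<and> i \<le> j \<and> j \<le> n}"
    and gauss: "\<And>i j. 1 \<le> i \<Longrightarrow> i \<le> j \<Longrightarrow> gaussian_rv M (Y i j)"
    and mean: "\<And>i j. 1 \<le> i \<Longrightarrow> i \<le> j \<Longrightarrow> (\<integral>\<omega>. Y i j \<omega> \<partial>M) = 0"
    and var: "\<And>i j. 1 \<le> i \<Longrightarrow> i \<le> j \<Longrightarrow> (\<integral>\<omega>. (Y i j \<omega>)\<^sup>2 \<partial>M) = (\<sigma> i j)\<^sup>2"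
    and a: "\<And>\<tau>. \<tau> > 0 \<Longrightarrow> (\<lambda>n. lindeberg_fraction M Y n \<tau>) \<longlonglongrightarrow> 0"
    and b: "(\<lambda>n. 1 / real n * (\<Sum>i=1..n. \<bar>(row_norm \<sigma> n i)\<^sup>2 - 1\<bar>)) \<longlonglongrightarrow> 0"
    and c: "\<exists>C. \<forall>n\<ge>1. (MAX i\<in>{1..n}. row_norm \<sigma> n i) \<le> C"
  shows "(\<lambda>n. SUP x. \<bar>expected_cdf M Y n x - semicircle_cdf x\<bar>) \<longlonglongrightarrow> 0"
proof -
  interpret prob_space M by fact
  interpret gaussian_array M Y \<sigma>
    by unfold_locales (fact Y_sym \<sigma>_sym indep gauss mean var)+
  obtain C where C: "\<And>n. n \<ge> 1 \<Longrightarrow> (MAX i\<in>{1..n}. row_norm \<sigma> n i) \<le> C" using c by blast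
  \<comment> \<open>The maximum is over a nonempty set only for n \<ge> 1; for n = 0 there is no
    index j.\<close>
  have "row_norm \<sigma> n j \<le> C" if "j \<in> {1..n}" for n j
  proof -
    have "row_norm \<sigma> n j \<le> (MAX i\<in>{1..n}. row_norm \<sigma> n i)" using that by (intro Max_ge) auto
    also have "\<dots> \<le> C" using that by (intro C) auto
    finally show ?thesis .
  qed
  with a b show ?thesis by (rule semicircle_law)
qed

end
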